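(* There exist a finitely generated free group $\Gamma$ and a properly discontinuous action of $\Gamma$ on $\mathrm{AdS}^3$ by isometries such that there is no fundamental domain for this action in $\mathrm{AdS}^3$ bounded by pairwise disjoint $\mathrm{AdS}$ crooked planes.
   Context: Let $\mathbb{H}^2$ be the hyperbolic plane and $\overline{\mathbb{H}^2}=\mathbb{H}^2\cup\partial_\infty\mathbb{H}^2$. Let $G=\mathrm{PGL}_2(\mathbb{R})=\mathrm{Isom}(\mathbb{H}^2)$ and $G_0=\mathrm{PSL}_2(\mathbb{R})$. Anti-de Sitter $3$-space $\mathrm{AdS}^3$ is $G_0$ with the bi-invariant Lorentzian metric induced by half the Killing form. The group $(G\times G)_+=\{(g_1,g_2)\in G\times G: g_1g_2\in G_0\}$ of orientation-preserving isometries acts by $(g_1,g_2)\cdot g=g_2gg_1^{-1}$. For a geodesic line $\ell$ of $\mathbb{H}^2$ with closure $\overline\ell\subset\overline{\mathbb{H}^2}$, let $\mathsf{C}(\ell)\subset G_0$ be the set of $h\in G_0$ having a nonrepelling fixed point in $\overline{\ell}$ (the identity fixes every point; an elliptic element has its fixed point in $\mathbb{H}^2$; a parabolic element its fixed point at infinity; for a hyperbolic element only its attracting fixed point counts as nonrepelling). A left $\mathrm{AdS}$ crooked plane is a set $g_2\mathsf{C}(\ell)g_1^{-1}$ with $g_1,g_2\in G_0$; a right $\mathrm{AdS}$ crooked plane is the image of a left one under $g\mapsto g^{-1}$. An $\mathrm{AdS}$ crooked plane is a left or right one; each separates $\mathrm{AdS}^3$ into two components. A fundamental domain bounded by pairwise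 disjoint crooked planes means a closed region $\mathsf{R}\subset\mathrm{AdS}^3$ whose boundary is the union of finitely many pairwise disjoint $\mathrm{AdS}$ crooked planes, whose translates under the group cover $\mathrm{AdS}^3$ and have pairwise disjoint interiors. *)

theory Defs
  imports "HOL-Analysis.Analysis" "HOL-Algebra.Generated_Groups"
begin

text \<open>A 2x2 real matrix [[a,b],[c,d]] is encoded as the tuple (a,b,c,d) in R^4
  (with the Euclidean topology of the product type).\<close>

type_synonym mat2 = "real \<times> real \<times> real \<times> real"

definition mmul :: "mat2 \<Rightarrow> mat2 \<Rightarrow> mat2" (infixl \<open>\<cdot>\<^sub>m\<close> 70) where
  "mmul = (\<lambda>(a,b,c,d) (e,f,g,h). (a*e + b*g, a*f + b*h, c*e + d*g, c*f + d*h))"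

definition mdet :: "mat2 \<Rightarrow> real" where
  "mdet = (\<lambda>(a,b,c,d). a*d - b*c)"

definition mneg :: "mat2 \<Rightarrow> mat2" where
  "mneg = (\<lambda>(a,b,c,d). (-a, -b, -c, -d))"

definition minv :: "mat2 \<Rightarrow> mat2" where
  "minv m = (case m of (a,b,c,d) \<Rightarrow> (d / mdet m, -b / mdet m, -c / mdet m, a / mdet m))"

text \<open>SL_2(R); its quotient by +-I is G_0 = PSL_2(R) = AdS^3.  A point of AdS^3 is
  represented by either of its two lifts in SL_2(R); subsets of AdS^3 are represented
  by their (saturated) preimages in SL_2(R).\<close>
definition SL2 :: "mat2 set" where
  "SL2 = {m. mdet m = 1}"

text \<open>Equality in PGL_2(R) of representatives of determinant +-1 (equality up to sign).\<close>
definition msim :: "mat2 \<Rightarrow> mat2 \<Rightarrow> bool" (infix \<open>\<approx>\<^sub>m\<close> 50) where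
  "m \<approx>\<^sub>m m' \<longleftrightarrow> m' = m \<or> m' = mneg m"

definition saturated :: "mat2 set \<Rightarrow> bool" where
  "saturated S \<longleftrightarrow> S \<subseteq> SL2 \<and> (\<forall>x\<in>S. mneg x \<in> S)"

text \<open>Topology of AdS^3 = PSL_2(R), lifted to SL_2(R) (the projection is a 2-fold covering,
  so closedness, interiors and frontiers of saturated sets correspond).\<close>
definition AdS_top :: "mat2 topology" where
  "AdS_top = top_of_set SL2"

text \<open>Points of H^2: complex numbers with positive imaginary part.
  Points of the boundary at infinity: R \<union> {\<infinity>}, encoded as real option (None = \<infinity>).
  An element [[a,b],[c,d]] of PSL_2(R) acts by z \<mapsto> (az+b)/(cz+d).\<close>

definition H2 :: "complex set" where
  "H2 = {z. Im z > 0}"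

definition fixes_H2 :: "mat2 \<Rightarrow> complex \<Rightarrow> bool" where
  "fixes_H2 m z = (case m of (a,b,c,d) \<Rightarrow>
      of_real a * z + of_real b = z * (of_real c * z + of_real d))"

text \<open>A boundary point xi is a nonrepelling fixed point of h in SL_2(R) iff a lift v of xi
  in R^2 is an eigenvector of h with eigenvalue lambda, |lambda| \<ge> 1.
  (Identity and parabolics: |lambda| = 1, every fixed point nonrepelling; hyperbolic:
  attracting fixed point = eigenline of the eigenvalue with |lambda| > 1, the repelling
  one has |lambda| < 1.)  Lift of x \<in> R is (x,1), lift of \<infinity> is (1,0).\<close>
definition nonrep_fixes_bdry :: "mat2 \<Rightarrow> real option \<Rightarrow> bool" where
  "nonrep_fixes_bdry m \<xi> = (case m of (a,b,c,d) \<Rightarrow>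
     (case \<xi> of
        None \<Rightarrow> c = 0 \<and> \<bar>a\<bar> \<ge> 1
      | Some x \<Rightarrow> a*x + b = (c*x + d) * x \<and> \<bar>c*x + d\<bar> \<ge> 1))"

datatype geod = Vert real | Circ real real

definition valid_geod :: "geod \<Rightarrow> bool" where
  "valid_geod l = (case l of Vert x \<Rightarrow> True | Circ c r \<Rightarrow> r > 0)"

definition geod_pts :: "geod \<Rightarrow> complex set" where
  "geod_pts l = (case l of
      Vert x \<Rightarrow> {z \<in> H2. Re z = x}
    | Circ c r \<Rightarrow> {z \<in> H2. cmod (z - of_real c) = r})"

definition geod_ends :: "geod \<Rightarrow> real option set" where
  "geod_ends l = (case l of
      Vert x \<Rightarrow> {Some x, None}
    | Circ c r \<Rightarrow> {Some (c - r), Some (c + r)})"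

text \<open>C(l): elements of G_0 having a nonrepelling fixed point in the closure of l in
  H^2 \<union> boundary (every fixed point in H^2 is nonrepelling).\<close>
definition Cset :: "geod \<Rightarrow> mat2 set" where
  "Cset l = {h \<in> SL2. (\<exists>z \<in> geod_pts l. fixes_H2 h z) \<or>
                       (\<exists>\<xi> \<in> geod_ends l. nonrep_fixes_bdry h \<xi>)}"

definition left_crooked_plane :: "mat2 set \<Rightarrow> bool" where
  "left_crooked_plane P \<longleftrightarrow> (\<exists>g1 \<in> SL2. \<exists>g2 \<in> SL2. \<exists>l. valid_geod l \<and>
       P = (\<lambda>h. g2 \<cdot>\<^sub>m h \<cdot>\<^sub>m minv g1) ` Cset l)"

definition right_crooked_plane :: "mat2 set \<Rightarrow> bool" where
  "right_crooked_plane P \<longleftrightarrow> (\<exists>Q. left_crooked_plane Q \<and> P = minv ` Q)"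

definition crooked_plane :: "mat2 set \<Rightarrow> bool" where
  "crooked_plane P \<longleftrightarrow> left_crooked_plane P \<or> right_crooked_plane P"

text \<open>Isometries of AdS^3 = (PSL_2(R), half Killing form): the maps g \<mapsto> g2 g g1^{-1}
  with (g1,g2) \<in> (G \<times> G)_+, possibly composed with g \<mapsto> g^{-1}.  Elements of
  G = PGL_2(R) are represented by matrices of determinant +-1; g1 g2 \<in> G_0 means
  det g1 = det g2.  A map f on lifts represents an isometry if it agrees up to sign
  with such a formula.\<close>
definition AdS_isometry :: "(mat2 \<Rightarrow> mat2) \<Rightarrow> bool" where
  "AdS_isometry f \<longleftrightarrow> (\<exists>g1 g2. (mdet g1 = 1 \<or> mdet g1 = -1) \<and> mdet g2 = mdet g1 \<and>
     ((\<forall>x\<in>SL2. f x \<approx>\<^sub>m g2 \<cdot>\<^sub>m x \<cdot>\<^sub>m minv g1) \<or>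
      (\<forall>x\<in>SL2. f x \<approx>\<^sub>m g2 \<cdot>\<^sub>m minv x \<cdot>\<^sub>m minv g1)))"

text \<open>An action of the group Gamma on AdS^3 by isometries, given on lifts (well defined
  up to sign).\<close>
definition isometric_action :: "('g, 'b) monoid_scheme \<Rightarrow> ('g \<Rightarrow> mat2 \<Rightarrow> mat2) \<Rightarrow> bool" where
  "isometric_action \<Gamma> \<alpha> \<longleftrightarrow>
     (\<forall>\<gamma> \<in> carrier \<Gamma>. AdS_isometry (\<alpha> \<gamma>)) \<and>
     (\<forall>x \<in> SL2. \<alpha> \<one>\<^bsub>\<Gamma>\<^esub> x \<approx>\<^sub>m x) \<and>
     (\<forall>\<gamma> \<in> carrier \<Gamma>. \<forall>\<delta> \<in> carrier \<Gamma>. \<forall>x \<in> SL2.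
        \<alpha> (\<gamma> \<otimes>\<^bsub>\<Gamma>\<^esub> \<delta>) x \<approx>\<^sub>m \<alpha> \<gamma> (\<alpha> \<delta> x))"

definition properly_discontinuous :: "('g, 'b) monoid_scheme \<Rightarrow> ('g \<Rightarrow> mat2 \<Rightarrow> mat2) \<Rightarrow> bool" where
  "properly_discontinuous \<Gamma> \<alpha> \<longleftrightarrow>
     (\<forall>K. compact K \<and> K \<subseteq> SL2 \<longrightarrow>
        finite {\<gamma> \<in> carrier \<Gamma>. \<exists>x \<in> K. \<exists>y \<in> K. \<alpha> \<gamma> x \<approx>\<^sub>m y})"

definition translate :: "('g \<Rightarrow> mat2 \<Rightarrow> mat2) \<Rightarrow> 'g \<Rightarrow> mat2 set \<Rightarrow> mat2 set" where
  "translate \<alpha> \<gamma> R = {y. \<exists>x \<in> R. \<alpha> \<gamma> x \<approx>\<^sub>m y}"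

definition crooked_fundamental_domain ::
  "('g, 'b) monoid_scheme \<Rightarrow> ('g \<Rightarrow> mat2 \<Rightarrow> mat2) \<Rightarrow> mat2 set \<Rightarrow> bool" where
  "crooked_fundamental_domain \<Gamma> \<alpha> R \<longleftrightarrow>
     saturated R \<and> closedin AdS_top R \<and>
     (\<exists>\<C>. finite \<C> \<and> (\<forall>P \<in> \<C>. crooked_plane P) \<and> pairwise disjnt \<C> \<and>
          AdS_top frontier_of R = \<Union>\<C>) \<and>
     (\<Union>\<gamma> \<in> carrier \<Gamma>. translate \<alpha> \<gamma> R) = SL2 \<and>
     (\<forall>\<gamma> \<in> carrier \<Gamma>. \<forall>\<delta> \<in> carrier \<Gamma>. \<gamma> \<noteq> \<delta> \<longrightarrow>
        disjnt (AdS_top interior_of translate \<alpha> \<gamma> R) (AdS_top interior_of translate \<alpha> \<delta> R))"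

definition word_prod :: "('g, 'b) monoid_scheme \<Rightarrow> ('g \<times> bool) list \<Rightarrow> 'g" where
  "word_prod G w = foldr (\<lambda>(s, e) acc. (if e then s else inv\<^bsub>G\<^esub> s) \<otimes>\<^bsub>G\<^esub> acc) w \<one>\<^bsub>G\<^esub>"

definition reduced_word :: "('g \<times> bool) list \<Rightarrow> bool" where
  "reduced_word w \<longleftrightarrow> (\<forall>i. Suc i < length w \<longrightarrow>
      \<not> (fst (w ! i) = fst (w ! Suc i) \<and> snd (w ! i) \<noteq> snd (w ! Suc i)))"

definition free_basis :: "('g, 'b) monoid_scheme \<Rightarrow> 'g set \<Rightarrow> bool" where
  "free_basis G S \<longleftrightarrow> S \<subseteq> carrier G \<and> generate G S = carrier G \<and>
     (\<forall>w. set (map fst w) \<subseteq> S \<and> reduced_word w \<and> w \<noteq> [] \<longrightarrow> word_prod G w \<noteq> \<one>\<^bsub>G\<^esub>)"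

definition fin_gen_free_group :: "('g, 'b) monoid_scheme \<Rightarrow> bool" where
  "fin_gen_free_group G \<longleftrightarrow> group G \<and> (\<exists>S. finite S \<and> free_basis G S)"

end

(*
  The group is Sanov's free group of integer matrices, a lattice in SL(2,R), acting by right
  multiplication.

  After multiplication on both sides every crooked plane becomes the set C_e (e = 1 for a left and
  e = -1 for a right plane), which consists of a stem {a = d, b c <= 0} and of two wings in the null
  planes {c = 0} and {b = 0}.  Away from its vertices C_e is two-sided and connected, so if the
  interior U of a fundamental domain lies on one side of C_e near some point, it lies on that side
  all along C_e.  It then suffices to find an element of the group for which the stem of a plane
  crosses transversally a wing of the translate of that plane: near a crossing point U would
  meet its own translate.  For e = 1 almost every group element will do.  For e = -1 one needs a
  conjugate with top left entry strictly between -1 and 1 and different from 0.  For the unipotent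
  element attached to an integer vector this entry is 1 - 2 Q, where Q is the value at the vector
  of an indefinite binary quadratic form of discriminant 1, and Gauss reduction yields a value of
  absolute value below 1/2.  If the form is isotropic, an end of the plane is a cusp, and the
  parabolic element fixing it translates the plane to one that branches off it along a wing.
*)

theory Submission
  imports Defs
begin

section \<open>Sanov's free group\<close>

text \<open>In coordinates where the plane is \<open>cplane e\<close>, right translation by a group
  element becomes right translation by its conjugate under an arbitrary real matrix
  \<open>k\<close>, so a crossing has to be found for every position of the lattice. If (a,b,c,a) is
  on the stem and the conjugate has top left entry \<alpha>, then choosing c so that the product has
  lower left entry 0 makes its diagonal (\<alpha>/a, a/\<alpha>), while 0 < |a| < 1. The wing in {c
  = 0} then asks for |\<alpha>| >= |a| if e = 1, which a small a achieves, but for |\<alpha>| <= |a|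
  < 1 if e = -1. This is where the arithmetic of small values enters. Very little is known about U:
  it is disjoint from its translates and is a union of components of the complement of the planes.
  It may be disconnected or lie on both sides of a plane, and no neighbouring tile is identified.
  Hence only the existence of some side is used, and each crossing is checked for both. The vertices
  are left out of the argument along a plane, at the price of showing that U touches some plane
  elsewhere; finitely many points do not disconnect SL2, so it does.\<close>

type_synonym imat = "int \<times> int \<times> int \<times> int"

definition imul :: "imat \<Rightarrow> imat \<Rightarrow> imat" where
  "imul = (\<lambda>(a,b,c,d) (e,f,g,h). (a*e + b*g, a*f + b*h, c*e + d*g, c*f + d*h))"

definition iinv :: "imat \<Rightarrow> imat" where
  "iinv = (\<lambda>(a,b,c,d). (d, -b, -c, a))"

text \<open>A determinant 1 matrix congruent to I mod 2 has a = d = 1 or a = d = 3 mod 4. The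
  congruences mod 4 thus select exactly one of each pair +-m: the group is a lift of the level 2
  congruence subgroup of PSL2 that omits -I, without which it could not be free.\<close>

definition sanov :: "imat set" where
  "sanov = {(a,b,c,d). a*d - b*c = 1 \<and> a mod 4 = 1 \<and> d mod 4 = 1 \<and> even b \<and> even c}"

lemma imul_simp [simp]:
  "imul (a,b,c,d) (e,f,g,h) = (a*e + b*g, a*f + b*h, c*e + d*g, c*f + d*h)"
  by (simp add: imul_def)

lemma iinv_simp [simp]: "iinv (a,b,c,d) = (d,-b,-c,a)"
  by (simp add: iinv_def)

lemma sanov_iff: "(a,b,c,d) \<in> sanov \<longleftrightarrow>
    a*d - b*c = 1 \<and> a mod 4 = 1 \<and> d mod 4 = 1 \<and> even b \<and> even c"
  by (simp add: sanov_def)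

lemma imul_assoc: "imul (imul x y) z = imul x (imul y z)"
  by (cases x; cases y; cases z) (simp add: algebra_simps)

lemma mod4_mult_add:
  fixes a b e g :: int
  assumes "a mod 4 = 1" "e mod 4 = 1" "even b" "even g"
  shows "(a*e + b*g) mod 4 = 1"
proof -
  obtain b' g' where "b = 2*b'" "g = 2*g'" using assms by (elim evenE)
  then have "(a*e + b*g) mod 4 = (a*e + 4*(b'*g')) mod 4" by (simp add: algebra_simps)
  also have "\<dots> = ((a mod 4) * (e mod 4)) mod 4" by (simp only: mod_mult_self2 mod_mult_eq)
  finally show ?thesis using assms by simp
qed

lemma imul_one [simp]: "imul (1,0,0,1) x = x"
  by (cases x) simp

lemma sanov_mul: "x \<in> sanov \<Longrightarrow> y \<in> sanov \<Longrightarrow> imul x y \<in> sanov"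
proof (cases x, cases y)
  fix a b c d e f g h
  assume xy: "x = (a,b,c,d)" "y = (e,f,g,h)" and "x \<in> sanov" "y \<in> sanov"
  then have *: "a*d - b*c = 1" "e*h - f*g = 1" "a mod 4 = 1" "d mod 4 = 1" "even b" "even c"
     "e mod 4 = 1" "h mod 4 = 1" "even f" "even g"
    by (auto simp: sanov_iff)
  have "(a*e+b*g)*(c*f+d*h) - (a*f+b*h)*(c*e+d*g) = (a*d-b*c)*(e*h-f*g)"
    by (simp add: algebra_simps)
  then have "(a*e+b*g)*(c*f+d*h) - (a*f+b*h)*(c*e+d*g) = 1" unfolding * by simp
  moreover have "(a*e+b*g) mod 4 = 1" by (rule mod4_mult_add) (use * in auto)
  moreover have "(c*f+d*h) mod 4 = 1"
    using mod4_mult_add[of d h c f] * by (simp add: add.commute)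
  moreover have "even (a*f+b*h)" "even (c*e+d*g)" using * by auto
  ultimately show "imul x y \<in> sanov" unfolding xy imul_simp sanov_iff by blast
qed

lemma sanov_inv: "x \<in> sanov \<Longrightarrow> iinv x \<in> sanov"
  by (cases x) (auto simp: sanov_iff algebra_simps)

lemma sanov_one: "(1,0,0,1) \<in> sanov"
  by (simp add: sanov_iff)

lemma iinv_mul: "x \<in> sanov \<Longrightarrow> imul (iinv x) x = (1,0,0,1)"
  by (cases x) (auto simp: sanov_iff algebra_simps)

text \<open>The matrices are coded by natural numbers because the theorem asks for a group with
  carrier in \<open>nat\<close>.\<close>

definition sanov_group :: "nat monoid" where
  "sanov_group = \<lparr>carrier = to_nat ` sanov,
     mult = (\<lambda>m n. to_nat (imul (from_nat m) (from_nat n))), one = to_nat ((1,0,0,1) :: imat)\<rparr>"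

lemma carrier_sanov_group [simp]: "carrier sanov_group = to_nat ` sanov"
  and mult_sanov_group [simp]: "to_nat x \<otimes>\<^bsub>sanov_group\<^esub> to_nat y = to_nat (imul x y)"
  and one_sanov_group [simp]: "\<one>\<^bsub>sanov_group\<^esub> = to_nat ((1,0,0,1) :: imat)"
  by (simp_all add: sanov_group_def)

lemma group_sanov_group: "group sanov_group"
proof (rule groupI)
  fix x assume "x \<in> carrier sanov_group"
  then obtain m where "m \<in> sanov" "x = to_nat m" by auto
  then show "\<exists>y\<in>carrier sanov_group. y \<otimes>\<^bsub>sanov_group\<^esub> x = \<one>\<^bsub>sanov_group\<^esub>"
    by (intro bexI[of _ "to_nat (iinv m)"]) (auto simp: iinv_mul sanov_inv)
qed (auto simp: imul_assoc sanov_mul sanov_one imul_one simp del: imul_simp)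

lemma inv_sanov_group:
  assumes "m \<in> sanov" shows "inv\<^bsub>sanov_group\<^esub> (to_nat m) = to_nat (iinv m)"
  by (rule group.inv_equality[OF group_sanov_group]) (use assms in \<open>auto simp: iinv_mul sanov_inv\<close>)

section \<open>Two generators, by descent on the first column\<close>

definition sanov_A :: imat where "sanov_A = (1,2,0,1)"
definition sanov_B :: imat where "sanov_B = (1,0,2,1)"

lemma sanov_AB: "sanov_A \<in> sanov" "sanov_B \<in> sanov"
  by (simp_all add: sanov_A_def sanov_B_def sanov_iff)

abbreviation gens :: "nat set" where "gens \<equiv> {to_nat sanov_A, to_nat sanov_B}"

lemma generate_mult_left:
  assumes "to_nat (imul g m) \<in> generate sanov_group gens" "to_nat g \<in> generate sanov_group gens"
    "g \<in> sanov" "m \<in> sanov"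
  shows "to_nat m \<in> generate sanov_group gens"
proof -
  interpret group sanov_group by (rule group_sanov_group)
  have "inv\<^bsub>sanov_group\<^esub> (to_nat g) \<in> generate sanov_group gens"
    by (rule generate_m_inv_closed) (use assms sanov_AB in auto)
  then have "to_nat (iinv g) \<otimes>\<^bsub>sanov_group\<^esub> to_nat (imul g m) \<in> generate sanov_group gens"
    using assms by (intro generate.eng) (auto simp: inv_sanov_group)
  moreover have "imul (iinv g) (imul g m) = m"
    using assms by (cases m) (simp add: imul_assoc[symmetric] iinv_mul)
  ultimately show ?thesis by simp
qed

lemma generate_A_power:
  "to_nat ((1, 2 * k, 0, 1) :: imat) \<in> generate sanov_group gens"
proof (induction k rule: int_induct[where k = 0])
  case base
  then show ?case using generate.one[of sanov_group gens] by simp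
next
  case (step1 i)
  have "to_nat sanov_A \<otimes>\<^bsub>sanov_group\<^esub> to_nat ((1, 2 * i, 0, 1) :: imat) \<in> generate sanov_group gens"
    using step1 by (intro generate.eng[OF generate.incl]) auto
  then show ?case by (simp add: sanov_A_def algebra_simps)
next
  case (step2 i)
  show ?case
    by (rule generate_mult_left[of sanov_A])
      (use step2 generate.incl[of "to_nat sanov_A" gens] in
        \<open>auto simp: sanov_A_def sanov_iff algebra_simps\<close>)
qed

text \<open>Euclid's algorithm on the first column (a,c): a is odd and c even, so |a| and |c|
  differ, and as long as c is nonzero a left factor \<open>sanov_A\<close> or
  \<open>sanov_B\<close>, or an inverse, shrinks the larger one. At c = 0 the congruence mod 4
  excludes a = -1.\<close>

lemma generate_gens: "m \<in> sanov \<Longrightarrow> to_nat m \<in> generate sanov_group gens"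
proof (induction "nat (\<bar>fst m\<bar> + \<bar>fst (snd (snd m))\<bar>)" arbitrary: m rule: less_induct)
  case less
  obtain a b c d where m: "m = (a,b,c,d)" by (cases m)
  have *: "a*d - b*c = 1" "a mod 4 = 1" "d mod 4 = 1" "even b" "even c"
    using less.prems by (auto simp: m sanov_iff)
  have red: "to_nat m \<in> generate sanov_group gens"
    if "g \<in> sanov" "to_nat g \<in> generate sanov_group gens"
      "\<bar>fst (imul g m)\<bar> + \<bar>fst (snd (snd (imul g m)))\<bar> < \<bar>a\<bar> + \<bar>c\<bar>" for g
  proof (rule generate_mult_left[OF _ that(2,1) less.prems])
    show "to_nat (imul g m) \<in> generate sanov_group gens"
      by (rule less.hyps) (use that less.prems in \<open>auto simp: m sanov_mul\<close>)
  qed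
  have gA: "to_nat sanov_A \<in> generate sanov_group gens" "to_nat sanov_B \<in> generate sanov_group gens"
    by (auto intro: generate.incl)
  have gi: "to_nat (iinv sanov_A) \<in> generate sanov_group gens"
      "to_nat (iinv sanov_B) \<in> generate sanov_group gens"
    using generate.inv[of _ gens sanov_group] by (auto simp flip: inv_sanov_group[OF sanov_AB(1)] inv_sanov_group[OF sanov_AB(2)])
  show ?case
  proof (cases "c = 0")
    case True
    then have "a = 1 \<or> a = -1" using *(1) by (auto simp: zmult_eq_1_iff)
    then have "a = 1" using *(2) by auto
    then have "d = 1" using *(1) True by simp
    obtain k where "b = 2 * k" using *(4) by (elim evenE)
    then show ?thesis using generate_A_power[of k] \<open>a = 1\<close> \<open>d = 1\<close> True m by simp
  next
    case False
    have "odd a" using *(2) by presburger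
    then have "\<bar>a\<bar> \<noteq> \<bar>c\<bar>" using *(5) by presburger
    then consider "\<bar>a + 2*c\<bar> < \<bar>a\<bar>" | "\<bar>a - 2*c\<bar> < \<bar>a\<bar>" | "\<bar>c + 2*a\<bar> < \<bar>c\<bar>" | "\<bar>c - 2*a\<bar> < \<bar>c\<bar>"
      using False \<open>odd a\<close> by (cases "a = 0") (simp, linarith)
    then show ?thesis
    proof cases
      case 1 then show ?thesis by (intro red[OF _ gA(1)]) (auto simp: m sanov_A_def sanov_iff)
    next
      case 2 then show ?thesis by (intro red[OF _ gi(1)]) (auto simp: m sanov_A_def sanov_iff)
    next
      case 3 then show ?thesis by (intro red[OF _ gA(2)]) (auto simp: m sanov_B_def sanov_iff algebra_simps)
    next
      case 4 then show ?thesis by (intro red[OF _ gi(2)]) (auto simp: m sanov_B_def sanov_iff algebra_simps)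
    qed
  qed
qed

section \<open>Freeness, by ping-pong on integer vectors\<close>

text \<open>The ping-pong regions: the region of a letter is mapped into that of the next letter, unless
  the next letter is its inverse.\<close>

definition pp_inv :: "nat \<times> bool \<Rightarrow> int \<times> int \<Rightarrow> bool" where
  "pp_inv = (\<lambda>(s,e) (x,y). let z = (if e then y else - y) in
     (0 < x \<and> 0 < z \<or> x < 0 \<and> z < 0) \<and>
     (if s = to_nat sanov_A then \<bar>y\<bar> < \<bar>x\<bar> else \<bar>x\<bar> < \<bar>y\<bar>))"

definition iapp :: "imat \<Rightarrow> int \<times> int \<Rightarrow> int \<times> int" where
  "iapp = (\<lambda>(a,b,c,d) (x,y). (a*x + b*y, c*x + d*y))"

lemma iapp_simp [simp]: "iapp (a,b,c,d) (x,y) = (a*x + b*y, c*x + d*y)"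
  by (simp add: iapp_def)

lemma iapp_imul: "iapp (imul m n) v = iapp m (iapp n v)"
  by (cases m; cases n; cases v) (simp add: algebra_simps)

definition letter :: "nat \<times> bool \<Rightarrow> imat" where
  "letter l = (if snd l then from_nat (fst l) else iinv (from_nat (fst l)))"

lemma reduced_word_Cons:
  "reduced_word (l # k # w) \<longleftrightarrow> \<not> (fst l = fst k \<and> snd l \<noteq> snd k) \<and> reduced_word (k # w)"
proof -
  have "reduced_word (l # k # w) \<longleftrightarrow> (\<forall>i<Suc (length w).
      \<not> (fst ((l # k # w) ! i) = fst ((k # w) ! i) \<and> snd ((l # k # w) ! i) \<noteq> snd ((k # w) ! i)))"
    unfolding reduced_word_def by simp
  also have "\<dots> \<longleftrightarrow> \<not> (fst l = fst k \<and> snd l \<noteq> snd k) \<and> (\<forall>i<length w.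
      \<not> (fst ((k # w) ! i) = fst (w ! i) \<and> snd ((k # w) ! i) \<noteq> snd (w ! i)))"
    unfolding All_less_Suc2 by simp
  also have "(\<forall>i<length w. \<not> (fst ((k # w) ! i) = fst (w ! i) \<and> snd ((k # w) ! i) \<noteq> snd (w ! i)))
      \<longleftrightarrow> reduced_word (k # w)"
    unfolding reduced_word_def by simp
  finally show ?thesis .
qed

lemma word_prod_letter:
  "set (map fst w) \<subseteq> gens \<Longrightarrow> \<exists>m\<in>sanov. word_prod sanov_group w = to_nat m"
  "set (map fst (l # w)) \<subseteq> gens \<Longrightarrow> word_prod sanov_group w = to_nat m \<Longrightarrow>
     word_prod sanov_group (l # w) = to_nat (imul (letter l) m)"
proof -
  have *: "(if e then s else inv\<^bsub>sanov_group\<^esub> s) = to_nat (letter (s,e)) \<and> letter (s,e) \<in> sanov"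
    if "s \<in> gens" for s e
    using that sanov_AB by (auto simp: letter_def inv_sanov_group sanov_inv)
  show 2: "word_prod sanov_group (l # w) = to_nat (imul (letter l) m)"
    if "set (map fst (l # w)) \<subseteq> gens" "word_prod sanov_group w = to_nat m" for l w m
    using that *[of "fst l" "snd l"] by (cases l) (auto simp: word_prod_def)
  show "\<exists>m\<in>sanov. word_prod sanov_group w = to_nat m" if "set (map fst w) \<subseteq> gens"
    using that
  proof (induction w)
    case Nil then show ?case by (auto simp: word_prod_def sanov_one)
  next
    case (Cons l w)
    then obtain m where "m \<in> sanov" "word_prod sanov_group w = to_nat m" by auto
    moreover have "letter l \<in> sanov" using *[of "fst l" "snd l"] Cons.prems by auto
    ultimately show ?case using 2[OF Cons.prems] sanov_mul by blast
  qed
qed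

lemma letter_cases:
  assumes "fst l \<in> gens"
  obtains "l = (to_nat sanov_A, True)" "letter l = (1,2,0,1)"
  | "l = (to_nat sanov_A, False)" "letter l = (1,-2,0,1)"
  | "l = (to_nat sanov_B, True)" "letter l = (1,0,2,1)"
  | "l = (to_nat sanov_B, False)" "letter l = (1,0,-2,1)"
  using assms that by (cases l; cases "snd l") (auto simp: letter_def sanov_A_def sanov_B_def)

lemma AB_neq [simp]: "sanov_A \<noteq> sanov_B" "sanov_B \<noteq> sanov_A"
  by (auto simp: sanov_A_def sanov_B_def)

text \<open>A letter of type A changes x by +-2y. Coming from a region with |x| < |y| this term
  dominates; coming from the region of the same letter it has the sign of x. Either way the new x
  exceeds |y| in absolute value and has the right sign. For type B the coordinates change
  roles.\<close>

lemma pp_step: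
  assumes "fst l \<in> gens" "fst k \<in> gens" "\<not> (fst l = fst k \<and> snd l \<noteq> snd k)" "pp_inv k v"
  shows "pp_inv l (iapp (letter l) v)"
proof (cases v)
  case (Pair x y)
  show ?thesis
    by (rule letter_cases[OF assms(1)]; rule letter_cases[OF assms(2)])
      (use assms(3,4) in \<open>simp add: Pair pp_inv_def Let_def; smt (verit)\<close>)+
qed

text \<open>The test vector lies on an axis, hence outside every region, since regions require two
  nonzero coordinates; so the word cannot be the identity. The axis depends on the last letter,
  because powers of \<open>sanov_A\<close> fix (1,0) and powers of \<open>sanov_B\<close> fix
  (0,1).\<close>

lemma free_sanov_word:
  assumes "set (map fst w) \<subseteq> gens" "reduced_word w" "w \<noteq> []"
  shows "\<exists>m v. word_prod sanov_group w = to_nat m \<and> (v = (0,1) \<or> v = (1,0)) \<and> pp_inv (hd w) (iapp m v)"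
  using assms
proof (induction w)
  case Nil then show ?case by simp
next
  case (Cons l w)
  have l: "fst l \<in> gens" using Cons.prems by auto
  show ?case
  proof (cases w)
    case Nil
    have "word_prod sanov_group [l] = to_nat (imul (letter l) (1,0,0,1))"
      by (rule word_prod_letter(2)) (use Cons.prems Nil in \<open>auto simp: word_prod_def\<close>)
    moreover have "imul (letter l) (1,0,0,1) = letter l" by (cases "letter l") simp
    ultimately have w: "word_prod sanov_group [l] = to_nat (letter l)" by simp
    have "\<exists>v. (v = (0,1) \<or> v = (1,0)) \<and> pp_inv l (iapp (letter l) v)"
    proof (rule letter_cases[OF l])
      assume "l = (to_nat sanov_A, True)" "letter l = (1,2,0,1)"
      then show ?thesis by (intro exI[of _ "(0,1)"]) (simp add: pp_inv_def)
    next
      assume "l = (to_nat sanov_A, False)" "letter l = (1,-2,0,1)"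
      then show ?thesis by (intro exI[of _ "(0,1)"]) (simp add: pp_inv_def)
    next
      assume "l = (to_nat sanov_B, True)" "letter l = (1,0,2,1)"
      then show ?thesis by (intro exI[of _ "(1,0)"]) (simp add: pp_inv_def)
    next
      assume "l = (to_nat sanov_B, False)" "letter l = (1,0,-2,1)"
      then show ?thesis by (intro exI[of _ "(1,0)"]) (simp add: pp_inv_def)
    qed
    then show ?thesis using w Nil by auto
  next
    case (Cons k u)
    have "set (map fst w) \<subseteq> gens" "reduced_word w" "w \<noteq> []"
      using Cons.prems Cons by (auto simp: reduced_word_Cons)
    from Cons.IH[OF this] obtain m v where m: "word_prod sanov_group w = to_nat m"
        "v = (0,1) \<or> v = (1,0)" "pp_inv (hd w) (iapp m v)"
      by blast
    then have m3: "pp_inv k (iapp m v)" using Cons by simp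
    have "pp_inv l (iapp (letter l) (iapp m v))"
      by (rule pp_step[OF l _ _ m3]) (use Cons.prems Cons in \<open>auto simp: reduced_word_Cons\<close>)
    then show ?thesis
      using word_prod_letter(2)[OF Cons.prems(1) m(1)] m(2)
      by (intro exI[of _ "imul (letter l) m"] exI[of _ v]) (auto simp: iapp_imul)
  qed
qed

lemma fin_gen_free_sanov_group: "fin_gen_free_group sanov_group"
  unfolding fin_gen_free_group_def free_basis_def
proof (intro conjI exI[of _ gens] allI impI)
  show "group sanov_group" by (rule group_sanov_group)
  show "finite gens" by simp
  show "gens \<subseteq> carrier sanov_group" using sanov_AB by auto
  then show "generate sanov_group gens = carrier sanov_group"
    using generate_gens group.generate_incl[OF group_sanov_group, of gens] by auto
  show "word_prod sanov_group w \<noteq> \<one>\<^bsub>sanov_group\<^esub>"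
    if w: "set (map fst w) \<subseteq> gens \<and> reduced_word w \<and> w \<noteq> []" for w
  proof
    assume one: "word_prod sanov_group w = \<one>\<^bsub>sanov_group\<^esub>"
    obtain m v where "word_prod sanov_group w = to_nat m" "v = (0,1) \<or> v = (1,0)"
        "pp_inv (hd w) (iapp m v)"
      using free_sanov_word[of w] w by metis
    then show False using one by (cases "hd w") (auto simp: pp_inv_def Let_def split: if_splits)
  qed
qed

section \<open>A normal form for crooked planes\<close>

lemma mmul_simp [simp]:
  "(a,b,c,d) \<cdot>\<^sub>m (e,f,g,h) = (a*e + b*g, a*f + b*h, c*e + d*g, c*f + d*h)"
  by (simp add: mmul_def)

lemma mdet_simp [simp]: "mdet (a,b,c,d) = a*d - b*c"
  by (simp add: mdet_def)

lemma mneg_simp [simp]: "mneg (a,b,c,d) = (-a,-b,-c,-d)"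
  by (simp add: mneg_def)

lemma SL2_iff: "(a,b,c,d) \<in> SL2 \<longleftrightarrow> a*d - b*c = 1"
  by (simp add: SL2_def)

lemma minv_simp [simp]: "a*d - b*c = 1 \<Longrightarrow> minv (a,b,c,d) = (d,-b,-c,a)"
  by (simp add: minv_def)

lemma mmul_assoc: "x \<cdot>\<^sub>m y \<cdot>\<^sub>m z = x \<cdot>\<^sub>m (y \<cdot>\<^sub>m z)"
  by (cases x; cases y; cases z) (simp add: algebra_simps)

lemma mmul_one [simp]: "(1,0,0,1) \<cdot>\<^sub>m x = x" "x \<cdot>\<^sub>m (1,0,0,1) = x"
  by (cases x; simp)+

lemma mdet_mmul: "mdet (x \<cdot>\<^sub>m y) = mdet x * mdet y"
  by (cases x; cases y) (simp add: algebra_simps)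

lemma SL2_mmul: "x \<in> SL2 \<Longrightarrow> y \<in> SL2 \<Longrightarrow> x \<cdot>\<^sub>m y \<in> SL2"
  by (simp add: SL2_def mdet_mmul)

lemma SL2_minv: "x \<in> SL2 \<Longrightarrow> minv x \<in> SL2"
  by (cases x) (auto simp: SL2_iff mult.commute)

lemma mmul_minv:
  assumes "x \<in> SL2" shows "x \<cdot>\<^sub>m minv x = (1,0,0,1)" "minv x \<cdot>\<^sub>m x = (1,0,0,1)"
  using assms by (cases x; auto simp: SL2_iff mult.commute)+

lemma mmul_minv_cancel:
  assumes "x \<in> SL2"
  shows "x \<cdot>\<^sub>m (minv x \<cdot>\<^sub>m y) = y" "minv x \<cdot>\<^sub>m (x \<cdot>\<^sub>m y) = y"
  using assms by (simp_all add: mmul_minv flip: mmul_assoc)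

lemma minv_minv: "x \<in> SL2 \<Longrightarrow> minv (minv x) = x"
  by (cases x) (auto simp: SL2_iff mult.commute)

lemma minv_mmul:
  assumes "x \<in> SL2" "y \<in> SL2" shows "minv (x \<cdot>\<^sub>m y) = minv y \<cdot>\<^sub>m minv x"
proof -
  have "minv y \<cdot>\<^sub>m minv x = minv (x \<cdot>\<^sub>m y) \<cdot>\<^sub>m ((x \<cdot>\<^sub>m y) \<cdot>\<^sub>m (minv y \<cdot>\<^sub>m minv x))"
    by (rule mmul_minv_cancel(2)[symmetric]) (intro SL2_mmul assms)
  also have "(x \<cdot>\<^sub>m y) \<cdot>\<^sub>m (minv y \<cdot>\<^sub>m minv x) = (1,0,0,1)"
    using assms by (simp add: mmul_assoc mmul_minv_cancel mmul_minv)
  finally show ?thesis by simp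
qed

lemma mneg_mmul: "mneg x \<cdot>\<^sub>m y = mneg (x \<cdot>\<^sub>m y)" "x \<cdot>\<^sub>m mneg y = mneg (x \<cdot>\<^sub>m y)"
  by (cases x; cases y; simp)+

lemma mneg_mneg [simp]: "mneg (mneg x) = x"
  by (cases x) simp

lemma SL2_mneg: "x \<in> SL2 \<Longrightarrow> mneg x \<in> SL2"
  by (cases x) (simp add: SL2_iff)

text \<open>For e = 1 this is the set C of the geodesic from 0 to \<infinity>. The stem a = d
  contains the elliptic elements centred on it. On c = 0 the point \<infinity> is fixed with
  eigenvalue a, and as a*d = 1 there, |a| >= |d| says that it is nonrepelling; likewise for 0 on b =
  0. Inversion swaps a and d, which is the change of sign of e.\<close>

definition cplane :: "real \<Rightarrow> mat2 set" where
  "cplane e = {(a,b,c,d). a*d - b*c = 1 \<and>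
     (a = d \<and> b*c \<le> 0 \<or> c = 0 \<and> 0 \<le> e*(\<bar>a\<bar>-\<bar>d\<bar>) \<or> b = 0 \<and> e*(\<bar>a\<bar>-\<bar>d\<bar>) \<le> 0)}"

lemma cplane_iff: "(a,b,c,d) \<in> cplane e \<longleftrightarrow> a*d - b*c = 1 \<and>
     (a = d \<and> b*c \<le> 0 \<or> c = 0 \<and> 0 \<le> e*(\<bar>a\<bar>-\<bar>d\<bar>) \<or> b = 0 \<and> e*(\<bar>a\<bar>-\<bar>d\<bar>) \<le> 0)"
  by (simp add: cplane_def)

lemma cplane_SL2: "cplane e \<subseteq> SL2"
  by (auto simp: cplane_def SL2_iff)

text \<open>The nonrepelling condition in homogeneous coordinates: it treats \<infinity> like every
  other boundary point, and conjugation acts on it linearly.\<close>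

definition eigdir :: "mat2 \<Rightarrow> real \<times> real \<Rightarrow> bool" where
  "eigdir m v = (case m of (a,b,c,d) \<Rightarrow> case v of (x,y) \<Rightarrow>
     \<exists>l. \<bar>l\<bar> \<ge> 1 \<and> a*x + b*y = l*x \<and> c*x + d*y = l*y)"

lemma nonrep_None: "nonrep_fixes_bdry m None \<longleftrightarrow> eigdir m (1,0)"
  by (cases m) (auto simp: nonrep_fixes_bdry_def eigdir_def)

lemma nonrep_Some: "nonrep_fixes_bdry m (Some x) \<longleftrightarrow> eigdir m (x,1)"
  by (cases m) (auto simp: nonrep_fixes_bdry_def eigdir_def)

lemma eigdir_scale:
  assumes "t \<noteq> 0" shows "eigdir m (t*x,t*y) \<longleftrightarrow> eigdir m (x,y)"
proof -
  have "(a*(t*x) + b*(t*y) = l*(t*x)) \<longleftrightarrow> (a*x + b*y = l*x)" for a b l x y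
  proof -
    have "a*(t*x) + b*(t*y) = t*(a*x+b*y)" "l*(t*x) = t*(l*x)" by (simp_all add: algebra_simps)
    then show ?thesis using assms by simp
  qed
  moreover have "(c*(t*x) + d*(t*y) = l*(t*y)) \<longleftrightarrow> (c*x + d*y = l*y)" for c d l x y
  proof -
    have "c*(t*x) + d*(t*y) = t*(c*x+d*y)" "l*(t*y) = t*(l*y)" by (simp_all add: algebra_simps)
    then show ?thesis using assms by simp
  qed
  ultimately show ?thesis by (cases m) (simp add: eigdir_def)
qed

lemma eigdir_conj:
  assumes k: "(p,q,r,s) \<in> SL2"
  shows "eigdir m (p*x+q*y, r*x+s*y) \<longleftrightarrow> eigdir (minv (p,q,r,s) \<cdot>\<^sub>m m \<cdot>\<^sub>m (p,q,r,s)) (x,y)"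
proof -
  obtain a b c d where m: "m = (a,b,c,d)" by (cases m)
  define X Y where "X = p*x+q*y" "Y = r*x+s*y"
  have det: "p* s - q*r = 1" using k by (simp add: SL2_iff)
  have conj: "minv (p,q,r,s) \<cdot>\<^sub>m m \<cdot>\<^sub>m (p,q,r,s) =
    ((s*a-q*c)*p + (s*b-q*d)*r, (s*a-q*c)*q + (s*b-q*d)* s,
     (p*c-r*a)*p + (p*d-r*b)*r, (p*c-r*a)*q + (p*d-r*b)* s)"
    using det by (simp add: m algebra_simps)
  have 1: "((s*a-q*c)*p + (s*b-q*d)*r)*x + ((s*a-q*c)*q + (s*b-q*d)* s)*y = s*(a*X+b*Y) - q*(c*X+d*Y)"
    "((p*c-r*a)*p + (p*d-r*b)*r)*x + ((p*c-r*a)*q + (p*d-r*b)* s)*y = p*(c*X+d*Y) - r*(a*X+b*Y)"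
    by (simp_all add: X_Y_def algebra_simps)
  have 2: "x = s*X - q*Y" "y = p*Y - r*X"
  proof -
    have "s*X - q*Y = (p* s-q*r)*x" "p*Y-r*X = (p* s-q*r)*y" by (simp_all add: X_Y_def algebra_simps)
    then show "x = s*X - q*Y" "y = p*Y - r*X" using det by simp_all
  qed
  have "(a*X+b*Y = l*X \<and> c*X+d*Y = l*Y) \<longleftrightarrow>
    (s*(a*X+b*Y) - q*(c*X+d*Y) = l*x \<and> p*(c*X+d*Y) - r*(a*X+b*Y) = l*y)" for l
  proof
    assume "a*X+b*Y = l*X \<and> c*X+d*Y = l*Y"
    then show "s*(a*X+b*Y) - q*(c*X+d*Y) = l*x \<and> p*(c*X+d*Y) - r*(a*X+b*Y) = l*y"
      by (simp add: 2 algebra_simps)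
  next
    define U V where "U = a*X+b*Y" "V = c*X+d*Y"
    assume "s*(a*X+b*Y) - q*(c*X+d*Y) = l*x \<and> p*(c*X+d*Y) - r*(a*X+b*Y) = l*y"
    then have *: "s*U - q*V = l*x" "p*V - r*U = l*y" by (auto simp: U_V_def)
    have "U = (p* s-q*r)*U" "V = (p* s-q*r)*V" using det by simp_all
    moreover have "(p* s-q*r)*U = p*(s*U-q*V) + q*(p*V-r*U)" "(p* s-q*r)*V = r*(s*U-q*V) + s*(p*V-r*U)"
      by (simp_all add: algebra_simps)
    ultimately have "U = p*(l*x) + q*(l*y)" "V = r*(l*x) + s*(l*y)" unfolding * by linarith+
    then have "U = l*X" "V = l*Y" by (simp_all add: X_Y_def algebra_simps)
    then show "a*X+b*Y = l*X \<and> c*X+d*Y = l*Y" by (simp add: U_V_def)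
  qed
  then show ?thesis unfolding conj using 1 by (simp add: eigdir_def m flip: X_Y_def)
qed

text \<open>Here z is the image of w under the Moebius map of (p,q,r,s). After clearing
  denominators, the fixed point equation of the conjugate at w is that of m at z multiplied by the
  square of r*w + s.\<close>

lemma fixes_H2_conj:
  assumes k: "(p,q,r,s) \<in> SL2" and Y: "of_real r * w + of_real s \<noteq> 0"
    and z: "z * (of_real r * w + of_real s) = of_real p * w + of_real q"
  shows "fixes_H2 m z \<longleftrightarrow> fixes_H2 (minv (p,q,r,s) \<cdot>\<^sub>m m \<cdot>\<^sub>m (p,q,r,s)) w"
proof -
  obtain a b c d where m: "m = (a,b,c,d)" by (cases m)
  have det: "p* s - q*r = 1" using k by (simp add: SL2_iff)
  have conj: "minv (p,q,r,s) \<cdot>\<^sub>m m \<cdot>\<^sub>m (p,q,r,s) =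
    ((s*a-q*c)*p + (s*b-q*d)*r, (s*a-q*c)*q + (s*b-q*d)* s,
     (p*c-r*a)*p + (p*d-r*b)*r, (p*c-r*a)*q + (p*d-r*b)* s)"
    using det by (simp add: m algebra_simps)
  define A B C D P Q R S :: complex where ABCD: "A = of_real a" "B = of_real b" "C = of_real c" "D = of_real d"
    "P = of_real p" "Q = of_real q" "R = of_real r" "S = of_real s"
  define Y X where XY: "Y = R*w+S" "X = P*w+Q"
  have "((S*A-Q*C)*P + (S*B-Q*D)*R)*w + ((S*A-Q*C)*Q + (S*B-Q*D)*S)
     - w*(((P*C-R*A)*P + (P*D-R*B)*R)*w + ((P*C-R*A)*Q + (P*D-R*B)*S))
     = (A*X+B*Y)*Y - (C*X+D*Y)*X"
    by (simp add: XY algebra_simps)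
  also have "\<dots> = Y^2*(A*z+B-z*(C*z+D))"
    using z by (simp add: ABCD[symmetric] XY[symmetric]) (simp add: power2_eq_square algebra_simps)
  finally have *: "((S*A-Q*C)*P + (S*B-Q*D)*R)*w + ((S*A-Q*C)*Q + (S*B-Q*D)*S)
     - w*(((P*C-R*A)*P + (P*D-R*B)*R)*w + ((P*C-R*A)*Q + (P*D-R*B)*S)) = Y^2*(A*z+B-z*(C*z+D))" .
  have Y0: "Y \<noteq> 0" using Y by (simp add: XY ABCD)
  have "fixes_H2 (minv (p,q,r,s) \<cdot>\<^sub>m m \<cdot>\<^sub>m (p,q,r,s)) w \<longleftrightarrow>
     ((S*A-Q*C)*P + (S*B-Q*D)*R)*w + ((S*A-Q*C)*Q + (S*B-Q*D)*S)
     - w*(((P*C-R*A)*P + (P*D-R*B)*R)*w + ((P*C-R*A)*Q + (P*D-R*B)*S)) = 0"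
    unfolding conj by (simp add: fixes_H2_def ABCD)
  also have "\<dots> \<longleftrightarrow> A*z+B-z*(C*z+D) = 0" unfolding * using Y0 by simp
  also have "\<dots> \<longleftrightarrow> fixes_H2 m z" by (simp add: fixes_H2_def m ABCD)
  finally show ?thesis by simp
qed

text \<open>For z = iy the fixed point equation splits into a = d and b = -c*y^2, so b*c < 0 unless
  both vanish. The remaining points with a = d and b*c = 0 are parabolic up to sign and enter
  through the boundary conditions.\<close>

lemma Cset_Vert_0: "Cset (Vert 0) = cplane 1"
proof -
  have 1: "(\<exists>z\<in>geod_pts (Vert 0). fixes_H2 (a,b,c,d) z) \<longleftrightarrow> a = d \<and> (b = 0 \<and> c = 0 \<or> b*c < 0)"
    if "a*d - b*c = 1" for a b c d
  proof
    assume "\<exists>z\<in>geod_pts (Vert 0). fixes_H2 (a,b,c,d) z"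
    then obtain z where z: "Im z > 0" "Re z = 0" "fixes_H2 (a,b,c,d) z"
      by (auto simp: geod_pts_def H2_def)
    then have "a = d" "b = - c * (Im z)^2"
      by (auto simp: fixes_H2_def complex_eq_iff power2_eq_square)
    moreover have "b*c < 0" if "c \<noteq> 0"
    proof -
      have "b*c = - (c^2*(Im z)^2)" using calculation by (simp add: power2_eq_square)
      then show ?thesis using that z by simp
    qed
    ultimately show "a = d \<and> (b = 0 \<and> c = 0 \<or> b*c < 0)" by auto
  next
    assume *: "a = d \<and> (b = 0 \<and> c = 0 \<or> b*c < 0)"
    show "\<exists>z\<in>geod_pts (Vert 0). fixes_H2 (a,b,c,d) z"
    proof (cases "c = 0")
      case True
      then show ?thesis using * by (intro bexI[of _ \<i>]) (auto simp: fixes_H2_def geod_pts_def H2_def)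
    next
      case False
      then have "b*c < 0" using * by auto
      then have pos: "- b/c > 0" by (auto simp: mult_less_0_iff field_simps)
      define y where "y = sqrt (-b/c)"
      have y: "y > 0" "y^2 = -b/c" using pos by (simp_all add: y_def)
      then have "b = - c*y^2" using False by simp
      then have "fixes_H2 (a,b,c,d) (Complex 0 y)"
        using * by (auto simp: fixes_H2_def complex_eq_iff power2_eq_square)
      then show ?thesis using y by (intro bexI[of _ "Complex 0 y"]) (auto simp: geod_pts_def H2_def)
    qed
  qed
  have sq: "1 \<le> \<bar>x\<bar> \<longleftrightarrow> \<bar>y\<bar> \<le> \<bar>x\<bar>" if "x*y = 1" for x y :: real
  proof -
    have "\<bar>x\<bar>*\<bar>y\<bar> = 1" using that by (simp flip: abs_mult)
    moreover from this have "\<bar>x\<bar> > 0" by auto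
    ultimately have "\<bar>y\<bar> \<le> \<bar>x\<bar> \<longleftrightarrow> 1 \<le> \<bar>x\<bar> * \<bar>x\<bar>"
      using mult_le_cancel_left_pos[of "\<bar>x\<bar>" "\<bar>y\<bar>" "\<bar>x\<bar>"] by simp
    then show ?thesis using abs_le_square_iff[of 1 x] by (simp add: power2_eq_square)
  qed
  have 2: "x \<in> Cset (Vert 0) \<longleftrightarrow> x \<in> cplane 1" for x
  proof -
    obtain a b c d where x: "x = (a,b,c,d)" by (cases x)
    show ?thesis
    proof (cases "a*d - b*c = 1")
      case True
      have "x \<in> Cset (Vert 0) \<longleftrightarrow> a = d \<and> (b = 0 \<and> c = 0 \<or> b*c < 0) \<or> b = 0 \<and> \<bar>d\<bar> \<ge> 1 \<or> c = 0 \<and> \<bar>a\<bar> \<ge> 1"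
        unfolding Cset_def x mem_Collect_eq 1[OF True] using True
        by (auto simp: SL2_iff geod_ends_def nonrep_fixes_bdry_def)
      also have "\<dots> \<longleftrightarrow> a = d \<and> b*c \<le> 0 \<or> c = 0 \<and> \<bar>d\<bar> \<le> \<bar>a\<bar> \<or> b = 0 \<and> \<bar>a\<bar> \<le> \<bar>d\<bar>"
        using True sq[of a d] sq[of d a] by (auto simp: mult.commute)
      finally show ?thesis using True by (auto simp: x cplane_iff)
    qed (auto simp: x cplane_iff Cset_def SL2_iff)
  qed
  then show ?thesis by blast
qed

lemma minv_cplane: "minv ` cplane 1 = cplane (-1)"
proof -
  have 1: "minv x \<in> cplane (-e)" if "x \<in> cplane e" for x e
    using that by (cases x) (auto simp: cplane_iff mult.commute algebra_simps)
  show ?thesis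
  proof
    show "minv ` cplane 1 \<subseteq> cplane (-1)" using 1[of _ 1] by auto
    show "cplane (-1) \<subseteq> minv ` cplane 1"
    proof
      fix x assume x: "x \<in> cplane (-1)"
      then show "x \<in> minv ` cplane 1"
        using 1[of x "-1"] minv_minv[of x] subsetD[OF cplane_SL2 x] by (intro image_eqI[of _ minv "minv x"]) auto
    qed
  qed
qed

text \<open>The set C is natural under conjugation, so it suffices to take for k a Moebius map
  carrying the imaginary axis, with its ends 0 and \<infinity>, to l with its ends.\<close>

lemma Cset_conj:
  assumes "valid_geod l"
  obtains k where "k \<in> SL2" "Cset l = (\<lambda>h. k \<cdot>\<^sub>m h \<cdot>\<^sub>m minv k) ` cplane 1"
proof -
  have fin: "\<exists>k\<in>SL2. \<forall>m\<in>SL2. m \<in> Cset l \<longleftrightarrow> minv k \<cdot>\<^sub>m m \<cdot>\<^sub>m k \<in> Cset (Vert 0)"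
    if "k \<in> SL2" "geod_ends l = {\<xi>, \<eta>}"
      "\<And>m. (\<exists>z\<in>geod_pts l. fixes_H2 m z) \<longleftrightarrow> (\<exists>z\<in>geod_pts (Vert 0). fixes_H2 (minv k \<cdot>\<^sub>m m \<cdot>\<^sub>m k) z)"
      "\<And>m. nonrep_fixes_bdry m \<xi> \<longleftrightarrow> nonrep_fixes_bdry (minv k \<cdot>\<^sub>m m \<cdot>\<^sub>m k) (Some 0)"
      "\<And>m. nonrep_fixes_bdry m \<eta> \<longleftrightarrow> nonrep_fixes_bdry (minv k \<cdot>\<^sub>m m \<cdot>\<^sub>m k) None"
    for k \<xi> \<eta>
  proof (intro bexI[of _ k] ballI)
    fix m assume "m \<in> SL2"
    moreover from this have "minv k \<cdot>\<^sub>m m \<cdot>\<^sub>m k \<in> SL2" by (intro SL2_mmul SL2_minv that(1))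
    moreover have "geod_ends (Vert 0) = {Some 0, None}" by (simp add: geod_ends_def)
    ultimately show "m \<in> Cset l \<longleftrightarrow> minv k \<cdot>\<^sub>m m \<cdot>\<^sub>m k \<in> Cset (Vert 0)"
      unfolding Cset_def that(2) using that(3-5)[of m] by auto
  qed (rule that(1))
  have main: "\<exists>k\<in>SL2. \<forall>m\<in>SL2. m \<in> Cset l \<longleftrightarrow> minv k \<cdot>\<^sub>m m \<cdot>\<^sub>m k \<in> Cset (Vert 0)"
  proof (cases l)
    case (Vert x)
    let ?k = "(1,x,0,1) :: mat2"
    have k: "?k \<in> SL2" by (simp add: SL2_iff)
    have *: "fixes_H2 m z \<longleftrightarrow> fixes_H2 (minv ?k \<cdot>\<^sub>m m \<cdot>\<^sub>m ?k) w" if "z = w + of_real x" for m z w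
      by (rule fixes_H2_conj[OF k]) (use that in auto)
    have "(\<exists>z\<in>geod_pts l. fixes_H2 m z) \<longleftrightarrow> (\<exists>z\<in>geod_pts (Vert 0). fixes_H2 (minv ?k \<cdot>\<^sub>m m \<cdot>\<^sub>m ?k) z)" for m
    proof safe
      fix z assume "z \<in> geod_pts l" "fixes_H2 m z"
      then show "\<exists>z\<in>geod_pts (Vert 0). fixes_H2 (minv ?k \<cdot>\<^sub>m m \<cdot>\<^sub>m ?k) z"
        using *[of z "z - of_real x" m]
        by (intro bexI[of _ "z - of_real x"]) (auto simp: Vert geod_pts_def H2_def)
    next
      fix w assume "w \<in> geod_pts (Vert 0)" "fixes_H2 (minv ?k \<cdot>\<^sub>m m \<cdot>\<^sub>m ?k) w"
      then show "\<exists>z\<in>geod_pts l. fixes_H2 m z"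
        using *[of "w + of_real x" w m]
        by (intro bexI[of _ "w + of_real x"]) (auto simp: Vert geod_pts_def H2_def)
    qed
    moreover have "eigdir m (x,1) \<longleftrightarrow> eigdir (minv ?k \<cdot>\<^sub>m m \<cdot>\<^sub>m ?k) (0,1)"
      "eigdir m (1,0) \<longleftrightarrow> eigdir (minv ?k \<cdot>\<^sub>m m \<cdot>\<^sub>m ?k) (1,0)" for m
      using eigdir_conj[OF k, of m 0 1] eigdir_conj[OF k, of m 1 0] by auto
    ultimately show ?thesis
      by (intro fin[OF k, of "Some x" None]) (auto simp only: geod_ends_def Vert geod.case nonrep_None nonrep_Some)
  next
    case (Circ c r)
    then have r: "r > 0" using assms by (simp add: valid_geod_def)
    define t where "t = 1 / sqrt (2*r)"
    have t: "t \<noteq> 0" "t > 0" "t*t = 1/(2*r)" using r by (auto simp: t_def)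
    \<comment> \<open>This map sends 0 to c - r, \<infinity> to c + r and i to c + ir; the factor t
      makes the determinant 2*r*t^2 equal to 1.\<close>
    let ?k = "(t*(c+r), t*(c-r), t*1, t*1) :: mat2"
    have k: "?k \<in> SL2"
    proof -
      have "t*(c+r)*(t*1) - t*(c-r)*(t*1) = t*t*(2*r)" by (simp add: algebra_simps)
      then show ?thesis using t r by (simp add: SL2_iff)
    qed
    have *: "fixes_H2 m z \<longleftrightarrow> fixes_H2 (minv ?k \<cdot>\<^sub>m m \<cdot>\<^sub>m ?k) w"
      if "w + 1 \<noteq> 0" "z * (w+1) = of_real (c+r) * w + of_real (c-r)" for m z w
    proof (rule fixes_H2_conj[OF k])
      have e: "of_real (t*1) * w + of_real (t*1) = of_real t * (w+1)" by (simp add: algebra_simps)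
      show "of_real (t*1) * w + of_real (t*1) \<noteq> 0" unfolding e using that(1) t by simp
      show "z * (of_real (t*1) * w + of_real (t*1)) = of_real (t*(c+r)) * w + of_real (t*(c-r))"
        using arg_cong[OF that(2), of "\<lambda>x. of_real t * x"] unfolding e by (simp add: ac_simps distrib_left)
    qed
    have "(\<exists>z\<in>geod_pts l. fixes_H2 m z) \<longleftrightarrow> (\<exists>z\<in>geod_pts (Vert 0). fixes_H2 (minv ?k \<cdot>\<^sub>m m \<cdot>\<^sub>m ?k) z)" for m
    proof safe
      fix z assume z: "z \<in> geod_pts l" "fixes_H2 m z"
      define u where "u = z - of_real c"
      have u: "Im u > 0" "(Re u)^2 + (Im u)^2 = r^2"
        using z r by (auto simp: u_def Circ geod_pts_def H2_def cmod_def)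
      \<comment> \<open>The inverse Moebius map, written in the coordinate u centred at c.\<close>
      define w where "w = (of_real r + u) / (of_real r - u)"
      have ne: "of_real r - u \<noteq> 0" using u by (auto simp: complex_eq_iff)
      have w1: "(w + 1) * (of_real r - u) = of_real (2*r)" "(w - 1) * (of_real r - u) = 2*u"
        using ne by (simp_all add: w_def field_simps)
      have "z * (w+1) = of_real (c+r) * w + of_real (c-r)"
      proof -
        have "u * (w+1) * (of_real r - u) = of_real r * (w-1) * (of_real r - u)"
        proof -
          have "u * (w+1) * (of_real r - u) = u * ((w+1) * (of_real r - u))" by (simp only: mult.assoc)
          also have "\<dots> = of_real r * ((w-1) * (of_real r - u))" unfolding w1 by simp
          finally show ?thesis by (simp only: mult.assoc)
        qed
        then have "u * (w+1) = of_real r * (w-1)" using ne by simp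
        moreover have "z = u + of_real c" by (simp add: u_def)
        ultimately show ?thesis by (simp add: algebra_simps)
      qed
      moreover have "w + 1 \<noteq> 0" using w1(1) r by auto
      moreover have "w \<in> geod_pts (Vert 0)"
      proof -
        define N where "N = (r - Re u)^2 + (Im u)^2"
        have N: "N > 0" using u by (simp add: N_def add_nonneg_pos)
        have "Re w = ((r + Re u)*(r - Re u) + Im u * (- Im u)) / N"
          "Im w = (Im u * (r - Re u) - (r + Re u) * (- Im u)) / N"
          by (simp_all add: w_def Re_divide Im_divide N_def)
        moreover have "(r + Re u)*(r - Re u) + Im u * (- Im u) = 0"
          using u by (simp add: algebra_simps power2_eq_square)
        moreover have "Im u * (r - Re u) - (r + Re u) * (- Im u) = 2*r*Im u"
          by (simp add: algebra_simps)
        ultimately show ?thesis using N u r by (simp add: geod_pts_def H2_def)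
      qed
      ultimately show "\<exists>z\<in>geod_pts (Vert 0). fixes_H2 (minv ?k \<cdot>\<^sub>m m \<cdot>\<^sub>m ?k) z"
        using *[of w z m] z by blast
    next
      fix w assume w: "w \<in> geod_pts (Vert 0)" "fixes_H2 (minv ?k \<cdot>\<^sub>m m \<cdot>\<^sub>m ?k) w"
      then have w0: "Re w = 0" "Im w > 0" by (auto simp: geod_pts_def H2_def)
      have ne: "w + 1 \<noteq> 0" using w0 by (auto simp: complex_eq_iff)
      define z where "z = of_real c + of_real r * ((w-1)/(w+1))"
      have "z * (w+1) = of_real (c+r) * w + of_real (c-r)"
        using ne by (simp add: z_def field_simps)
      moreover have "z \<in> geod_pts l"
      proof -
        have "cmod (w-1) = cmod (w+1)" using w0 by (simp add: cmod_def)
        then have "cmod (z - of_real c) = r" using ne r by (simp add: z_def norm_mult norm_divide)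
        moreover have "Im ((w-1)/(w+1)) = 2 * Im w / (1 + (Im w)^2)"
          using w0 by (simp add: Im_divide)
        then have "Im ((w-1)/(w+1)) > 0" using w0 by (simp add: add_pos_nonneg)
        then have "r * Im X > 0" if "X = (w-1)/(w+1)" for X using r that by simp
        then have "Im z > 0" unfolding z_def by (simp del: times_divide_eq_right)
        ultimately show ?thesis by (simp add: Circ geod_pts_def H2_def)
      qed
      ultimately show "\<exists>z\<in>geod_pts l. fixes_H2 m z" using *[OF ne, of z m] w by blast
    qed
    moreover have "eigdir m (c-r,1) \<longleftrightarrow> eigdir (minv ?k \<cdot>\<^sub>m m \<cdot>\<^sub>m ?k) (0,1)"
      "eigdir m (c+r,1) \<longleftrightarrow> eigdir (minv ?k \<cdot>\<^sub>m m \<cdot>\<^sub>m ?k) (1,0)" for m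
      using eigdir_conj[OF k, of m 0 1] eigdir_conj[OF k, of m 1 0]
        eigdir_scale[OF t(1), of m "c-r" 1] eigdir_scale[OF t(1), of m "c+r" 1] by auto
    ultimately show ?thesis
      by (intro fin[OF k, of "Some (c - r)" "Some (c + r)"])
        (auto simp only: geod_ends_def Circ geod.case nonrep_None nonrep_Some)
  qed
  then obtain k where k: "k \<in> SL2" "\<And>m. m \<in> SL2 \<Longrightarrow> m \<in> Cset l \<longleftrightarrow> minv k \<cdot>\<^sub>m m \<cdot>\<^sub>m k \<in> cplane 1"
    unfolding Cset_Vert_0 by blast
  have "Cset l = (\<lambda>h. k \<cdot>\<^sub>m h \<cdot>\<^sub>m minv k) ` cplane 1"
  proof (intro equalityI subsetI)
    fix m :: mat2 assume m: "m \<in> Cset l"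
    then have "m \<in> SL2" by (simp add: Cset_def)
    moreover have "m = k \<cdot>\<^sub>m (minv k \<cdot>\<^sub>m m \<cdot>\<^sub>m k) \<cdot>\<^sub>m minv k"
      using k(1) by (simp add: mmul_assoc mmul_minv_cancel mmul_minv)
    ultimately show "m \<in> (\<lambda>h. k \<cdot>\<^sub>m h \<cdot>\<^sub>m minv k) ` cplane 1" using k(2) m by blast
  next
    fix m assume "m \<in> (\<lambda>h. k \<cdot>\<^sub>m h \<cdot>\<^sub>m minv k) ` cplane 1"
    then obtain h where h: "h \<in> cplane 1" and m: "m = k \<cdot>\<^sub>m h \<cdot>\<^sub>m minv k" by blast
    then have "h \<in> SL2" using cplane_SL2 by blast
    moreover have "h = minv k \<cdot>\<^sub>m (k \<cdot>\<^sub>m h \<cdot>\<^sub>m minv k) \<cdot>\<^sub>m k"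
      using k(1) by (simp add: mmul_assoc mmul_minv_cancel mmul_minv)
    ultimately show "m \<in> Cset l"
      using k(2)[OF SL2_mmul[OF SL2_mmul[OF k(1)] SL2_minv[OF k(1)]], of h] h unfolding m by simp
  qed
  with k(1) show thesis by (rule that)
qed

text \<open>For a left plane the matrix conjugating the geodesic is absorbed into both factors. For
  a right plane inversion exchanges the two factors and turns \<open>cplane 1\<close> into
  \<open>cplane (-1)\<close>.\<close>

lemma crooked_plane_normal_form:
  assumes "crooked_plane P"
  obtains g k e where "g \<in> SL2" "k \<in> SL2" "e = 1 \<or> e = -1"
    "P = (\<lambda>h. g \<cdot>\<^sub>m h \<cdot>\<^sub>m minv k) ` cplane e"
proof -
  have left: "\<exists>g\<in>SL2. \<exists>k\<in>SL2. Q = (\<lambda>h. g \<cdot>\<^sub>m h \<cdot>\<^sub>m minv k) ` cplane 1"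
    if "left_crooked_plane Q" for Q
  proof -
    obtain g1 g2 l where gl: "g1 \<in> SL2" "g2 \<in> SL2" "valid_geod l"
      "Q = (\<lambda>h. g2 \<cdot>\<^sub>m h \<cdot>\<^sub>m minv g1) ` Cset l"
      using \<open>left_crooked_plane Q\<close> by (auto simp: left_crooked_plane_def)
    obtain k where k: "k \<in> SL2" "Cset l = (\<lambda>h. k \<cdot>\<^sub>m h \<cdot>\<^sub>m minv k) ` cplane 1"
      using Cset_conj[OF gl(3)] .
    have "Q = (\<lambda>h. (g2 \<cdot>\<^sub>m k) \<cdot>\<^sub>m h \<cdot>\<^sub>m minv (g1 \<cdot>\<^sub>m k)) ` cplane 1"
      using gl k(1) by (simp add: k(2) image_image minv_mmul mmul_assoc)
    then show ?thesis using SL2_mmul[OF gl(2) k(1)] SL2_mmul[OF gl(1) k(1)] by blast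
  qed
  show thesis
  proof (cases "left_crooked_plane P")
    case True then show thesis using left that[of _ _ 1] by blast
  next
    case False
    then obtain Q where Q: "left_crooked_plane Q" "P = minv ` Q"
      using assms by (auto simp: crooked_plane_def right_crooked_plane_def)
    then obtain g k where gk: "g \<in> SL2" "k \<in> SL2" "Q = (\<lambda>h. g \<cdot>\<^sub>m h \<cdot>\<^sub>m minv k) ` cplane 1"
      using left by blast
    have "minv (g \<cdot>\<^sub>m h \<cdot>\<^sub>m minv k) = k \<cdot>\<^sub>m minv h \<cdot>\<^sub>m minv g" if "h \<in> cplane 1" for h
      using that cplane_SL2[of 1] gk
      by (subst minv_mmul) (auto simp: minv_mmul SL2_mmul SL2_minv minv_minv mmul_assoc)
    then have "P = (\<lambda>h. k \<cdot>\<^sub>m h \<cdot>\<^sub>m minv g) ` cplane (-1)"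
      by (simp add: Q gk(3) image_image flip: minv_cplane)
    then show thesis using gk that[of k g "-1"] by blast
  qed
qed

section \<open>Following a crooked plane\<close>

text \<open>Near the points under consideration, the two sides of \<open>cplane e\<close> are \<open>side e 1\<close> and
  \<open>side e (-1)\<close>; far away from them these sets have no meaning.\<close>

definition side :: "real \<Rightarrow> real \<Rightarrow> mat2 set" where
  "side e s = {(a,b,c,d). a*d - b*c = 1 \<and>
     (0 < s*b \<and> e*(a-d) < 0 \<or> 0 < s*c \<and> 0 < e*(a-d) \<or> 0 < s*b \<and> 0 < s*c)}"

lemma side_iff: "(a,b,c,d) \<in> side e s \<longleftrightarrow> a*d - b*c = 1 \<and>
     (0 < s*b \<and> e*(a-d) < 0 \<or> 0 < s*c \<and> 0 < e*(a-d) \<or> 0 < s*b \<and> 0 < s*c)"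
  by (simp add: side_def)

lemma side_SL2: "side e s \<subseteq> SL2"
  by (auto simp: side_def SL2_iff)

text \<open>Connectedness lets U fill a whole side near z once it meets it; nonemptiness for
  arbitrarily small B makes z adherent to both sides. B is open in R^4, hence the intersections with
  \<open>SL2\<close>.\<close>

definition two_sided :: "real \<Rightarrow> mat2 \<Rightarrow> bool" where
  "two_sided e z \<longleftrightarrow> (\<forall>A. open A \<and> z \<in> A \<longrightarrow> (\<exists>B. open B \<and> z \<in> B \<and> B \<inter> SL2 \<subseteq> A \<and>
     (\<forall>s\<in>{1,-1}. connected (B \<inter> side e s) \<and> B \<inter> side e s \<noteq> {} \<and> B \<inter> side e s \<inter> cplane e = {}) \<and>
     B \<inter> SL2 \<subseteq> side e 1 \<union> side e (-1) \<union> cplane e))"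

lemma two_sidedE:
  assumes "two_sided e z" "open A" "z \<in> A"
  obtains B where "open B" "z \<in> B" "B \<inter> SL2 \<subseteq> A"
    "\<And>s. s \<in> {1,-1} \<Longrightarrow> connected (B \<inter> side e s)"
    "\<And>s. s \<in> {1,-1} \<Longrightarrow> B \<inter> side e s \<noteq> {}"
    "\<And>s. s \<in> {1,-1} \<Longrightarrow> B \<inter> side e s \<inter> cplane e = {}"
    "B \<inter> SL2 \<subseteq> side e 1 \<union> side e (-1) \<union> cplane e"
proof -
  obtain B where B: "open B" "z \<in> B" "B \<inter> SL2 \<subseteq> A"
     "\<forall>s\<in>{1,-1}. connected (B \<inter> side e s) \<and> B \<inter> side e s \<noteq> {} \<and> B \<inter> side e s \<inter> cplane e = {}"
     "B \<inter> SL2 \<subseteq> side e 1 \<union> side e (-1) \<union> cplane e"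
    using assms(1)[unfolded two_sided_def, rule_format, OF conjI[OF assms(2,3)]] by blast
  show thesis by (rule that[OF B(1-3) _ _ _ B(5)]) (use B(4) in blast)+
qed

text \<open>An open-closed argument: the points of M adherent to the part of U on side s form a
  relatively closed set. It is relatively open, because near such a point U contains all of the
  side, to which the nearby points of M are adherent as well. D stands for the other planes and is
  avoided by shrinking neighbourhoods.\<close>

lemma follow_plane:
  assumes M: "connected M" "M \<subseteq> cplane e" "\<And>z. z \<in> M \<Longrightarrow> two_sided e z"
    and D: "closed D" "D \<inter> cplane e = {}"
    and U: "U \<subseteq> SL2" "U \<inter> cplane e = {}"
    and conn: "\<And>T. connected T \<Longrightarrow> T \<subseteq> SL2 \<Longrightarrow> T \<inter> (cplane e \<union> D) = {} \<Longrightarrow> T \<inter> U \<noteq> {} \<Longrightarrow> T \<subseteq> U"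
    and z0: "z0 \<in> M" "z0 \<in> closure U"
  obtains s where "s \<in> {1,-1}" "\<And>z. z \<in> M \<Longrightarrow> \<exists>B. open B \<and> z \<in> B \<and> B \<inter> side e s \<subseteq> U"
proof -
  define A where "A s = {z\<in>M. z \<in> closure (U \<inter> side e s)}" for s
  have key: "\<exists>B. open B \<and> z \<in> B \<and> B \<inter> side e s \<subseteq> U \<and> M \<inter> B \<subseteq> A s"
    if s: "s \<in> {1,-1}" and z: "z \<in> A s" for s z
  proof -
    have zM: "z \<in> M" and zc: "z \<in> closure (U \<inter> side e s)" using z by (auto simp: A_def)
    have "open (- D)" "z \<in> - D" using D M(2) zM by auto
    from two_sidedE[OF M(3)[OF zM] this] obtain B where B: "open B" "z \<in> B" "B \<inter> SL2 \<subseteq> - D"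
      "connected (B \<inter> side e s)" "B \<inter> side e s \<inter> cplane e = {}" using s by metis
    have "B \<inter> (U \<inter> side e s) \<noteq> {}" using zc B(1,2) open_Int_closure_eq_empty by blast
    then have BU: "B \<inter> side e s \<subseteq> U"
      using B side_SL2[of e s] by (intro conn) auto
    moreover have "z' \<in> A s" if z': "z' \<in> M" "z' \<in> B" for z'
    proof -
      have "z' \<in> closure (U \<inter> side e s)"
        unfolding closure_iff_nhds_not_empty
      proof (intro allI impI)
        fix W V assume V: "V \<subseteq> W" "open V" "z' \<in> V"
        then have "open (V \<inter> B)" "z' \<in> V \<inter> B" using B z' by auto
        from two_sidedE[OF M(3)[OF z'(1)] this] obtain B' where "B' \<inter> SL2 \<subseteq> V \<inter> B" "B' \<inter> side e s \<noteq> {}"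
          using s by metis
        then show "U \<inter> side e s \<inter> W \<noteq> {}" using BU side_SL2[of e s] V(1) by blast
      qed
      then show ?thesis using z' by (simp add: A_def)
    qed
    ultimately show ?thesis using B by blast
  qed
  have A_all: "A s = M" if s: "s \<in> {1,-1}" and ne: "A s \<noteq> {}" for s
  proof -
    have "A s = M \<inter> closure (U \<inter> side e s)" by (auto simp: A_def)
    then have "closedin (top_of_set M) (A s)" by (metis closed_closure closedin_closed_Int)
    moreover have "openin (top_of_set M) (A s)"
    proof (subst openin_subopen, intro ballI)
      fix z assume "z \<in> A s"
      then obtain B where "open B" "z \<in> B" "M \<inter> B \<subseteq> A s" using key[OF s] by blast
      then show "\<exists>T. openin (top_of_set M) T \<and> z \<in> T \<and> T \<subseteq> A s"
        using \<open>z \<in> A s\<close> by (intro exI[of _ "M \<inter> B"]) (auto simp: A_def)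
    qed
    ultimately show ?thesis using M(1) ne unfolding connected_clopen by blast
  qed
  \<comment> \<open>U misses the plane, so its points near z0 lie on one of the two sides.\<close>
  have "\<exists>s\<in>{1,-1}. A s \<noteq> {}"
  proof (rule ccontr)
    assume *: "\<not> ?thesis"
    define V where "V = - closure (U \<inter> side e 1) \<inter> - closure (U \<inter> side e (-1))"
    have "z0 \<notin> closure (U \<inter> side e 1)" "z0 \<notin> closure (U \<inter> side e (-1))"
      using * z0(1) unfolding A_def by blast+
    then have "open V" "z0 \<in> V" by (auto simp: V_def)
    from two_sidedE[OF M(3)[OF z0(1)] this] obtain B where B: "open B" "z0 \<in> B" "B \<inter> SL2 \<subseteq> V"
      "B \<inter> SL2 \<subseteq> side e 1 \<union> side e (-1) \<union> cplane e" by metis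
    then have "B \<inter> U \<noteq> {}" using z0 open_Int_closure_eq_empty by blast
    then obtain x where "x \<in> B" "x \<in> U" by blast
    then have "x \<in> V" "x \<in> side e 1 \<union> side e (-1)" using B U by blast+
    then have "x \<in> closure (U \<inter> side e 1) \<or> x \<in> closure (U \<inter> side e (-1))"
      using \<open>x \<in> U\<close> by (auto intro: closure_subset[THEN subsetD])
    then show False using \<open>x \<in> V\<close> by (simp add: V_def)
  qed
  then obtain s where s: "s \<in> {1,-1}" "A s \<noteq> {}" by blast
  from A_all[OF this] s(1) show thesis using key[OF s(1)] by (intro that[of s]) blast+
qed

section \<open>The local shape of a crooked plane, in charts\<close>

definition cube :: "real \<times> real \<times> real \<Rightarrow> real \<Rightarrow> (real \<times> real \<times> real) set" where
  "cube = (\<lambda>(x,y,w) r. {x-r<..<x+r} \<times> {y-r<..<y+r} \<times> {w-r<..<w+r})"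

lemma cube_iff: "(x',y',w') \<in> cube (x,y,w) r \<longleftrightarrow> \<bar>x'-x\<bar> < r \<and> \<bar>y'-y\<bar> < r \<and> \<bar>w'-w\<bar> < r"
  by (auto simp: cube_def)

lemma cube_open: "open (cube q r)" and cube_convex: "convex (cube q r)"
  by (cases q; auto simp: cube_def intro!: open_Times convex_Times)+

lemma cube_center: "r > 0 \<Longrightarrow> q \<in> cube q r"
  by (cases q) (simp add: cube_iff)

lemma cube_mono: "r \<le> r' \<Longrightarrow> cube q r \<subseteq> cube q r'"
  by (cases q) (auto simp: cube_def)

lemma cube_subset_open:
  assumes "open A" "q \<in> A" obtains r where "r > 0" "cube q r \<subseteq> A"
proof -
  obtain x y w where q: "q = (x,y,w)" by (cases q)
  obtain P Q where "open P" "open Q" "(x,y,w) \<in> P \<times> Q" "P \<times> Q \<subseteq> A"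
    using assms q by (metis open_prod_elim)
  moreover from this obtain Q1 Q2 where "open Q1" "open Q2" "(y,w) \<in> Q1 \<times> Q2" "Q1 \<times> Q2 \<subseteq> Q"
    by (metis SigmaD2 open_prod_elim)
  ultimately have *: "open P" "open Q1" "open Q2" "x \<in> P" "y \<in> Q1" "w \<in> Q2" "P \<times> Q1 \<times> Q2 \<subseteq> A"
    by auto
  obtain r1 where r1: "r1 > 0" "\<And>t. \<bar>t - x\<bar> < r1 \<Longrightarrow> t \<in> P"
    using *(1,4) unfolding open_dist dist_real_def by blast
  obtain r2 where r2: "r2 > 0" "\<And>t. \<bar>t - y\<bar> < r2 \<Longrightarrow> t \<in> Q1"
    using *(2,5) unfolding open_dist dist_real_def by blast
  obtain r3 where r3: "r3 > 0" "\<And>t. \<bar>t - w\<bar> < r3 \<Longrightarrow> t \<in> Q2"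
    using *(3,6) unfolding open_dist dist_real_def by blast
  show thesis
  proof (rule that[of "min r1 (min r2 r3)"])
    show "cube q (min r1 (min r2 r3)) \<subseteq> A"
    proof
      fix p assume "p \<in> cube q (min r1 (min r2 r3))"
      then show "p \<in> A" using r1 r2 r3 *(7) by (cases p) (auto simp: q cube_iff)
    qed
  qed (use r1 r2 r3 in auto)
qed

lemma image_Int_Collect: "f ` A \<inter> B = f ` {x \<in> A. f x \<in> B}"
  by auto

text \<open>The question is moved to cubes in R^3, where sides are cut out by half-spaces and
  connectedness follows from convexity. As \<kappa> is continuous on an open set of R^4, the
  preimage of a cube is an admissible neighbourhood B, and it meets \<open>SL2\<close> in the chart
  image of that cube.\<close>

lemma two_sided_chart:
  fixes \<psi> :: "real \<times> real \<times> real \<Rightarrow> mat2"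
  assumes W: "open W" "continuous_on W \<kappa>"
    and E: "open E" "continuous_on E \<psi>" "q \<in> E" "\<psi> q \<in> W"
    and \<psi>: "\<And>p. p \<in> E \<Longrightarrow> \<psi> p \<in> W \<inter> SL2 \<and> \<kappa> (\<psi> p) = p"
    and \<kappa>: "\<And>x. x \<in> W \<inter> SL2 \<Longrightarrow> \<psi> (\<kappa> x) = x"
    and r0: "r0 > 0" "cube q r0 \<subseteq> E"
    and sides: "\<And>r s. 0 < r \<Longrightarrow> r \<le> r0 \<Longrightarrow> s \<in> {1,-1} \<Longrightarrow> connected {p \<in> cube q r. \<psi> p \<in> side e s}"
      "\<And>r s. 0 < r \<Longrightarrow> r \<le> r0 \<Longrightarrow> s \<in> {1,-1} \<Longrightarrow> \<exists>p \<in> cube q r. \<psi> p \<in> side e s"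
    and part: "\<And>p. p \<in> cube q r0 \<Longrightarrow> \<psi> p \<in> side e 1 \<or> \<psi> p \<in> side e (-1) \<or> \<psi> p \<in> cplane e"
      "\<And>p s. p \<in> cube q r0 \<Longrightarrow> s \<in> {1,-1} \<Longrightarrow> \<psi> p \<in> side e s \<Longrightarrow> \<psi> p \<notin> cplane e"
  shows "two_sided e (\<psi> q)"
  unfolding two_sided_def
proof (intro allI impI, elim conjE)
  fix A assume A: "open A" "\<psi> q \<in> A"
  have "open (E \<inter> \<psi> -` A)" by (rule continuous_open_preimage[OF E(2,1) A(1)])
  moreover have "q \<in> E \<inter> \<psi> -` A" using A E by auto
  ultimately obtain r1 where r1: "r1 > 0" "cube q r1 \<subseteq> E \<inter> \<psi> -` A" by (rule cube_subset_open)
  define r where "r = min r0 r1"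
  have r: "r > 0" "r \<le> r0" "cube q r \<subseteq> cube q r0" "cube q r \<subseteq> cube q r1" "cube q r \<subseteq> E"
    using r0 r1 cube_mono[of r r0 q] cube_mono[of r r1 q] by (auto simp: r_def)
  define B where "B = W \<inter> \<kappa> -` cube q r"
  have BS: "B \<inter> SL2 = \<psi> ` cube q r"
  proof
    show "B \<inter> SL2 \<subseteq> \<psi> ` cube q r"
    proof
      fix x assume "x \<in> B \<inter> SL2"
      then have "x = \<psi> (\<kappa> x)" "\<kappa> x \<in> cube q r" using \<kappa> by (auto simp: B_def)
      then show "x \<in> \<psi> ` cube q r" by blast
    qed
    show "\<psi> ` cube q r \<subseteq> B \<inter> SL2" using \<psi> r(5) by (auto simp: B_def)
  qed
  have Bs: "B \<inter> side e s = \<psi> ` {p \<in> cube q r. \<psi> p \<in> side e s}" for s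
  proof -
    have "B \<inter> side e s = \<psi> ` cube q r \<inter> side e s" using side_SL2[of e s] unfolding BS[symmetric] by auto
    then show ?thesis by (simp only: image_Int_Collect)
  qed
  show "\<exists>B. open B \<and> \<psi> q \<in> B \<and> B \<inter> SL2 \<subseteq> A \<and>
     (\<forall>s\<in>{1,-1}. connected (B \<inter> side e s) \<and> B \<inter> side e s \<noteq> {} \<and> B \<inter> side e s \<inter> cplane e = {}) \<and>
     B \<inter> SL2 \<subseteq> side e 1 \<union> side e (-1) \<union> cplane e"
  proof (intro exI[of _ B] conjI ballI)
    show "open B" unfolding B_def by (rule continuous_open_preimage[OF W(2,1) cube_open])
    show "\<psi> q \<in> B" using BS cube_center[OF r(1), of q] by blast
    show "B \<inter> SL2 \<subseteq> A" unfolding BS using r(4) r1(2) by blast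
    show "B \<inter> SL2 \<subseteq> side e 1 \<union> side e (-1) \<union> cplane e" unfolding BS using part(1) r(3) by blast
    fix s :: real assume s: "s \<in> {1,-1}"
    have "continuous_on {p \<in> cube q r. \<psi> p \<in> side e s} \<psi>"
      using E(2) by (rule continuous_on_subset) (use r(5) in auto)
    then show "connected (B \<inter> side e s)" unfolding Bs
      by (rule connected_continuous_image) (rule sides(1)[OF r(1,2) s])
    show "B \<inter> side e s \<noteq> {}" unfolding Bs using sides(2)[OF r(1,2) s] by blast
    show "B \<inter> side e s \<inter> cplane e = {}" unfolding Bs using part(2)[OF _ s] r(3) by blast
  qed
qed

definition stem_pt :: "real \<times> real \<Rightarrow> mat2" where
  "stem_pt = (\<lambda>(a,b). (a, b, (a*a-1)/b, a))"

text \<open>The chart with coordinates \<open>(a - d, b, c)\<close> on the matrices of positive trace.\<close>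

definition chi :: "real \<times> real \<times> real \<Rightarrow> mat2" where
  "chi = (\<lambda>(v,b,c). ((sqrt (4+4*(b*c)+v * v) + v)/2, b, c, (sqrt (4+4*(b*c)+v * v) - v)/2))"

lemma convex_less: "convex {p :: real \<times> real \<times> real. x * fst p + y * fst (snd p) + w * snd (snd p) < 0}"
proof -
  have "convex {p. inner (x,y,w) p < 0}" by (rule convex_halfspace_lt)
  moreover have "inner (x,y,w) p = x * fst p + y * fst (snd p) + w * snd (snd p)" for p
    by (cases p) (simp add: inner_Pair)
  ultimately show ?thesis by simp
qed

lemma two_sided_stem:
  assumes e: "e = 1 \<or> e = -1" and a0: "\<bar>a0\<bar> < 1" and b0: "b0 > 0"
  shows "two_sided e (stem_pt (a0,b0))"
proof -
  define \<psi> :: "real \<times> real \<times> real \<Rightarrow> mat2" where "\<psi> = (\<lambda>(a,d,b). (a, b, (a*d-1)/b, d))"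
  define \<kappa> :: "mat2 \<Rightarrow> real \<times> real \<times> real" where "\<kappa> = (\<lambda>(a,b,c,d). (a,d,b))"
  define W :: "mat2 set" where "W = {x. 0 < fst (snd x)}"
  define E :: "(real \<times> real \<times> real) set" where "E = {p. 0 < snd (snd p)}"
  define q where "q = (a0,a0,b0)"
  \<comment> \<open>This radius keeps b positive and |a|, |d| below 1. Then a*d < 1 and c is
    negative, so only the sign of a - d distinguishes the sides.\<close>
  define r0 where "r0 = min b0 (1 - \<bar>a0\<bar>)"
  have \<psi>E: "\<psi> p \<in> W \<inter> SL2 \<and> \<kappa> (\<psi> p) = p" if "p \<in> E" for p
    using that by (cases p) (auto simp: E_def W_def \<psi>_def \<kappa>_def SL2_iff)
  have r0: "r0 > 0" using a0 b0 by (simp add: r0_def)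
  have box: "b > 0 \<and> (a*d-1)/b < 0" if "(a,d,b) \<in> cube q r0" for a d b
  proof -
    have "\<bar>a - a0\<bar> < 1 - \<bar>a0\<bar>" "\<bar>d - a0\<bar> < 1 - \<bar>a0\<bar>" "\<bar>b - b0\<bar> < b0"
      using that by (auto simp: q_def cube_iff r0_def)
    then have "\<bar>a\<bar> < 1" "\<bar>d\<bar> < 1" "b > 0" by linarith+
    then have "\<bar>a\<bar> * \<bar>d\<bar> < 1" using mult_left_mono[of "\<bar>d\<bar>" 1 "\<bar>a\<bar>"] by simp
    then have "a * d < 1" by (simp flip: abs_mult)
    then show ?thesis using \<open>b > 0\<close> by (simp add: divide_neg_pos)
  qed
  have inv: "b * ((a*d-1)/b) = a*d-1" if "b > 0" for a b d :: real using that by simp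
  have side: "\<psi> (a,d,b) \<in> side e s \<longleftrightarrow> s*e*(a-d) < 0" if p: "(a,d,b) \<in> cube q r0" and s: "s \<in> {1,-1}" for a d b s
  proof -
    define c where "c = (a*d-1)/b"
    have "b > 0" "c < 0" "b*c = a*d-1" using box[OF p] inv by (auto simp: c_def)
    then show ?thesis using s e by (auto simp: \<psi>_def side_iff simp flip: c_def)
  qed
  have plane: "\<psi> (a,d,b) \<in> cplane e \<longleftrightarrow> a = d" if p: "(a,d,b) \<in> cube q r0" for a d b
  proof -
    define c where "c = (a*d-1)/b"
    have "b > 0" "c < 0" "b*c = a*d-1" using box[OF p] inv by (auto simp: c_def)
    moreover from this(1,2) have "b*c < 0" by (rule mult_pos_neg)
    ultimately show ?thesis by (auto simp: \<psi>_def cplane_iff simp flip: c_def)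
  qed
  have "two_sided e (\<psi> q)"
  proof (rule two_sided_chart[where W = W and \<kappa> = \<kappa> and E = E and q = q and ?r0.0 = r0])
    show "open W" unfolding W_def by (intro open_Collect_less continuous_intros)
    show "continuous_on W \<kappa>" unfolding \<kappa>_def split_beta by (intro continuous_intros)
    show "open E" unfolding E_def by (intro open_Collect_less continuous_intros)
    show "continuous_on E \<psi>" unfolding \<psi>_def split_beta by (intro continuous_intros) (auto simp: E_def)
    show "q \<in> E" using b0 by (simp add: q_def E_def)
    then show "\<psi> q \<in> W" using \<psi>E by blast
    show "\<psi> (\<kappa> x) = x" if "x \<in> W \<inter> SL2" for x
      using that by (cases x) (auto simp: W_def \<kappa>_def \<psi>_def SL2_iff field_simps)
    show "cube q r0 \<subseteq> E"
    proof
      fix p assume "p \<in> cube q r0" then show "p \<in> E" using box by (cases p) (auto simp: E_def)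
    qed
    fix r s :: real assume r: "0 < r" "r \<le> r0" and s: "s \<in> {1,-1}"
    have eq: "{p \<in> cube q r. \<psi> p \<in> side e s} = cube q r \<inter> {p. (s*e) * fst p + (-s*e) * fst (snd p) + 0 * snd (snd p) < 0}"
      using side[OF _ s] cube_mono[OF r(2), of q] by (auto simp: algebra_simps)
    show "connected {p \<in> cube q r. \<psi> p \<in> side e s}"
      unfolding eq by (intro convex_connected convex_Int cube_convex convex_less)
    define p where "p = (a0 - s*e*(r/2), a0, b0)"
    have p: "p \<in> cube q r" using s e r by (auto simp: p_def q_def cube_iff)
    then have "(a0 - s*e*(r/2), a0, b0) \<in> cube q r0" using cube_mono[OF r(2), of q] by (auto simp: p_def)
    from side[OF this s] have "\<psi> p \<in> side e s" using s e r by (auto simp: p_def)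
    then show "\<exists>p\<in>cube q r. \<psi> p \<in> side e s" using p by blast
  next
    fix p assume p: "p \<in> cube q r0"
    obtain a d b where p': "p = (a,d,b)" by (cases p)
    show "\<psi> p \<in> side e 1 \<or> \<psi> p \<in> side e (-1) \<or> \<psi> p \<in> cplane e"
      using side[OF p[unfolded p'], of 1] side[OF p[unfolded p'], of "-1"] plane[OF p[unfolded p']] e
      unfolding p' by auto
    show "\<psi> p \<notin> cplane e" if "s \<in> {1,-1}" "\<psi> p \<in> side e s" for s
      using that(2) side[OF p[unfolded p'] that(1)] plane[OF p[unfolded p']] unfolding p' by auto
  qed (use \<psi>E r0 in auto)
  then show ?thesis by (simp add: \<psi>_def q_def stem_pt_def)
qed

lemma chi_SL2:
  assumes "4+4*(b*c)+v * v > 0"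
  shows "chi (v,b,c) \<in> SL2" "sqrt (4+4*(b*c)+v * v) > 0"
proof -
  define t where "t = sqrt (4+4*(b*c)+v * v)"
  have "t*t = 4+4*(b*c)+v * v" using assms by (simp add: t_def)
  then have "(t+v)/2*((t-v)/2) - b*c = 1" by (simp add: field_simps)
  then show "chi (v,b,c) \<in> SL2" by (simp add: chi_def SL2_iff flip: t_def)
qed (use assms in simp)

lemma chi_side:
  assumes "4+4*(b*c)+v * v > 0"
  shows "chi (v,b,c) \<in> side e s \<longleftrightarrow> 0 < s*b \<and> e* v < 0 \<or> 0 < s*c \<and> 0 < e* v \<or> 0 < s*b \<and> 0 < s*c"
proof -
  define t where "t = sqrt (4+4*(b*c)+v * v)"
  have "(t+v)/2*((t-v)/2) - b*c = 1" using chi_SL2(1)[OF assms] by (simp add: chi_def SL2_iff flip: t_def)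
  moreover have "(t+v)/2 - (t-v)/2 = v" by (simp add: field_simps)
  ultimately show ?thesis by (simp add: chi_def side_iff flip: t_def)
qed

lemma chi_cplane:
  assumes "4+4*(b*c)+v * v > 0"
  shows "chi (v,b,c) \<in> cplane e \<longleftrightarrow> v = 0 \<and> b*c \<le> 0 \<or> c = 0 \<and> 0 \<le> e* v \<or> b = 0 \<and> e* v \<le> 0"
proof -
  define t where "t = sqrt (4+4*(b*c)+v * v)"
  have det: "(t+v)/2*((t-v)/2) - b*c = 1" using chi_SL2(1)[OF assms] by (simp add: chi_def SL2_iff flip: t_def)
  have "\<bar>(t+v)/2\<bar> - \<bar>(t-v)/2\<bar> = v" if "b*c = 0"
  proof -
    have "(t+v)/2*((t-v)/2) > 0" using det that by simp
    then have "(t+v)*(t-v) > 0" by simp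
    moreover have "t > 0" using chi_SL2(2)[OF assms] by (simp add: t_def)
    ultimately have "t+v > 0" "t-v > 0" by (auto simp: zero_less_mult_iff)
    then show ?thesis by (simp add: field_simps)
  qed
  moreover have "(t+v)/2 = (t-v)/2 \<longleftrightarrow> v = 0" by auto
  ultimately show ?thesis using det by (auto simp: chi_def cplane_iff simp flip: t_def)
qed

lemma wing_signs:
  fixes b c x :: real
  assumes "0 < x \<or> b \<noteq> 0"
  shows "0 < b \<and> x < 0 \<or> 0 < c \<and> 0 < x \<or> 0 < b \<and> 0 < c \<or>
      0 < - b \<and> x < 0 \<or> 0 < - c \<and> 0 < x \<or> 0 < - b \<and> 0 < - c \<or>
      x = 0 \<and> b*c \<le> 0 \<or> c = 0 \<and> 0 \<le> x \<or> b = 0 \<and> x \<le> 0"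
  by (rule linorder_cases[of b 0]; rule linorder_cases[of c 0]; rule linorder_cases[of x 0];
      use assms in \<open>auto simp: mult_le_0_iff\<close>)

lemma wing_signs':
  fixes b c x s :: real
  assumes "0 < x \<or> b \<noteq> 0" "s = 1 \<or> s = -1"
    "0 < s*b \<and> x < 0 \<or> 0 < s*c \<and> 0 < x \<or> 0 < s*b \<and> 0 < s*c"
  shows "\<not> (x = 0 \<and> b*c \<le> 0 \<or> c = 0 \<and> 0 \<le> x \<or> b = 0 \<and> x \<le> 0)"
  by (rule linorder_cases[of b 0]; rule linorder_cases[of c 0]; rule linorder_cases[of x 0];
      use assms in \<open>auto simp: mult_le_0_iff\<close>)

text \<open>In the coordinates (v,b,c) there are two local pictures. Where v0 is nonzero the sides
  are the two halves of a cube cut by c = 0. On the edge v0 = 0, where stem and wing meet, one side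
  is a quarter of the cube and the other the remaining three quarters.\<close>

lemma two_sided_wing:
  assumes e: "e = 1 \<or> e = -1" and v0: "0 \<le> e* v0" and ne: "v0 \<noteq> 0 \<or> b0 \<noteq> 0"
  shows "two_sided e (chi (v0,b0,0))"
proof -
  define \<kappa> :: "mat2 \<Rightarrow> real \<times> real \<times> real" where "\<kappa> = (\<lambda>(a,b,c,d). (a-d,b,c))"
  define W :: "mat2 set" where "W = {x. 0 < fst x + snd (snd (snd x))}"
  define E :: "(real \<times> real \<times> real) set" where "E = {p. 0 < 4 + 4 * (fst (snd p) * snd (snd p)) + fst p * fst p}"
  define q where "q = (v0,b0,0::real)"
  \<comment> \<open>The first bound keeps the sign of whichever coordinate is known to be nonzero, b
    on the edge and v elsewhere. The bound 1/(|b0|+2) gives |b*c| < 1, so that the radicand in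
    \<open>chi\<close> stays positive.\<close>
  define r0 where "r0 = (if v0 = 0 then min \<bar>b0\<bar> (1/(\<bar>b0\<bar>+2)) else min \<bar>v0\<bar> (1/(\<bar>b0\<bar>+2)))"
  have r0: "r0 > 0" "r0 \<le> 1/(\<bar>b0\<bar>+2)" using ne by (auto simp: r0_def)
  have \<psi>E: "chi p \<in> W \<inter> SL2 \<and> \<kappa> (chi p) = p" if "p \<in> E" for p
  proof (cases p)
    case (fields v b c)
    then have *: "4+4*(b*c)+v * v > 0" using that by (simp add: E_def)
    define t where "t = sqrt (4+4*(b*c)+v * v)"
    have "t > 0" using chi_SL2(2)[OF *] by (simp add: t_def)
    then show ?thesis using chi_SL2(1)[OF *]
      by (simp add: fields W_def \<kappa>_def chi_def flip: t_def) (simp add: field_simps)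
  qed
  have box: "4+4*(b*c)+v * v > 0" if "(v,b,c) \<in> cube q r0" for v b c
  proof -
    have "r0 < 1" using r0(2) by (smt (verit) divide_less_eq_1_pos abs_ge_zero)
    moreover have "\<bar>b - b0\<bar> < r0" "\<bar>c\<bar> < r0" using that by (auto simp: q_def cube_iff)
    ultimately have bc: "\<bar>b\<bar> \<le> \<bar>b0\<bar> + 2" "\<bar>c\<bar> < 1/(\<bar>b0\<bar>+2)" using r0(2) by linarith+
    have "\<bar>b\<bar>*\<bar>c\<bar> \<le> (\<bar>b0\<bar>+2)*\<bar>c\<bar>" using bc by (intro mult_right_mono) auto
    also have "\<dots> < 1" using bc(2) by (simp add: pos_less_divide_eq mult.commute)
    finally have "\<bar>b*c\<bar> < 1" by (simp add: abs_mult)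
    then show ?thesis using zero_le_square[of v] by linarith
  qed
  show ?thesis unfolding q_def[symmetric]
  proof (rule two_sided_chart[where W = W and \<kappa> = \<kappa> and E = E and q = q and ?r0.0 = r0])
    show "open W" unfolding W_def by (intro open_Collect_less continuous_intros)
    show "continuous_on W \<kappa>" unfolding \<kappa>_def split_beta by (intro continuous_intros)
    show "open E" unfolding E_def by (intro open_Collect_less continuous_intros)
    show "continuous_on E chi" unfolding chi_def split_beta by (intro continuous_intros) auto
    show qE: "q \<in> E" by (simp add: q_def E_def add_pos_nonneg)
    then show "chi q \<in> W" using \<psi>E by blast
    show "chi (\<kappa> x) = x" if x: "x \<in> W \<inter> SL2" for x
    proof (cases x)
      case (fields a b c d)
      then have "a + d > 0" "a*d - b*c = 1" using x by (auto simp: W_def SL2_iff)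
      then have "4 + 4*(b*c) + (a-d)*(a-d) = (a+d)^2" by (simp add: power2_eq_square algebra_simps)
      then have "sqrt (4 + 4*(b*c) + (a-d)*(a-d)) = a+d" using \<open>a + d > 0\<close> by simp
      then show ?thesis by (simp add: fields \<kappa>_def chi_def)
    qed
    show "cube q r0 \<subseteq> E"
    proof
      fix p assume "p \<in> cube q r0" then show "p \<in> E" using box by (cases p) (auto simp: E_def)
    qed
    show "r0 > 0" by (rule r0)
    fix r s :: real assume r: "0 < r" "r \<le> r0" and s: "s \<in> {1,-1}"
    note sub = cube_mono[OF r(2), of q]
    define H1 where "H1 = {p :: real \<times> real \<times> real. e * fst p + 0 * fst (snd p) + 0 * snd (snd p) < 0}"
    define H2 where "H2 = {p :: real \<times> real \<times> real. 0 * fst p + 0 * fst (snd p) + (-s) * snd (snd p) < 0}"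
    define H3 where "H3 = {p :: real \<times> real \<times> real. (-e) * fst p + 0 * fst (snd p) + 0 * snd (snd p) < 0}"
    have cvx: "convex H1" "convex H2" "convex H3" unfolding H1_def H2_def H3_def by (rule convex_less)+
    define p1 where "p1 = (v0 - e*(r/2), b0, s*(r/2))"
    define p2 where "p2 = (v0 + e*(r/2), b0, s*(r/2))"
    have p12: "p1 \<in> cube q r" "p2 \<in> cube q r"
      using e s r by (auto simp: p1_def p2_def q_def cube_iff)
    have "connected {p \<in> cube q r. chi p \<in> side e s} \<and> (\<exists>p\<in>cube q r. chi p \<in> side e s)"
    \<comment> \<open>This is the three-quarter side, a union of two overlapping convex half-cubes;
      in all other cases the side is convex.\<close>
    proof (cases "v0 = 0 \<and> s*b0 > 0")
      case True
      have eq: "{p \<in> cube q r. chi p \<in> side e s} = (cube q r \<inter> H1) \<union> (cube q r \<inter> H2)"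
      proof (rule Set.set_eqI)
        fix p show "p \<in> {p \<in> cube q r. chi p \<in> side e s} \<longleftrightarrow> p \<in> (cube q r \<inter> H1) \<union> (cube q r \<inter> H2)"
        proof (cases "p \<in> cube q r")
          case pc: True
          obtain v b c where p: "p = (v,b,c)" by (cases p)
          have "(v,b,c) \<in> cube q r0" using sub pc p by auto
          from chi_side[OF box[OF this], of e s] have *: "chi p \<in> side e s \<longleftrightarrow>
             0 < s*b \<and> e* v < 0 \<or> 0 < s*c \<and> 0 < e* v \<or> 0 < s*b \<and> 0 < s*c" by (simp add: p)
          have "\<bar>b - b0\<bar> < \<bar>b0\<bar>" using \<open>(v,b,c) \<in> cube q r0\<close> True by (auto simp: q_def cube_iff r0_def)
          then have "0 < s*b" using True s by auto
          then show ?thesis using pc * by (auto simp: p H1_def H2_def)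
        qed auto
      qed
      have "p1 \<in> cube q r \<inter> H1 \<inter> (cube q r \<inter> H2)"
        using p12 True e s r by (auto simp: H1_def H2_def p1_def)
      then have "connected ((cube q r \<inter> H1) \<union> (cube q r \<inter> H2))"
        by (intro connected_Un convex_connected convex_Int cube_convex cvx) auto
      moreover have "p1 \<in> (cube q r \<inter> H1) \<union> (cube q r \<inter> H2)"
        using \<open>p1 \<in> cube q r \<inter> H1 \<inter> (cube q r \<inter> H2)\<close> by simp
      ultimately show ?thesis unfolding eq[symmetric] by blast
    next
      case False
      have ev: "0 < s*b \<Longrightarrow> e* v > 0" if "(v,b,c) \<in> cube q r0" for v b c
      proof (cases "v0 = 0")
        case True
        then have "\<bar>b - b0\<bar> < \<bar>b0\<bar>" using that by (auto simp: q_def cube_iff r0_def)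
        then show "0 < s*b \<Longrightarrow> e* v > 0" using False True s ne by auto
      next
        case False
        then have "\<bar>v - v0\<bar> < \<bar>v0\<bar>" using that by (auto simp: q_def cube_iff r0_def)
        then show "e* v > 0" using v0 e by auto
      qed
      have eq: "{p \<in> cube q r. chi p \<in> side e s} = cube q r \<inter> (H2 \<inter> H3)"
      proof (rule Set.set_eqI)
        fix p show "p \<in> {p \<in> cube q r. chi p \<in> side e s} \<longleftrightarrow> p \<in> cube q r \<inter> (H2 \<inter> H3)"
        proof (cases "p \<in> cube q r")
          case pc: True
          obtain v b c where p: "p = (v,b,c)" by (cases p)
          have "(v,b,c) \<in> cube q r0" using sub pc p by auto
          from chi_side[OF box[OF this], of e s] ev[OF this] have *: "chi p \<in> side e s \<longleftrightarrow> 0 < s*c \<and> 0 < e* v"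
            by (auto simp: p)
          then show ?thesis using pc by (auto simp: p H2_def H3_def)
        qed auto
      qed
      have "p2 \<in> cube q r \<inter> (H2 \<inter> H3)"
        using p12 v0 e s r by (auto simp: H2_def H3_def p2_def)
      moreover have "connected (cube q r \<inter> (H2 \<inter> H3))"
        by (intro convex_connected convex_Int cube_convex cvx)
      ultimately show ?thesis unfolding eq[symmetric] by blast
    qed
    then show "connected {p \<in> cube q r. chi p \<in> side e s}" "\<exists>p\<in>cube q r. chi p \<in> side e s" by blast+
  next
    fix p assume p: "p \<in> cube q r0"
    obtain v b c where p': "p = (v,b,c)" by (cases p)
    note bx = box[OF p[unfolded p']]
    have ne': "e* v > 0 \<or> v0 = 0 \<and> b \<noteq> 0"
    proof (cases "v0 = 0")
      case True
      then have "\<bar>b - b0\<bar> < \<bar>b0\<bar>" using p p' by (auto simp: q_def cube_iff r0_def)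
      then show ?thesis using True by auto
    next
      case False
      then have "\<bar>v - v0\<bar> < \<bar>v0\<bar>" using p p' by (auto simp: q_def cube_iff r0_def)
      then show ?thesis using v0 e by auto
    qed
    have ev: "v = 0 \<longleftrightarrow> e * v = 0" using e by auto
    have ne'': "0 < e * v \<or> b \<noteq> 0" using ne' by auto
    show "chi p \<in> side e 1 \<or> chi p \<in> side e (-1) \<or> chi p \<in> cplane e"
      unfolding p' chi_side[OF bx] chi_cplane[OF bx] ev using wing_signs[OF ne'', of c] by simp
    show "chi p \<notin> cplane e" if "s \<in> {1,-1}" "chi p \<in> side e s" for s
      using that wing_signs'[OF ne'', of s c] unfolding p' chi_side[OF bx] chi_cplane[OF bx] ev by blast
  qed (use \<psi>E in auto)
qed

section \<open>The track of a crooked plane\<close>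

text \<open>One stem of \<open>cplane e\<close> together with an adjacent closed wing, without the vertex. Up to sign and
  conjugation by \<open>J\<close> it exhausts \<open>cplane e\<close> except for the vertices.\<close>

definition track :: "real \<Rightarrow> mat2 set" where
  "track e = stem_pt ` ({-1<..1} \<times> {0<..}) \<union> (\<lambda>(v,b). chi (v,b,0)) ` {(v,b). 0 \<le> e * v \<and> (v \<noteq> 0 \<or> b \<noteq> 0)}"

lemma wing_pt:
  assumes "a*d = 1" "a > 0" shows "(a,b,0,d) = chi (a-d,b,0)"
proof -
  have "d > 0" using assms by (metis zero_less_mult_pos zero_less_one)
  have "4 + (a-d)*(a-d) = (a+d)^2" using assms by (simp add: power2_eq_square algebra_simps)
  then have "sqrt (4 + (a-d)*(a-d)) = a+d" using assms \<open>d > 0\<close> by simp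
  then show ?thesis by (simp add: chi_def)
qed

lemma chi_parabolic: "chi (0,b,0) = (1,b,0,1)"
  using wing_pt[of 1 1 b] by simp

lemma stem_pt_1: "stem_pt (1,b) = chi (0,b,0)"
  by (simp add: stem_pt_def chi_parabolic)

lemma trackI_wing:
  assumes "a*d = 1" "a > 0" "0 \<le> e*(a-d)" "a \<noteq> d \<or> b \<noteq> 0"
  shows "(a,b,0,d) \<in> track e"
  unfolding track_def wing_pt[OF assms(1,2)] using assms(3,4) by (intro UnI2 image_eqI[of _ _ "(a-d,b)"]) auto

lemma trackI_stem:
  assumes "a*a - b*c = 1" "-1 < a" "a \<le> 1" "b > 0"
  shows "(a,b,c,a) \<in> track e"
proof -
  have "(a,b,c,a) = stem_pt (a,b)" using assms by (simp add: stem_pt_def field_simps)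
  then show ?thesis unfolding track_def using assms by auto
qed

lemma track_two_sided:
  assumes e: "e = 1 \<or> e = -1" and z: "z \<in> track e" shows "two_sided e z"
proof -
  consider a b where "z = stem_pt (a,b)" "-1 < a" "a \<le> 1" "b > 0"
    | v b where "z = chi (v,b,0)" "0 \<le> e * v" "v \<noteq> 0 \<or> b \<noteq> 0"
    using z by (auto simp: track_def)
  then show ?thesis
  proof cases
    case 1
    show ?thesis
    proof (cases "a = 1")
      case True
      then show ?thesis using 1 two_sided_wing[OF e, of 0 b] by (simp add: stem_pt_1)
    next
      case False
      then show ?thesis using 1 two_sided_stem[OF e, of a b] by simp
    qed
  next
    case 2 then show ?thesis using two_sided_wing[OF e] by blast
  qed
qed

lemma track_cplane:
  assumes "e = 1 \<or> e = -1" shows "track e \<subseteq> cplane e"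
proof -
  have "stem_pt (a,b) \<in> cplane e" if "-1 < a" "a \<le> 1" "b > 0" for a b
  proof -
    have "\<bar>a\<bar> \<le> 1" using that by auto
    then have "a*a \<le> 1" using abs_le_square_iff[of a 1] by (simp add: power2_eq_square)
    then show ?thesis using that by (simp add: stem_pt_def cplane_iff)
  qed
  moreover have "chi (v,b,0) \<in> cplane e" if "0 \<le> e * v" for v b
    using chi_cplane[of b 0 v e] that by (simp add: add_pos_nonneg)
  ultimately show ?thesis by (auto simp: track_def)
qed

text \<open>The wing is a closed half-plane punctured at a boundary point, covered by three
  consecutively overlapping convex pieces: b > 0, the open half-plane, and b < 0. The stem is
  attached along its edge a = 1.\<close>

lemma track_connected:
  assumes e: "e = 1 \<or> e = -1" shows "connected (track e)"
proof -
  have "connected ({-1<..1::real} \<times> {0::real<..})"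
    by (intro convex_connected convex_Times) auto
  moreover have "continuous_on ({-1<..1::real} \<times> {0::real<..}) stem_pt"
    unfolding stem_pt_def split_beta by (intro continuous_intros) auto
  ultimately have 1: "connected (stem_pt ` ({-1<..1} \<times> {0<..}))"
    by (rule connected_continuous_image[rotated])
  define P1 where "P1 = {p :: real \<times> real. inner (-e,0) p \<le> 0} \<inter> {p. inner (0,-1) p < 0}"
  define P2 where "P2 = {p :: real \<times> real. inner (-e,0) p < 0}"
  define P3 where "P3 = {p :: real \<times> real. inner (-e,0) p \<le> 0} \<inter> {p. inner (0,1) p < 0}"
  have c: "connected P1" "connected P2" "connected P3"
    unfolding P1_def P2_def P3_def
    by (intro convex_connected convex_Int convex_halfspace_lt convex_halfspace_le)+
  have "(e,1) \<in> P1 \<inter> P2" "(e,-1) \<in> P2 \<inter> P3" using e by (auto simp: P1_def P2_def P3_def)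
  then have "connected (P1 \<union> P2 \<union> P3)" by (intro connected_Un c) auto
  also have "P1 \<union> P2 \<union> P3 = {(v,b). 0 \<le> e * v \<and> (v \<noteq> 0 \<or> b \<noteq> 0)}"
    using e by (auto simp: P1_def P2_def P3_def)
  finally have "connected {(v,b). 0 \<le> e * v \<and> (v \<noteq> 0 \<or> (b::real) \<noteq> 0)}" .
  moreover have "continuous_on {(v,b). 0 \<le> e * v \<and> (v \<noteq> 0 \<or> b \<noteq> 0)} (\<lambda>(v,b). chi (v,b,0))"
    unfolding chi_def split_beta by (intro continuous_intros) auto
  ultimately have 2: "connected ((\<lambda>(v,b). chi (v,b,0)) ` {(v,b). 0 \<le> e * v \<and> (v \<noteq> 0 \<or> b \<noteq> 0)})"
    by (rule connected_continuous_image[rotated])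
  have "stem_pt (1,1) \<in> stem_pt ` ({-1<..1} \<times> {0<..})" by (rule imageI) simp
  moreover have "(\<lambda>(v,b). chi (v,b,0)) (0,1) \<in> (\<lambda>(v,b). chi (v,b,0)) ` {(v,b). 0 \<le> e * v \<and> (v \<noteq> 0 \<or> b \<noteq> 0)}"
    by (rule imageI) simp
  ultimately have "chi (0,1,0) \<in> stem_pt ` ({-1<..1} \<times> {0<..}) \<inter>
      (\<lambda>(v,b). chi (v,b,0)) ` {(v,b). 0 \<le> e * v \<and> (v \<noteq> 0 \<or> b \<noteq> 0)}"
    by (simp only: stem_pt_1 prod.case Int_iff simp_thms)
  then show ?thesis unfolding track_def by (intro connected_Un 1 2) (metis empty_iff)
qed

text \<open>The half turn about i, in the middle of the stem. \<open>jconj\<close> is conjugation by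
  it: it exchanges the two wings and fixes J, which therefore serves as a reference point for a tile
  and for its image under \<open>jconj\<close>.\<close>

definition J :: mat2 where "J = (0,1,-1,0)"

definition jconj :: "mat2 \<Rightarrow> mat2" where "jconj = (\<lambda>(a,b,c,d). (d,-c,-b,a))"

lemma jconj_simp [simp]: "jconj (a,b,c,d) = (d,-c,-b,a)"
  by (simp add: jconj_def)

lemma jconj_jconj [simp]: "jconj (jconj x) = x"
  by (cases x) simp

lemma jconj_mmul: "jconj (x \<cdot>\<^sub>m y) = jconj x \<cdot>\<^sub>m jconj y"
  by (cases x; cases y) (simp add: algebra_simps)

lemma jconj_mneg: "jconj (mneg x) = mneg (jconj x)"
  by (cases x) simp

lemma jconj_cplane: "jconj x \<in> cplane e \<longleftrightarrow> x \<in> cplane e"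
proof -
  have "jconj x \<in> cplane e" if "x \<in> cplane e" for x
  proof (cases x)
    case (fields a b c d)
    have "e*(\<bar>d\<bar>-\<bar>a\<bar>) = - (e*(\<bar>a\<bar>-\<bar>d\<bar>))" by (simp add: algebra_simps)
    then show ?thesis using that by (auto simp: fields cplane_iff mult.commute)
  qed
  from this[of x] this[of "jconj x"] show ?thesis by auto
qed

lemma jconj_SL2: "jconj x \<in> SL2 \<longleftrightarrow> x \<in> SL2"
  by (cases x) (auto simp: SL2_iff mult.commute)

lemma continuous_jconj: "continuous_on A jconj"
  unfolding jconj_def split_beta by (intro continuous_intros)

lemma continuous_mneg: "continuous_on A mneg"
  unfolding mneg_def split_beta by (intro continuous_intros)

lemma J_track: "J \<in> track e"
  unfolding J_def using trackI_stem[of 0 1 "-1" e] by simp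

lemma cplane_cases:
  assumes e: "e = 1 \<or> e = -1" and z: "z \<in> cplane e" "z \<noteq> (1,0,0,1)" "z \<noteq> (-1,0,0,-1)"
  shows "z \<in> track e \<or> mneg z \<in> track e \<or> jconj z \<in> track e \<or> mneg (jconj z) \<in> track e"
proof -
  obtain a b c d where zz: "z = (a,b,c,d)" by (cases z)
  have wing: "(a,b,0,d) \<in> track e \<or> mneg (a,b,0,d) \<in> track e"
    if "a*d = 1" "0 \<le> e*(\<bar>a\<bar>-\<bar>d\<bar>)" "(a,b,0,d) \<noteq> (1,0,0,1)" "(a,b,0,d) \<noteq> (-1,0,0,-1)" for a b d :: real
  proof -
    have ne: "a \<noteq> d \<or> b \<noteq> 0" using that by (auto simp: square_eq_1_iff)
    show ?thesis
    proof (cases "a > 0")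
      case True
      then have "d > 0" using that(1) by (metis zero_less_mult_pos zero_less_one)
      then show ?thesis using trackI_wing[of a d e b] that ne True by auto
    next
      case False
      then have "a < 0" using that(1) by (cases "a = 0") auto
      moreover from this have "d < 0" using that(1) by (metis zero_less_mult_iff zero_less_one less_asym)
      ultimately show ?thesis using trackI_wing[of "-a" "-d" e "-b"] that ne by auto
    qed
  qed
  have det: "a*d - b*c = 1" using z by (simp add: zz cplane_iff)
  consider "c = 0" "0 \<le> e*(\<bar>a\<bar>-\<bar>d\<bar>)" | "b = 0" "e*(\<bar>a\<bar>-\<bar>d\<bar>) \<le> 0" | "a = d" "b*c < 0"
    using z det by (cases "b*c = 0") (auto simp: zz cplane_iff less_le)
  then show ?thesis
  proof cases
    case 1
    then show ?thesis using wing[of a d b] det z by (auto simp: zz)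
  next
    case 2
    have "e*(\<bar>d\<bar>-\<bar>a\<bar>) = - (e*(\<bar>a\<bar>-\<bar>d\<bar>))" by (simp add: algebra_simps)
    then show ?thesis using wing[of d a "-c"] det z 2 by (auto simp: zz mult.commute)
  next
    case 3
    have "a^2 < 1^2" using det 3 by (simp add: power2_eq_square)
    then have "\<bar>a\<bar> < 1" by (simp add: abs_square_less_1)
    then have "-1 < a" "a < 1" by linarith+
    then show ?thesis
      using trackI_stem[of a b c e] trackI_stem[of "-a" "-b" "-c" e] det 3
      by (auto simp: zz mult_less_0_iff)
  qed
qed

text \<open>For U inside \<open>SL2\<close> this says that U - X is a union of connected components
  of \<open>SL2\<close> - X.\<close>

definition connsat :: "mat2 set \<Rightarrow> mat2 set \<Rightarrow> bool" where
  "connsat X U \<longleftrightarrow> (\<forall>T. connected T \<and> T \<subseteq> SL2 \<and> T \<inter> X = {} \<and> T \<inter> U \<noteq> {} \<longrightarrow> T \<subseteq> U)"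

lemma image_eq_vimage_inverse:
  assumes "\<And>x. f (f' x) = x" "\<And>x. f' (f x) = x" shows "f ` A = f' -` A"
  using assms by (metis bijI' bij_vimage_eq_inv_image inv_equality)

lemma image_Int_empty_iff: "f ` T \<inter> X = {} \<longleftrightarrow> T \<inter> f -` X = {}"
  by auto

lemma connsat_image:
  assumes "connsat X U" "continuous_on UNIV f'" "\<And>x. f (f' x) = x" "\<And>x. f' (f x) = x"
    "\<And>x. x \<in> SL2 \<Longrightarrow> f' x \<in> SL2"
  shows "connsat (f ` X) (f ` U)"
  unfolding connsat_def image_eq_vimage_inverse[OF assms(3,4)]
proof (intro allI impI)
  fix T assume T: "connected T \<and> T \<subseteq> SL2 \<and> T \<inter> f' -` X = {} \<and> T \<inter> f' -` U \<noteq> {}"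
  have "connected (f' ` T)" using T assms(2) by (intro connected_continuous_image) (auto intro: continuous_on_subset)
  moreover have "f' ` T \<subseteq> SL2" using T assms(5) by blast
  moreover have "f' ` T \<inter> X = {}" "f' ` T \<inter> U \<noteq> {}" using T by (simp_all add: image_Int_empty_iff)
  ultimately have "f' ` T \<subseteq> U" using assms(1) unfolding connsat_def by blast
  then show "T \<subseteq> f' -` U" by (simp add: image_subset_iff_subset_vimage)
qed

text \<open>What is kept of a fundamental domain: U is its interior in coordinates adapted to one
  boundary plane, and D the union of the other boundary planes. Symmetry under \<open>mneg\<close>
  reflects that U is the lift of a subset of PSL2.\<close>

definition tile :: "real \<Rightarrow> mat2 set \<Rightarrow> mat2 set \<Rightarrow> bool" where
  "tile e D U \<longleftrightarrow> closed D \<and> D \<inter> cplane e = {} \<and> U \<subseteq> SL2 \<and> U \<inter> cplane e = {} \<and>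
     connsat (cplane e \<union> D) U \<and> (\<forall>x\<in>U. mneg x \<in> U)"

lemma tile_follow:
  assumes e: "e = 1 \<or> e = -1" and t: "tile e D U" and z: "z \<in> track e" "z \<in> closure U"
  obtains s where "s \<in> {1,-1}" "\<And>z. z \<in> track e \<Longrightarrow> \<exists>B. open B \<and> z \<in> B \<and> B \<inter> side e s \<subseteq> U"
proof (rule follow_plane[of "track e" e D U z])
  show "connected (track e)" "track e \<subseteq> cplane e" "\<And>z. z \<in> track e \<Longrightarrow> two_sided e z"
    using e track_connected track_cplane track_two_sided by auto
  show "closed D" "D \<inter> cplane e = {}" "U \<subseteq> SL2" "U \<inter> cplane e = {}" using t by (auto simp: tile_def)
  show "T \<subseteq> U" if "connected T" "T \<subseteq> SL2" "T \<inter> (cplane e \<union> D) = {}" "T \<inter> U \<noteq> {}" for T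
    using t that by (simp add: tile_def connsat_def)
qed (use z that in auto)

lemma closure_image_mem:
  fixes f :: "mat2 \<Rightarrow> mat2"
  assumes "continuous_on UNIV f" "x \<in> closure A" shows "f x \<in> closure (f ` A)"
proof -
  have "f ` closure A \<subseteq> closure (f ` A)"
    by (rule image_closure_subset[OF continuous_on_subset[OF assms(1)] closed_closure closure_subset]) simp
  then show ?thesis using assms(2) by (rule subsetD[OF _ imageI])
qed

lemma tile_jconj:
  assumes "tile e D U" shows "tile e (jconj ` D) (jconj ` U)"
proof -
  have im: "jconj ` A = jconj -` A" for A by (rule image_eq_vimage_inverse) simp_all
  have cont: "continuous_on UNIV jconj" by (rule continuous_jconj)
  have "closed (jconj -` D)" using assms cont
    by (auto simp: tile_def intro: closed_vimage)
  moreover have "jconj -` D \<inter> cplane e = {}" "jconj -` U \<inter> cplane e = {}" "jconj -` U \<subseteq> SL2"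
    using assms jconj_cplane jconj_SL2 unfolding tile_def by blast+
  moreover have "jconj -` cplane e = cplane e" using jconj_cplane by blast
  then have "jconj ` (cplane e \<union> D) = cplane e \<union> jconj -` D" unfolding image_Un im by simp
  moreover have "connsat (jconj ` (cplane e \<union> D)) (jconj ` U)"
  proof (rule connsat_image[OF _ cont])
    show "connsat (cplane e \<union> D) U" using assms by (simp add: tile_def)
    show "jconj x \<in> SL2" if "x \<in> SL2" for x using that by (simp only: jconj_SL2)
  qed (rule jconj_jconj)+
  moreover have "\<forall>x\<in>jconj -` U. mneg x \<in> jconj -` U"
    using assms by (simp only: tile_def jconj_mneg vimage_eq Ball_def) blast
  ultimately show ?thesis by (simp only: tile_def im simp_thms)
qed

text \<open>By \<open>cplane_cases\<close> one of +-z and +-\<open>jconj z\<close> is on the track.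
  U is symmetric under sign and its image under \<open>jconj\<close> is again a tile, so adherence
  can be followed along the track to J, which \<open>jconj\<close> fixes.\<close>

lemma tile_J:
  assumes e: "e = 1 \<or> e = -1" and t: "tile e D U"
    and z: "z \<in> cplane e" "z \<noteq> (1,0,0,1)" "z \<noteq> (-1,0,0,-1)" "z \<in> closure U"
  shows "J \<in> closure U"
proof -
  have A: "J \<in> closure U" if t: "tile e D U" and z: "z \<in> track e" "z \<in> closure U" for D U z
  proof -
    obtain s B where s: "s \<in> {1,-1}" and B: "open B" "J \<in> B" "B \<inter> side e s \<subseteq> U"
      using tile_follow[OF e t z] J_track by metis
    show ?thesis
      unfolding closure_iff_nhds_not_empty
    proof (intro allI impI)
      fix W V assume V: "V \<subseteq> W" "open V" "J \<in> V"
      have "two_sided e J" by (rule track_two_sided[OF e J_track])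
      moreover have "open (V \<inter> B)" "J \<in> V \<inter> B" using V B by auto
      ultimately obtain B' where "B' \<inter> SL2 \<subseteq> V \<inter> B" "B' \<inter> side e s \<noteq> {}"
        using s by (metis two_sidedE)
      then show "U \<inter> W \<noteq> {}" using B(3) V(1) side_SL2[of e s] by blast
    qed
  qed
  have neg: "mneg z \<in> closure U" if t: "tile e D U" and z: "z \<in> closure U" for D U z
  proof -
    have "mneg ` U \<subseteq> U" using t by (auto simp: tile_def)
    then show ?thesis using closure_image_mem[OF continuous_mneg z] closure_mono by blast
  qed
  have jt: "tile e (jconj ` D) (jconj ` U)" by (rule tile_jconj[OF t])
  have jz: "jconj z \<in> closure (jconj ` U)" by (rule closure_image_mem[OF continuous_jconj z(4)])
  have "J \<in> closure U" if "J \<in> closure (jconj ` U)"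
  proof -
    have "jconj J \<in> closure (jconj ` jconj ` U)" by (rule closure_image_mem[OF continuous_jconj that])
    moreover have "jconj ` jconj ` U = U" by (simp add: image_image)
    moreover have "jconj J = J" by (simp add: J_def)
    ultimately show ?thesis by simp
  qed
  then show ?thesis
    using cplane_cases[OF e z(1-3)] A[OF t _ z(4)] A[OF t _ neg[OF t z(4)]] A[OF jt _ jz]
      A[OF jt _ neg[OF jt jz]] by blast
qed

section \<open>Crossings with translates\<close>

text \<open>U fills one and the same side s near z and near its translate, both being on the track.
  A path that approaches z on side s while its translate approaches on side s as well puts a point
  and its translate into U. As s is not known, a path is required for either value.\<close>

lemma crossing_contradiction:
  fixes X :: "real \<Rightarrow> real \<Rightarrow> mat2"
  assumes e: "e = 1 \<or> e = -1" and t: "tile e D U" and J: "J \<in> closure U"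
    and h: "\<And>x. x \<in> U \<Longrightarrow> x \<cdot>\<^sub>m h \<notin> U"
    and z: "z \<in> track e" "z \<cdot>\<^sub>m h \<in> track e"
    and X: "\<And>s. s \<in> {1,-1} \<Longrightarrow> (X s \<longlongrightarrow> z) (at_right 0)"
      "\<And>s. s \<in> {1,-1} \<Longrightarrow> eventually (\<lambda>r. X s r \<in> side e s) (at_right 0)"
      "\<And>s. s \<in> {1,-1} \<Longrightarrow> eventually (\<lambda>r. X s r \<cdot>\<^sub>m h \<in> side e s) (at_right 0)"
  shows False
proof -
  obtain s where s: "s \<in> {1,-1}" and B: "\<And>z. z \<in> track e \<Longrightarrow> \<exists>B. open B \<and> z \<in> B \<and> B \<inter> side e s \<subseteq> U"
    using tile_follow[OF e t J_track J] by metis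
  obtain B1 where B1: "open B1" "z \<in> B1" "B1 \<inter> side e s \<subseteq> U" using B[OF z(1)] by blast
  obtain B2 where B2: "open B2" "z \<cdot>\<^sub>m h \<in> B2" "B2 \<inter> side e s \<subseteq> U" using B[OF z(2)] by blast
  have cont: "continuous_on UNIV (\<lambda>x. x \<cdot>\<^sub>m h)"
    unfolding mmul_def split_beta by (intro continuous_intros)
  have "((\<lambda>r. X s r \<cdot>\<^sub>m h) \<longlongrightarrow> z \<cdot>\<^sub>m h) (at_right 0)"
    using continuous_on_tendsto_compose[OF cont X(1)[OF s]] by simp
  then have "eventually (\<lambda>r. X s r \<cdot>\<^sub>m h \<in> B2) (at_right 0)" using B2 by (simp add: tendsto_def)
  moreover have "eventually (\<lambda>r. X s r \<in> B1) (at_right 0)" using X(1)[OF s] B1 by (simp add: tendsto_def)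
  ultimately have "eventually (\<lambda>r::real. False) (at_right 0)"
    using X(2)[OF s] X(3)[OF s]
  proof eventually_elim
    case (elim r)
    then have "X s r \<in> U" "X s r \<cdot>\<^sub>m h \<in> U" using B1(3) B2(3) by blast+
    then show False using h by blast
  qed
  then show False by simp
qed

text \<open>A stem point (a,b,c,a) is mapped into {c = 0} when c = -a*\<gamma>/\<alpha>; the
  determinant then fixes b, and the image has diagonal (\<alpha>/a, a/\<alpha>). Only |a| remains to
  be chosen.\<close>

lemma stem_wing_crossing:
  assumes e: "e = 1 \<or> e = -1" and t: "tile e D U" and J: "J \<in> closure U"
    and h: "\<And>x. x \<in> U \<Longrightarrow> x \<cdot>\<^sub>m (\<alpha>,\<beta>,\<gamma>,\<delta>) \<notin> U"
    and det: "\<alpha>*\<delta> - \<beta>*\<gamma> = 1" and \<alpha>: "\<alpha> \<noteq> 0" "e = -1 \<Longrightarrow> \<bar>\<alpha>\<bar> < 1" and \<gamma>: "\<gamma> > 0"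
  shows False
proof -
  \<comment> \<open>The value of |a|: below 1 to be on the stem, and on the side of |\<alpha>| that
    makes e*(\<alpha>/a - a/\<alpha>) positive. For e = -1 there is room only if |\<alpha>| <
    1.\<close>
  obtain m where m: "0 < m" "m < 1" "e = 1 \<Longrightarrow> m < \<bar>\<alpha>\<bar>" "e = -1 \<Longrightarrow> \<bar>\<alpha>\<bar> < m"
  proof (cases "e = 1")
    case True
    show thesis by (rule that[of "min 1 \<bar>\<alpha>\<bar> / 2"]) (use True \<alpha>(1) in auto)
  next
    case False
    then show thesis using e \<alpha> by (intro that[of "(1+\<bar>\<alpha>\<bar>)/2"]) auto
  qed
  \<comment> \<open>Giving a the sign of \<alpha> makes c negative and hence b positive, and makes
    the image's diagonal positive.\<close>
  define a where "a = sgn \<alpha> * m"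
  define c where "c = - a*\<gamma>/\<alpha>"
  define b where "b = (a*a-1)/c"
  have a: "a \<noteq> 0" "\<bar>a\<bar> = m" "a*\<alpha> > 0" using m \<alpha>(1) mult_pos_pos[of m \<alpha>] mult_pos_neg[of m \<alpha>] by (auto simp: a_def abs_mult sgn_if)
  have aa: "a/\<alpha> > 0" "\<alpha>/a > 0" using a(3) by (auto simp: zero_less_mult_iff zero_less_divide_iff)
  have c: "c < 0"
  proof -
    have "a*\<gamma>/\<alpha> = a/\<alpha>*\<gamma>" by simp
    then show ?thesis using mult_pos_pos[OF aa(1) \<gamma>] by (simp add: c_def)
  qed
  have a1: "a*a < 1" using a(2) m abs_square_less_1[of a] by (simp add: power2_eq_square)
  have b: "b > 0" unfolding b_def using a1 c by (intro divide_neg_neg) auto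
  have bc: "b*c = a*a - 1" using c by (simp add: b_def)
  define v where "v = \<alpha>/a - a/\<alpha>"
  have v: "e * v > 0"
  proof -
    have q: "\<alpha>/a * (a/\<alpha>) = 1" using a \<alpha> by simp
    have "\<alpha>/a = \<bar>\<alpha>\<bar>/m" using aa(2) a(2) by (metis abs_divide abs_of_pos)
    then have "e = 1 \<Longrightarrow> \<alpha>/a > 1" "e = -1 \<Longrightarrow> \<alpha>/a < 1" using m by auto
    then have "e = 1 \<Longrightarrow> \<alpha>/a > a/\<alpha>" "e = -1 \<Longrightarrow> \<alpha>/a < a/\<alpha>"
      using q aa by (smt (verit) mult_less_cancel_left2 mult_less_cancel_left1)+
    then show ?thesis using e by (auto simp: v_def)
  qed
  define z where "z = (a,b,c,a)"
  have z1: "c*\<alpha> + a*\<gamma> = 0" using \<alpha>(1) by (simp add: c_def)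
  have z2: "a*\<alpha> + b*\<gamma> = \<alpha>/a"
  proof -
    have "b*\<gamma> = - b*c*\<alpha>/a" using a \<alpha> by (simp add: c_def)
    also have "\<dots> = (1 - a*a)*\<alpha>/a" using bc by simp
    finally show ?thesis using a by (simp add: field_simps)
  qed
  have z3: "c*\<beta> + a*\<delta> = a/\<alpha>"
  proof -
    have "c*\<beta> + a*\<delta> = a*(\<alpha>*\<delta>-\<beta>*\<gamma>)/\<alpha>" using \<alpha>(1) by (simp add: c_def field_simps)
    then show ?thesis by (simp only: det mult_1_right)
  qed
  have zh: "z \<cdot>\<^sub>m (\<alpha>,\<beta>,\<gamma>,\<delta>) = (\<alpha>/a, a*\<beta>+b*\<delta>, 0, a/\<alpha>)"
    by (simp add: z_def z1 z2 z3)
  \<comment> \<open>The two crossings are controlled independently. Changing only the top left entry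
    makes a - d equal to -s*e*r, side s of the stem. Changing c by s*\<open>sgn\<close> \<alpha>*r
    gives the product the lower left entry s*|\<alpha>|*r, side s of the wing. The entry b restores
    the determinant.\<close>
  define X where "X s r = (a - s * e*r, ((a - s * e*r)*a - 1)/(c + s * sgn \<alpha>*r), c + s * sgn \<alpha>*r, a)" for s r
  have lim: "(X s \<longlongrightarrow> z) (at_right 0)" for s
  proof -
    have "(X s \<longlongrightarrow> (a - s * e*0, ((a - s * e*0)*a - 1)/(c + s * sgn \<alpha>*0), c + s * sgn \<alpha>*0, a)) (at_right 0)"
      unfolding X_def using c by (intro tendsto_intros) auto
    then show ?thesis by (simp add: z_def b_def)
  qed
  have cont: "continuous_on UNIV (\<lambda>x. x \<cdot>\<^sub>m (\<alpha>,\<beta>,\<gamma>,\<delta>))"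
    unfolding mmul_def split_beta by (intro continuous_intros)
  have limh: "((\<lambda>r. X s r \<cdot>\<^sub>m (\<alpha>,\<beta>,\<gamma>,\<delta>)) \<longlongrightarrow> z \<cdot>\<^sub>m (\<alpha>,\<beta>,\<gamma>,\<delta>)) (at_right 0)" for s
    using continuous_on_tendsto_compose[OF cont lim] by simp
  define O1 :: "mat2 set" where "O1 = {x. 0 < fst (snd x)} \<inter> {x. fst (snd (snd x)) < 0}"
  define O2 :: "mat2 set" where "O2 = {x. 0 < e * (fst x - snd (snd (snd x)))}"
  have "open O1" "open O2" unfolding O1_def O2_def
    by (intro open_Int open_Collect_less continuous_intros)+
  moreover have "z \<in> O1" "z \<cdot>\<^sub>m (\<alpha>,\<beta>,\<gamma>,\<delta>) \<in> O2"
    using b c v unfolding zh by (auto simp: O1_def O2_def z_def v_def)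
  ultimately have ev: "eventually (\<lambda>r. X s r \<in> O1) (at_right 0)"
      "eventually (\<lambda>r. X s r \<cdot>\<^sub>m (\<alpha>,\<beta>,\<gamma>,\<delta>) \<in> O2) (at_right 0)" for s
    using lim[of s] limh[of s] by (auto simp: tendsto_def)
  have pos: "eventually (\<lambda>r::real. r > 0) (at_right 0)" by (simp add: eventually_at_right_less)
  show False
  proof (rule crossing_contradiction[OF e t J h, of z X])
    show "z \<in> track e" unfolding z_def using bc a1 b m a(2) by (intro trackI_stem) auto
    show "z \<cdot>\<^sub>m (\<alpha>,\<beta>,\<gamma>,\<delta>) \<in> track e"
      unfolding zh using v a \<alpha> aa by (intro trackI_wing) (auto simp: v_def)
    fix s :: real assume s: "s \<in> {1,-1}"
    show "(X s \<longlongrightarrow> z) (at_right 0)" by (rule lim)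
    show "eventually (\<lambda>r. X s r \<in> side e s) (at_right 0)"
      using ev(1)[of s] pos
    proof eventually_elim
      case (elim r)
      define c' where "c' = c + s * sgn \<alpha>*r"
      define b' where "b' = ((a - s * e*r)*a - 1)/c'"
      have "c' < 0" "b' > 0" using elim by (auto simp: O1_def X_def c'_def b'_def)
      moreover from this have "b'*c' = (a - s * e*r)*a - 1" by (simp add: b'_def)
      ultimately show ?case
        using s e elim(2) by (auto simp: X_def side_iff simp flip: c'_def b'_def)
    qed
    show "eventually (\<lambda>r. X s r \<cdot>\<^sub>m (\<alpha>,\<beta>,\<gamma>,\<delta>) \<in> side e s) (at_right 0)"
      using ev[of s] pos
    proof eventually_elim
      case (elim r)
      define c' where "c' = c + s * sgn \<alpha>*r"
      define b' where "b' = ((a - s * e*r)*a - 1)/c'"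
      have "c' < 0" using elim by (auto simp: O1_def X_def c'_def)
      then have "b'*c' = (a - s * e*r)*a - 1" by (simp add: b'_def)
      then have "X s r \<in> SL2" by (simp add: X_def SL2_iff flip: c'_def b'_def)
      then have XS: "X s r \<cdot>\<^sub>m (\<alpha>,\<beta>,\<gamma>,\<delta>) \<in> SL2" using det by (intro SL2_mmul) (auto simp: SL2_iff)
      obtain p q u w where P: "X s r \<cdot>\<^sub>m (\<alpha>,\<beta>,\<gamma>,\<delta>) = (p,q,u,w)" by (metis prod_cases4)
      have pw: "0 < e * (p - w)" using elim(2) P by (simp add: O2_def)
      have "u = s * (sgn \<alpha>*\<alpha>)*r"
      proof -
        have "u = (c + s * sgn \<alpha>*r)*\<alpha> + a*\<gamma>" using P by (simp add: X_def)
        also have "\<dots> = (c*\<alpha> + a*\<gamma>) + s * (sgn \<alpha>*\<alpha>)*r" by (simp add: algebra_simps)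
        finally show ?thesis using z1 by simp
      qed
      moreover have "sgn \<alpha> * \<alpha> = \<bar>\<alpha>\<bar>" by (simp add: sgn_if)
      ultimately have "u = s * (\<bar>\<alpha>\<bar> * r)" by (simp only: mult.assoc)
      moreover have "\<bar>\<alpha>\<bar> * r > 0" using elim(3) \<alpha>(1) by simp
      ultimately have "0 < s * u" using s by auto
      then show ?case using XS pw unfolding P side_iff SL2_iff by simp
    qed
  qed auto
qed

text \<open>The translation preserves {c = 0} and moves the edge between stem and wing along itself,
  so a point and its image can both be taken on that edge. There the sides are a quarter and three
  quarters, and on each there are nearby points whose translates are on the same side.\<close>

lemma parabolic_crossing:
  assumes t: "tile (-1) D U" and J: "J \<in> closure U"
    and h: "\<And>x. x \<in> U \<Longrightarrow> x \<cdot>\<^sub>m (1,\<beta>,0,1) \<notin> U"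
  shows False
proof -
  \<comment> \<open>Both b + \<beta> and b - \<beta> are positive: the value of a - d for X and for
    its translate is -r*b and -r*(b + \<beta>) if s = 1, and -r*b and -r*(b - \<beta>) if s = -1. So
    e*(a - d) > 0 in all four cases, and s*c = r > 0.\<close>
  define b where "b = \<bar>\<beta>\<bar> + 1"
  define z :: mat2 where "z = (1,b,0,1)"
  define X :: "real \<Rightarrow> real \<Rightarrow> mat2" where
    "X s r = (if s = 1 then (1, b, r, 1 + b*r) else (1 - b*r, b, -r, 1))" for s r
  have b: "b > 0" "b + \<beta> > 0" "b > \<beta>" by (auto simp: b_def)
  have e: "(-1::real) = 1 \<or> (-1::real) = -1" by simp
  have pos: "eventually (\<lambda>r::real. r > 0) (at_right 0)" by (simp add: eventually_at_right_less)
  show False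
  proof (rule crossing_contradiction[OF e t J h, of z X])
    show "z \<in> track (-1)" unfolding z_def using b by (intro trackI_wing) auto
    have "z \<cdot>\<^sub>m (1,\<beta>,0,1) = (1,\<beta>+b,0,1)" by (simp add: z_def)
    then show "z \<cdot>\<^sub>m (1,\<beta>,0,1) \<in> track (-1)" using b by (simp only:) (intro trackI_wing; auto)
    fix s :: real assume s: "s \<in> {1,-1}"
    show "(X s \<longlongrightarrow> z) (at_right 0)"
    proof -
      have "((\<lambda>r. (1, b, r, 1 + b*r)) \<longlongrightarrow> (1,b,0,1+b*0)) (at_right 0)"
        "((\<lambda>r. (1 - b*r, b, -r, 1)) \<longlongrightarrow> (1-b*0,b,-0,1)) (at_right 0)"
        by (intro tendsto_intros)+
      moreover have "X 1 = (\<lambda>r. (1, b, r, 1 + b*r))" "X (-1) = (\<lambda>r. (1 - b*r, b, -r, 1))"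
        by (auto simp: X_def fun_eq_iff)
      ultimately show ?thesis using s by (auto simp: z_def)
    qed
    show "eventually (\<lambda>r. X s r \<in> side (-1) s) (at_right 0)"
      using pos by eventually_elim (use s b in \<open>auto simp: X_def side_iff algebra_simps\<close>)
    show "eventually (\<lambda>r. X s r \<cdot>\<^sub>m (1,\<beta>,0,1) \<in> side (-1) s) (at_right 0)"
      using pos
    proof eventually_elim
      case (elim r)
      have "r*\<beta> < r*b" using elim b by simp
      then show ?case using s b elim
        by (auto simp: X_def side_iff algebra_simps)
    qed
  qed
qed

section \<open>Small values of binary quadratic forms of discriminant 1\<close>

definition qform :: "real \<Rightarrow> real \<Rightarrow> real \<Rightarrow> int \<Rightarrow> int \<Rightarrow> real" where
  "qform A B C m n = A * (real_of_int m)^2 + B * real_of_int m * real_of_int n + C * (real_of_int n)^2"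

lemma qform_shift:
  "qform A (B + 2*A*k) (A*(real_of_int k)^2 + B*k + C) m n = qform A B C (m + k*n) n"
  by (simp add: qform_def power2_eq_square algebra_simps)

lemma qform_shift_disc:
  fixes A B C k :: real
  shows "(B + 2*A*k)^2 - 4*A*(A*k^2 + B*k + C) = B^2 - 4*A*C"
  by (simp add: power2_eq_square algebra_simps)

lemma qform_swap: "qform C B A m n = qform A B C n m"
  by (simp add: qform_def)

lemma qform_reduce_middle:
  fixes A B C :: real
  assumes "B^2 - 4*A*C = 1" "A \<noteq> 0"
  obtains k :: int and B' C' where "\<bar>B'\<bar> \<le> \<bar>A\<bar>" "B'^2 - 4*A*C' = 1"
    "\<And>m n. qform A B' C' m n = qform A B C (m + k*n) n"
proof -
  define k where "k = round (- B/(2*A))"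
  have "\<bar>real_of_int k - (- B/(2*A))\<bar> \<le> 1/2" unfolding k_def by (rule of_int_round_abs_le)
  then have "\<bar>2*A\<bar> * \<bar>real_of_int k - (- B/(2*A))\<bar> \<le> \<bar>2*A\<bar> * (1/2)"
    by (intro mult_left_mono) auto
  then have "\<bar>2*A*(real_of_int k - (- B/(2*A)))\<bar> \<le> \<bar>A\<bar>" by (simp only: abs_mult)
  moreover have "2*A*(real_of_int k - (- B/(2*A))) = B + 2*A*k" using assms(2) by (simp add: field_simps)
  ultimately have "\<bar>B + 2*A*k\<bar> \<le> \<bar>A\<bar>" by simp
  then show thesis
    using qform_shift_disc[of B A "real_of_int k" C] assms(1) qform_shift by (intro that[of "B + 2*A*k"]) auto
qed

text \<open>After reduction B'^2 < 1, so A*C' lies in [-1/4, 0) and one of the represented values A,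
  C' is below 1/2 in absolute value, except when both equal 1/2.\<close>

lemma qform_small_value_reduced:
  fixes A B C :: real
  assumes disc: "B^2 - 4*A*C = 1" and A1: "\<bar>A\<bar> < 1"
    and an: "\<And>m n. (m,n) \<noteq> (0,0) \<Longrightarrow> qform A B C m n \<noteq> 0"
  shows "\<exists>m n. 0 < \<bar>qform A B C m n\<bar> \<and> \<bar>qform A B C m n\<bar> < 1/2"
proof -
  have "A \<noteq> 0" using an[of 1 0] by (simp add: qform_def)
  with disc obtain k :: int and B' C' where B': "\<bar>B'\<bar> \<le> \<bar>A\<bar>" and disc': "B'^2 - 4*A*C' = 1"
    and sh: "\<And>m n. qform A B' C' m n = qform A B C (m + k*n) n" by (rule qform_reduce_middle) blast
  have "B'^2 < 1" using B' A1 by (simp add: abs_square_less_1)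
  then have AC: "A*C' < 0" "4*(A*C') \<ge> -1" using disc' zero_le_power2[of B'] by linarith+
  have A: "qform A B C 1 0 = A" and C: "qform A B C k 1 = C'"
    using sh[of 1 0] sh[of 0 1] by (simp_all add: qform_def)
  consider "\<bar>A\<bar> < 1/2" | "\<bar>C'\<bar> < 1/2" | "\<bar>A\<bar> \<ge> 1/2" "\<bar>C'\<bar> \<ge> 1/2" by linarith
  then show ?thesis
  proof cases
    case 1
    then show ?thesis using A \<open>A \<noteq> 0\<close> by (intro exI[of _ 1] exI[of _ 0]) simp
  next
    case 2
    then show ?thesis using C AC(1) by (intro exI[of _ k] exI[of _ 1]) auto
  next
    case 3
    have P: "\<bar>A\<bar>*\<bar>C'\<bar> \<le> 1/4" using AC by (simp flip: abs_mult)
    have "\<bar>A\<bar>*(1/2) \<le> \<bar>A\<bar>*\<bar>C'\<bar>" "(1/2)*\<bar>C'\<bar> \<le> \<bar>A\<bar>*\<bar>C'\<bar>"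
      using 3 by (intro mult_left_mono mult_right_mono; simp)+
    then have eq: "\<bar>A\<bar> = 1/2" "\<bar>C'\<bar> = 1/2" using P 3 by linarith+
    then have "\<bar>A*C'\<bar> = 1/4" unfolding abs_mult eq by simp
    then have "A*C' = -(1/4)" using AC(1) by linarith
    then have "B'^2 = 0" using disc' by linarith
    then have "B' = 0" by simp
    moreover have "A = 1/2 \<or> A = -1/2" "C' = 1/2 \<or> C' = -1/2" using eq by linarith+
    then have "A + C' = 0" using \<open>A*C' = -(1/4)\<close> by (elim disjE) simp_all
    \<comment> \<open>In the exceptional case the form is +-(m^2 - n^2)/2, which is
      isotropic.\<close>
    ultimately have "qform A B' C' 1 1 = 0" by (simp add: qform_def)
    then show ?thesis using an[of "1 + k" 1] sh[of 1 1] by simp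
  qed
qed

text \<open>Gauss reduction: while the leading coefficient is at least one in absolute value, it can be
  replaced by one at most a quarter as large.\<close>

lemma qform_small_value:
  fixes A B C :: real
  assumes "B^2 - 4*A*C = 1" and "\<bar>A\<bar> < 4^N"
    and "\<And>m n. (m,n) \<noteq> (0,0) \<Longrightarrow> qform A B C m n \<noteq> 0"
  shows "\<exists>m n. 0 < \<bar>qform A B C m n\<bar> \<and> \<bar>qform A B C m n\<bar> < 1/2"
  using assms
proof (induction N arbitrary: A B C)
  case 0
  then show ?case by (intro qform_small_value_reduced) auto
next
  case (Suc N)
  show ?case
  proof (cases "\<bar>A\<bar> < 1")
    case True
    then show ?thesis using Suc.prems by (intro qform_small_value_reduced) auto
  next
    case False
    then have "A \<noteq> 0" by auto
    with Suc.prems(1) obtain k :: int and B' C' where B': "\<bar>B'\<bar> \<le> \<bar>A\<bar>" and disc': "B'^2 - 4*A*C' = 1"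
      and sh: "\<And>m n. qform A B' C' m n = qform A B C (m + k*n) n" by (rule qform_reduce_middle) blast
    have "B'^2 \<le> A^2" using B' abs_le_square_iff by blast
    moreover have "1 \<le> A^2" using False abs_le_square_iff[of 1 A] by simp
    \<comment> \<open>4*A*C' is the difference of B'^2 and 1, two numbers in [0, A^2].\<close>
    ultimately have "\<bar>4*A*C'\<bar> \<le> A^2" using disc' zero_le_power2[of B'] by linarith
    then have "\<bar>A\<bar> * (4*\<bar>C'\<bar>) \<le> \<bar>A\<bar> * \<bar>A\<bar>" by (simp add: abs_mult power2_eq_square)
    then have "4*\<bar>C'\<bar> \<le> \<bar>A\<bar>" by (rule mult_left_le_imp_le) (use \<open>A \<noteq> 0\<close> in simp)
    then have "\<bar>C'\<bar> < 4^N" using Suc.prems(2) by simp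
    moreover have "B'^2 - 4*C'*A = 1" using disc' by (simp add: mult.commute mult.left_commute)
    moreover have "qform C' B' A m n \<noteq> 0" if "(m,n) \<noteq> (0,0)" for m n
      unfolding qform_swap[of C' B' A] sh using that by (intro Suc.prems(3)) auto
    ultimately have "\<exists>m n. 0 < \<bar>qform C' B' A m n\<bar> \<and> \<bar>qform C' B' A m n\<bar> < 1/2" by (intro Suc.IH)
    then show ?thesis unfolding qform_swap[of C' B' A] sh by blast
  qed
qed

section \<open>Integral unipotents that force a crossing\<close>

text \<open>The conjugate of the unipotent matrix attached to an integer vector, where \<open>(x, y)\<close> are the
  coordinates of that vector in the basis given by the conjugating matrix.\<close>

definition unipotent :: "real \<Rightarrow> real \<Rightarrow> real \<Rightarrow> mat2" where
  "unipotent \<sigma> x y = (1 - 2*\<sigma>*(x*y), 2*\<sigma>*(x*x), - 2*\<sigma>*(y*y), 1 + 2*\<sigma>*(x*y))"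

text \<open>The values \<beta>1 and \<beta>2 are the coordinates of (m,n) in the basis of columns of
  (p,q,r,s). The conjugated unipotent has top left entry 1 - 2*\<sigma>*\<beta>1*\<beta>2 and lower
  left entry -2*\<sigma>*\<beta>2^2. It degenerates exactly at integer vectors with \<beta>2 = 0,
  where it fixes \<infinity>, or \<beta>1 = 0, where it fixes 0.\<close>

lemma tile_no_crossing_False:
  assumes e: "e = 1 \<or> e = -1" and t: "tile e D U" and J: "J \<in> closure U"
    and k: "p* s - q*r = (1::real)"
    and h: "\<And>m n \<sigma> x. (m,n) \<noteq> (0,0) \<Longrightarrow> \<sigma> = 1 \<or> \<sigma> = -1 \<Longrightarrow> x \<in> U \<Longrightarrow>
      x \<cdot>\<^sub>m unipotent \<sigma> (s * real_of_int m - q*real_of_int n) (p*real_of_int n - r*real_of_int m) \<notin> U"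
  shows False
proof -
  define \<beta>1 where "\<beta>1 m n = s * real_of_int m - q*real_of_int n" for m n
  define \<beta>2 where "\<beta>2 m n = p*real_of_int n - r*real_of_int m" for m n
  have inv: "p*\<beta>1 m n + q*\<beta>2 m n = m" "r*\<beta>1 m n + s * \<beta>2 m n = n" for m n
  proof -
    have "p*\<beta>1 m n + q*\<beta>2 m n = (p* s-q*r)*m" "r*\<beta>1 m n + s * \<beta>2 m n = (p* s-q*r)*n"
      by (simp_all add: \<beta>1_def \<beta>2_def algebra_simps)
    then show "p*\<beta>1 m n + q*\<beta>2 m n = m" "r*\<beta>1 m n + s * \<beta>2 m n = n" by (simp_all add: k)
  qed
  have sym: "mneg x \<in> U" if "x \<in> U" for x using t that by (simp add: tile_def)
  have crossing: False
    if mn: "(m,n) \<noteq> (0,0)" and \<sigma>: "\<sigma> = 1 \<or> \<sigma> = -1" and y: "\<beta>2 m n \<noteq> 0"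
      and \<alpha>: "1 - 2*\<sigma>*(\<beta>1 m n*\<beta>2 m n) \<noteq> 0" "e = -1 \<Longrightarrow> \<bar>1 - 2*\<sigma>*(\<beta>1 m n*\<beta>2 m n)\<bar> < 1" for m n \<sigma>
  proof -
    define x y where "x = \<beta>1 m n" and "y = \<beta>2 m n"
    have H: "u \<cdot>\<^sub>m unipotent \<sigma> x y \<notin> U" if "u \<in> U" for u
      using h[OF mn \<sigma> that] by (simp add: x_def y_def \<beta>1_def \<beta>2_def)
    have det: "(1 - 2*\<sigma>*(x*y))*(1 + 2*\<sigma>*(x*y)) - (2*\<sigma>*(x*x))*(- 2*\<sigma>*(y*y)) = 1"
      by (simp add: algebra_simps)
    show False
    \<comment> \<open>A positive lower left entry is needed. It is there for \<sigma> = -1; for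
      \<sigma> = 1 the matrix is negated, which is harmless because U is symmetric.\<close>
    proof (cases "\<sigma> = -1")
      case True
      show False
        by (rule stem_wing_crossing[OF e t J H[unfolded unipotent_def] det])
          (use \<alpha> y True in \<open>auto simp: x_def y_def zero_less_mult_iff\<close>)
    next
      case False
      have Hn: "u \<cdot>\<^sub>m (- (1 - 2*\<sigma>*(x*y)), - (2*\<sigma>*(x*x)), - (- 2*\<sigma>*(y*y)), - (1 + 2*\<sigma>*(x*y))) \<notin> U" if "u \<in> U" for u
      proof
        assume "u \<cdot>\<^sub>m (- (1 - 2*\<sigma>*(x*y)), - (2*\<sigma>*(x*x)), - (- 2*\<sigma>*(y*y)), - (1 + 2*\<sigma>*(x*y))) \<in> U"
        moreover have "u \<cdot>\<^sub>m (- (1 - 2*\<sigma>*(x*y)), - (2*\<sigma>*(x*x)), - (- 2*\<sigma>*(y*y)), - (1 + 2*\<sigma>*(x*y)))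
            = mneg (u \<cdot>\<^sub>m unipotent \<sigma> x y)"
          unfolding mneg_mmul(2)[symmetric] by (simp only: unipotent_def mneg_simp)
        ultimately show False using H[OF that] sym by (metis mneg_mneg)
      qed
      have detn: "(- (1 - 2*\<sigma>*(x*y)))*(- (1 + 2*\<sigma>*(x*y))) - (- (2*\<sigma>*(x*x)))*(- (- 2*\<sigma>*(y*y))) = 1"
        by (simp add: algebra_simps)
      show False
        by (rule stem_wing_crossing[OF e t J Hn detn])
          (use \<alpha> y \<sigma> False in \<open>auto simp: x_def y_def zero_less_mult_iff\<close>)
    qed
  qed
  show False
  proof (cases "e = 1")
    case True
    obtain m n where mn: "\<beta>2 m n \<noteq> 0"
    proof (cases "p = 0")
      case True
      then have "r \<noteq> 0" using k by auto
      then show thesis using True by (intro that[of 1 0]) (simp add: \<beta>2_def)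
    next
      case False
      then show thesis by (intro that[of 0 1]) (simp add: \<beta>2_def)
    qed
    then have mn0: "(m,n) \<noteq> (0,0)" by (auto simp: \<beta>2_def)
    \<comment> \<open>The two entries add up to 2, so the unipotent or its inverse has a nonzero top
      left entry.\<close>
    have "1 - 2*1*(\<beta>1 m n*\<beta>2 m n) \<noteq> 0 \<or> 1 - 2*(-1)*(\<beta>1 m n*\<beta>2 m n) \<noteq> 0" by linarith
    then show False
    proof
      assume *: "1 - 2*1*(\<beta>1 m n*\<beta>2 m n) \<noteq> 0"
      show False by (rule crossing[OF mn0 _ mn *]) (use True in auto)
    next
      assume *: "1 - 2*(-1)*(\<beta>1 m n*\<beta>2 m n) \<noteq> 0"
      show False by (rule crossing[OF mn0 _ mn *]) (use True in auto)
    qed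
  next
    case False
    then have e1: "e = -1" using e by simp
    consider m n where "(m,n) \<noteq> (0,0)" "\<beta>2 m n = 0" | m n where "(m,n) \<noteq> (0,0)" "\<beta>1 m n = 0"
      | "\<And>m n. (m,n) \<noteq> (0,0) \<Longrightarrow> \<beta>1 m n \<noteq> 0 \<and> \<beta>2 m n \<noteq> 0" by blast
    then show False
    proof cases
      case 1
      show False
        by (rule parabolic_crossing[OF t[unfolded e1] J, of "2*(\<beta>1 m n*\<beta>1 m n)"])
          (use h[OF 1(1), of 1] 1(2) in \<open>auto simp: unipotent_def simp flip: \<beta>1_def \<beta>2_def\<close>)
    next
      case 2
      have Jc: "J \<in> closure (jconj ` U)"
        using closure_image_mem[OF continuous_jconj J] by (simp add: J_def)
      show False
      \<comment> \<open>\<open>jconj\<close> turns the lower triangular unipotent into an upper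
        triangular one.\<close>
      proof (rule parabolic_crossing[OF tile_jconj[OF t[unfolded e1]] Jc, of "2*(\<beta>2 m n*\<beta>2 m n)"])
        fix x assume "x \<in> jconj ` U"
        then obtain u where u: "u \<in> U" "x = jconj u" by (rule imageE) simp
        have "jconj (1, 2*(\<beta>2 m n*\<beta>2 m n), 0, 1) = unipotent 1 (\<beta>1 m n) (\<beta>2 m n)"
          using 2(2) by (simp add: unipotent_def)
        then have "jconj (x \<cdot>\<^sub>m (1, 2*(\<beta>2 m n*\<beta>2 m n), 0, 1)) = u \<cdot>\<^sub>m unipotent 1 (\<beta>1 m n) (\<beta>2 m n)"
          unfolding jconj_mmul u(2) by (simp only: jconj_jconj)
        moreover have "u \<cdot>\<^sub>m unipotent 1 (\<beta>1 m n) (\<beta>2 m n) \<notin> U"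
          using h[OF 2(1) _ u(1), of 1] by (simp add: \<beta>1_def \<beta>2_def)
        ultimately show "x \<cdot>\<^sub>m (1, 2*(\<beta>2 m n*\<beta>2 m n), 0, 1) \<notin> jconj ` U"
          by (metis imageE jconj_jconj)
      qed
    next
      case 3
      have Q: "qform (- r* s) (p* s+q*r) (- p*q) m n = \<beta>1 m n * \<beta>2 m n" for m n
        by (simp add: qform_def \<beta>1_def \<beta>2_def power2_eq_square algebra_simps)
      have "(p* s+q*r)^2 - 4*(- r* s)*(- p*q) = (p* s-q*r)^2" by (simp add: power2_eq_square algebra_simps)
      then have disc: "(p* s+q*r)^2 - 4*(- r* s)*(- p*q) = 1" by (simp only: k) simp
      obtain N where "\<bar>- r* s\<bar> < 4^N" using real_arch_pow[of 4 "\<bar>- r* s\<bar>"] by auto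
      from qform_small_value[OF disc this] obtain m n where
        mn: "0 < \<bar>\<beta>1 m n * \<beta>2 m n\<bar>" "\<bar>\<beta>1 m n * \<beta>2 m n\<bar> < 1/2"
        unfolding Q using 3 by (metis mult_eq_0_iff)
      \<comment> \<open>With this sign the top left entry is 1 - 2*|\<beta>1*\<beta>2|, strictly
        between 0 and 1.\<close>
      define \<sigma> where "\<sigma> = sgn (\<beta>1 m n * \<beta>2 m n)"
      have \<sigma>: "\<sigma> = 1 \<or> \<sigma> = -1" "\<sigma> * (\<beta>1 m n * \<beta>2 m n) = \<bar>\<beta>1 m n * \<beta>2 m n\<bar>"
        using mn by (auto simp: \<sigma>_def sgn_if)
      have "1 - 2*\<sigma>*(\<beta>1 m n * \<beta>2 m n) = 1 - 2*\<bar>\<beta>1 m n * \<beta>2 m n\<bar>"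
        using \<sigma>(2) by (simp only: mult.assoc)
      then have "1 - 2*\<sigma>*(\<beta>1 m n * \<beta>2 m n) \<noteq> 0" "\<bar>1 - 2*\<sigma>*(\<beta>1 m n * \<beta>2 m n)\<bar> < 1"
        using mn by linarith+
      moreover have "\<beta>2 m n \<noteq> 0" "(m,n) \<noteq> (0,0)" using mn by (auto simp: \<beta>2_def)
      ultimately show False using crossing \<sigma>(1) by blast
    qed
  qed
qed

section \<open>The action\<close>

definition rmat :: "imat \<Rightarrow> mat2" where
  "rmat = (\<lambda>(a,b,c,d). (real_of_int a, real_of_int b, real_of_int c, real_of_int d))"

lemma rmat_simp [simp]: "rmat (a,b,c,d) = (real_of_int a, real_of_int b, real_of_int c, real_of_int d)"
  by (simp add: rmat_def)

lemma rmat_mul: "rmat (imul x y) = rmat x \<cdot>\<^sub>m rmat y"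
  by (cases x; cases y) simp

lemma rmat_SL2:
  assumes "x \<in> sanov" shows "rmat x \<in> SL2"
proof (cases x)
  case (fields a b c d)
  then have "a*d - b*c = 1" using assms by (simp add: sanov_iff)
  then have "real_of_int (a*d - b*c) = 1" by (simp only: of_int_1)
  then show ?thesis by (simp add: fields SL2_iff)
qed

lemma rmat_inv:
  assumes "x \<in> sanov" shows "rmat (iinv x) = minv (rmat x)"
  using rmat_SL2[OF assms] by (cases x) (simp add: SL2_iff)

definition act :: "nat \<Rightarrow> mat2 \<Rightarrow> mat2" where
  "act n x = x \<cdot>\<^sub>m minv (rmat (from_nat n))"

lemma act_to_nat [simp]: "act (to_nat m) x = x \<cdot>\<^sub>m minv (rmat m)"
  by (simp add: act_def)

lemma isometric_act: "isometric_action sanov_group act"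
  unfolding isometric_action_def
proof (intro conjI ballI)
  fix \<gamma> assume "\<gamma> \<in> carrier sanov_group"
  then obtain m where m: "m \<in> sanov" "\<gamma> = to_nat m" by auto
  have "mdet (rmat m) = 1" using rmat_SL2[OF m(1)] by (simp add: SL2_def)
  moreover have "mdet (1,0,0,1) = 1" by simp
  ultimately show "AdS_isometry (act \<gamma>)"
    unfolding AdS_isometry_def m(2) act_to_nat msim_def by (intro exI[of _ "rmat m"] exI[of _ "(1,0,0,1)"]) simp
next
  fix x :: mat2 assume "x \<in> SL2"
  show "act \<one>\<^bsub>sanov_group\<^esub> x \<approx>\<^sub>m x" by (simp add: msim_def)
next
  fix \<gamma> \<delta> :: nat and x :: mat2
  assume "\<gamma> \<in> carrier sanov_group" "\<delta> \<in> carrier sanov_group"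
  then obtain m n where mn: "m \<in> sanov" "\<gamma> = to_nat m" "n \<in> sanov" "\<delta> = to_nat n" by auto
  show "act (\<gamma> \<otimes>\<^bsub>sanov_group\<^esub> \<delta>) x \<approx>\<^sub>m act \<gamma> (act \<delta> x)"
    by (simp only: mn mult_sanov_group act_to_nat rmat_mul minv_mmul[OF rmat_SL2[OF mn(1)] rmat_SL2[OF mn(3)]]
        mmul_assoc msim_def simp_thms)
qed

text \<open>If m moves x to +-y with both in K, then m = +-y^-1 x. Its entries are bounded by twice
  the square of a bound for K, and only finitely many integer matrices satisfy this.\<close>

lemma properly_discontinuous_act: "properly_discontinuous sanov_group act"
  unfolding properly_discontinuous_def
proof (intro allI impI)
  fix K :: "mat2 set" assume K: "compact K \<and> K \<subseteq> SL2"
  then obtain M where M: "\<And>x. x \<in> K \<Longrightarrow> norm x \<le> M" by (meson bounded_iff compact_imp_bounded)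
  have entries: "\<bar>a\<bar> \<le> M \<and> \<bar>b\<bar> \<le> M \<and> \<bar>c\<bar> \<le> M \<and> \<bar>d\<bar> \<le> M" if "(a,b,c,d) \<in> K" for a b c d
  proof -
    have 1: "norm (a,b,c,d) \<le> M" by (rule M[OF that])
    have 2: "norm (b,c,d) \<le> norm (a,b,c,d)" "\<bar>a\<bar> \<le> norm (a,b,c,d)"
      using norm_snd_le[where x = a and y = "(b,c,d)"] norm_fst_le[where x = a and y = "(b,c,d)"] by simp_all
    have 3: "norm (c,d) \<le> norm (b,c,d)" "\<bar>b\<bar> \<le> norm (b,c,d)"
      using norm_snd_le[where x = b and y = "(c,d)"] norm_fst_le[where x = b and y = "(c,d)"] by simp_all
    have 4: "\<bar>d\<bar> \<le> norm (c,d)" "\<bar>c\<bar> \<le> norm (c,d)"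
      using norm_snd_le[where x = c and y = d] norm_fst_le[where x = c and y = d] by simp_all
    show ?thesis using 1 2 3 4 by linarith
  qed
  define N where "N = \<lceil>2*(M*M)\<rceil>"
  have prodM: "\<bar>x*y\<bar> \<le> M*M" if "\<bar>x\<bar> \<le> M" "\<bar>y\<bar> \<le> M" for x y :: real
    using mult_mono[OF that] that by (simp add: abs_mult)
  have diff: "\<bar>p\<bar> \<le> 2*(M*M)"
    if "p = x - y \<or> p = - (x - y)" "\<bar>x\<bar> \<le> M*M" "\<bar>y\<bar> \<le> M*M" for p x y :: real
    using that by linarith
  have le: "p \<in> {-N..N}" if "\<bar>real_of_int p\<bar> \<le> 2*(M*M)" for p :: int
  proof -
    have "real_of_int \<bar>p\<bar> \<le> 2*(M*M)" using that by simp
    then have "\<bar>p\<bar> \<le> N" unfolding N_def using le_ceiling_iff by (metis ceiling_mono ceiling_of_int)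
    then show ?thesis by auto
  qed
  have "{\<gamma> \<in> carrier sanov_group. \<exists>x\<in>K. \<exists>y\<in>K. act \<gamma> x \<approx>\<^sub>m y}
      \<subseteq> to_nat ` ({-N..N} \<times> {-N..N} \<times> {-N..N} \<times> {-N..N})"
  proof
    fix \<gamma> assume "\<gamma> \<in> {\<gamma> \<in> carrier sanov_group. \<exists>x\<in>K. \<exists>y\<in>K. act \<gamma> x \<approx>\<^sub>m y}"
    then obtain m x y where m: "m \<in> sanov" "\<gamma> = to_nat m" and xy: "x \<in> K" "y \<in> K" "act \<gamma> x \<approx>\<^sub>m y"
      by auto
    have SL: "rmat m \<in> SL2" "y \<in> SL2" using m rmat_SL2 K xy by auto
    define w where "w = x \<cdot>\<^sub>m minv (rmat m)"
    have "w \<cdot>\<^sub>m rmat m = x" unfolding w_def mmul_assoc by (simp add: mmul_minv SL)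
    moreover have "w = y \<or> w = mneg y" using xy(3) unfolding m(2) act_to_nat w_def[symmetric] msim_def by auto
    ultimately have "y \<cdot>\<^sub>m rmat m = x \<or> y \<cdot>\<^sub>m rmat m = mneg x" by (auto simp: mneg_mmul)
    then have *: "rmat m = minv y \<cdot>\<^sub>m x \<or> rmat m = mneg (minv y \<cdot>\<^sub>m x)"
      using mmul_minv_cancel(2)[OF SL(2), of "rmat m"] by (auto simp: mneg_mmul)
    obtain a b c d where y: "y = (a,b,c,d)" by (cases y)
    obtain e f g h where x: "x = (e,f,g,h)" by (cases x)
    obtain p q r s where mm: "m = (p,q,r,s)" by (cases m)
    have inv: "minv y = (d,-b,-c,a)" using SL(2) by (simp add: y SL2_iff)
    have E: "\<bar>a\<bar> \<le> M" "\<bar>b\<bar> \<le> M" "\<bar>c\<bar> \<le> M" "\<bar>d\<bar> \<le> M" "\<bar>e\<bar> \<le> M" "\<bar>f\<bar> \<le> M" "\<bar>g\<bar> \<le> M" "\<bar>h\<bar> \<le> M"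
      using entries xy(1,2) x y by auto
    have "real_of_int p = d*e - b*g \<or> real_of_int p = -(d*e - b*g)"
      "real_of_int q = d*f - b*h \<or> real_of_int q = -(d*f - b*h)"
      "real_of_int r = a*g - c*e \<or> real_of_int r = -(a*g - c*e)"
      "real_of_int s = a*h - c*f \<or> real_of_int s = -(a*h - c*f)"
      using * by (auto simp: mm inv x)
    note diff[OF this(1) prodM[OF E(4,5)] prodM[OF E(2,7)]] diff[OF this(2) prodM[OF E(4,6)] prodM[OF E(2,8)]]
      diff[OF this(3) prodM[OF E(1,7)] prodM[OF E(3,5)]] diff[OF this(4) prodM[OF E(1,8)] prodM[OF E(3,6)]]
    then show "\<gamma> \<in> to_nat ` ({-N..N} \<times> {-N..N} \<times> {-N..N} \<times> {-N..N})"
      unfolding m(2) mm by (intro imageI SigmaI le)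
  qed
  then show "finite {\<gamma> \<in> carrier sanov_group. \<exists>x\<in>K. \<exists>y\<in>K. act \<gamma> x \<approx>\<^sub>m y}"
    by (rule finite_subset) auto
qed

text \<open>The factor 2 in \<open>unipotent\<close> makes the matrix congruent to I mod 2. Its
  diagonal is 1 or 3 mod 4 according to the parity of m*n, which decides the sign of the
  lift.\<close>

lemma unipotent_sanov:
  assumes "(m,n) \<noteq> (0,0)" "\<sigma> = 1 \<or> \<sigma> = -1"
  obtains g where "g \<in> sanov" "g \<noteq> (1,0,0,1)"
    "rmat g = unipotent \<sigma> (real_of_int m) (real_of_int n) \<or> rmat g = mneg (unipotent \<sigma> (real_of_int m) (real_of_int n))"
proof -
  obtain t :: int where t: "\<sigma> = real_of_int t" "t = 1 \<or> t = -1" using assms(2) that by (metis of_int_1 of_int_minus)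
  define g :: imat where "g = (1 - 2*t*(m*n), 2*t*(m*m), - 2*t*(n*n), 1 + 2*t*(m*n))"
  have tt: "t*t = 1" using t(2) by auto
  have det: "(1 - 2*t*(m*n))*(1 + 2*t*(m*n)) - (2*t*(m*m))*(- 2*t*(n*n)) = 1"
    by (simp add: algebra_simps)
  have rg: "rmat g = unipotent \<sigma> (real_of_int m) (real_of_int n)"
    by (simp add: g_def unipotent_def t(1))
  have ne: "2*t*(m*m) \<noteq> 0 \<or> - 2*t*(n*n) \<noteq> 0" using assms(1) t(2) by auto
  show thesis
  proof (cases "even (m*n)")
    case True
    then obtain j where j: "m*n = 2*j" by (elim evenE)
    have "(1 - 2*t*(m*n)) mod 4 = 1" "(1 + 2*t*(m*n)) mod 4 = 1"
      using t(2) unfolding j by presburger+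
    then have "g \<in> sanov" unfolding g_def sanov_iff using det by simp
    moreover have "g \<noteq> (1,0,0,1)" unfolding g_def using ne by auto
    ultimately show thesis using rg that by blast
  next
    case False
    then obtain j where j: "m*n = 2*j+1" by (elim oddE)
    define g' :: imat where "g' = (- (1 - 2*t*(m*n)), - (2*t*(m*m)), - (- 2*t*(n*n)), - (1 + 2*t*(m*n)))"
    have "(- (1 - 2*t*(m*n))) mod 4 = 1" "(- (1 + 2*t*(m*n))) mod 4 = 1"
      using t(2) unfolding j by presburger+
    moreover have "(- (1 - 2*t*(m*n)))*(- (1 + 2*t*(m*n))) - (- (2*t*(m*m)))*(- (- 2*t*(n*n))) = 1"
      by (simp add: algebra_simps)
    ultimately have "g' \<in> sanov" unfolding g'_def sanov_iff by simp
    moreover have "g' \<noteq> (1,0,0,1)" unfolding g'_def using ne by auto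
    moreover have "rmat g' = mneg (rmat g)" by (simp add: g'_def g_def)
    ultimately show thesis using rg that by metis
  qed
qed

text \<open>With v = (x,y) the matrix is I + 2*\<sigma>*v*v^T*J. For k of determinant 1 one has J*k
  = k^-T*J, so conjugation merely replaces v by k^-1 v.\<close>

lemma unipotent_conj:
  assumes k: "p* s - q*r = 1"
  shows "minv (p,q,r,s) \<cdot>\<^sub>m unipotent \<sigma> x y \<cdot>\<^sub>m (p,q,r,s) = unipotent \<sigma> (s * x - q*y) (p*y - r*x)"
proof -
  have "s * (1 - 2*\<sigma>*(x*y))*p + s * (2*\<sigma>*(x*x))*r - q*(- 2*\<sigma>*(y*y))*p - q*(1 + 2*\<sigma>*(x*y))*r
      = (p* s-q*r) - 2*\<sigma>*((s * x-q*y)*(p*y-r*x))"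
    "s * (1 - 2*\<sigma>*(x*y))*q + s * (2*\<sigma>*(x*x))* s - q*(- 2*\<sigma>*(y*y))*q - q*(1 + 2*\<sigma>*(x*y))* s
      = 2*\<sigma>*((s * x-q*y)*(s * x-q*y))"
    "p*(- 2*\<sigma>*(y*y))*p + p*(1 + 2*\<sigma>*(x*y))*r - r*(1 - 2*\<sigma>*(x*y))*p - r*(2*\<sigma>*(x*x))*r
      = - 2*\<sigma>*((p*y-r*x)*(p*y-r*x))"
    "p*(- 2*\<sigma>*(y*y))*q + p*(1 + 2*\<sigma>*(x*y))* s - r*(1 - 2*\<sigma>*(x*y))*q - r*(2*\<sigma>*(x*x))* s
      = (p* s-q*r) + 2*\<sigma>*((s * x-q*y)*(p*y-r*x))"
    by (simp_all add: algebra_simps)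
  note * = this[unfolded k]
  show ?thesis unfolding unipotent_def minv_simp[OF k] mmul_simp
    by (simp only: prod.inject *[symmetric]) (simp add: algebra_simps)
qed

text \<open>F parametrises \<open>SL2\<close> by the nonzero first column (a,c) and a real t: the
  second column is (-c,a)/(a^2+c^2), orthogonal to the first, plus t times the first. The domain is
  open and connected in R^3, where removing a countable set preserves connectedness.\<close>

lemma SL2_minus_finite_connected:
  assumes "finite V" shows "connected (SL2 - V)"
proof -
  define S :: "((real \<times> real) \<times> real) set" where "S = (- {(0,0)}) \<times> UNIV"
  define F :: "(real \<times> real) \<times> real \<Rightarrow> mat2" where
    "F = (\<lambda>((a,c),t). (a, - c/(a*a+c*c) + t*a, c, a/(a*a+c*c) + t*c))"
  have n0: "a*a+c*c \<noteq> 0" if "(a,c) \<noteq> (0,0)" for a c :: real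
    using that by (auto simp: sum_squares_eq_zero_iff)
  have "connected S" unfolding S_def
    by (intro connected_Times connected_punctured_universe) auto
  moreover have oS: "open S" unfolding S_def by (intro open_Times) auto
  have inj: "inj_on F S"
  proof (rule inj_onI)
    fix x y assume xy: "x \<in> S" "y \<in> S" "F x = F y"
    obtain a c t where x: "x = ((a,c),t)" by (metis prod.exhaust)
    obtain a' c' t' where y: "y = ((a',c'),t')" by (metis prod.exhaust)
    have *: "a = a'" "c = c'" "t*a = t'*a" "t*c = t'*c" using xy(3) by (auto simp: F_def x y)
    moreover have "a \<noteq> 0 \<or> c \<noteq> 0" using xy(1) by (auto simp: S_def x)
    ultimately have "t = t'" by auto
    then show "x = y" using * by (simp add: x y)
  qed
  moreover have "countable (F -` V \<inter> S)" by (rule countable_finite[OF finite_vimage_IntI[OF assms inj]])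
  ultimately have "connected (S - (F -` V \<inter> S))" using oS by (intro connected_open_diff_countable) auto
  moreover have "continuous_on (S - (F -` V \<inter> S)) F"
    unfolding F_def split_beta by (intro continuous_intros) (auto simp: S_def dest: n0)
  moreover have "F ` (S - (F -` V \<inter> S)) = SL2 - V"
  proof -
    have "F ` S = SL2"
    proof (intro equalityI subsetI)
      fix x assume "x \<in> F ` S"
      then obtain a c t where x: "x = F ((a,c),t)" "(a,c) \<noteq> (0,0)" by (auto simp: S_def)
      define n where "n = a*a+c*c"
      have "a*(a/n + t*c) - (- c/n + t*a)*c = a*a/n + c*c/n" by (simp add: algebra_simps)
      also have "\<dots> = n/n" unfolding n_def by (rule add_divide_distrib[symmetric])
      finally show "x \<in> SL2" using n0[OF x(2)] by (simp add: x F_def SL2_iff flip: n_def)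
    next
      fix x assume x: "x \<in> SL2"
      obtain a b c d where xx: "x = (a,b,c,d)" by (cases x)
      have det: "a*d - b*c = 1" using x by (simp add: xx SL2_iff)
      then have ne: "(a,c) \<noteq> (0,0)" by auto
      define n t where "n = a*a+c*c" and "t = (a*b+c*d)/n"
      have n: "n \<noteq> 0" using n0[OF ne] by (simp add: n_def)
      have "n*b = - c*(a*d-b*c) + (a*b+c*d)*a" "n*d = a*(a*d-b*c) + (a*b+c*d)*c"
        by (simp_all add: n_def algebra_simps)
      moreover have "a*b + c*d = n*t" using n by (simp add: t_def)
      ultimately have "n*b = n*(- c/n + t*a)" "n*d = n*(a/n + t*c)"
        using n unfolding det by (simp_all add: distrib_left right_diff_distrib mult.assoc)
      then have "b = - c/n + t*a" "d = a/n + t*c" by (simp_all only: mult_left_cancel[OF n])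
      then have "x = F ((a,c),t)" by (simp add: xx F_def flip: n_def)
      moreover have "((a,c),t) \<in> S" using ne by (auto simp: S_def)
      ultimately show "x \<in> F ` S" by blast
    qed
    moreover have "F ` (S - (F -` V \<inter> S)) = F ` S - V" by blast
    ultimately show ?thesis by simp
  qed
  ultimately show ?thesis by (metis connected_continuous_image)
qed

section \<open>Closed and open sets under multiplication\<close>

lemma bimul_continuous: "continuous_on A (\<lambda>x. g \<cdot>\<^sub>m x \<cdot>\<^sub>m k)"
  unfolding mmul_def split_beta by (intro continuous_intros)

lemma bimul_inverse:
  assumes "g \<in> SL2" "k \<in> SL2"
  shows "minv g \<cdot>\<^sub>m (g \<cdot>\<^sub>m x \<cdot>\<^sub>m minv k) \<cdot>\<^sub>m k = x" "g \<cdot>\<^sub>m (minv g \<cdot>\<^sub>m x \<cdot>\<^sub>m k) \<cdot>\<^sub>m minv k = x"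
  using assms by (simp_all add: mmul_assoc mmul_minv_cancel mmul_minv)

lemma closed_SL2: "closed SL2"
proof -
  have "continuous_on UNIV mdet" unfolding mdet_def split_beta by (intro continuous_intros)
  then have "closed (mdet -` {1})" by (intro closed_vimage) auto
  moreover have "mdet -` {1} = SL2" by (auto simp: SL2_def)
  ultimately show ?thesis by simp
qed

lemma closed_cplane: "closed (cplane e)"
proof -
  have "cplane e = {x. fst x * snd (snd (snd x)) - fst (snd x) * fst (snd (snd x)) = 1} \<inter>
     (({x. fst x = snd (snd (snd x))} \<inter> {x. fst (snd x) * fst (snd (snd x)) \<le> 0}) \<union>
      ({x. fst (snd (snd x)) = 0} \<inter> {x. 0 \<le> e*(\<bar>fst x\<bar>-\<bar>snd (snd (snd x))\<bar>)}) \<union>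
      ({x. fst (snd x) = 0} \<inter> {x. e*(\<bar>fst x\<bar>-\<bar>snd (snd (snd x))\<bar>) \<le> 0}))"
    by (auto simp: cplane_def)
  also have "closed \<dots>"
    by (intro closed_Int closed_Un closed_Collect_eq closed_Collect_le continuous_intros)
  finally show ?thesis .
qed

lemma closed_bimul_image:
  assumes "g \<in> SL2" "k \<in> SL2" "closed A"
  shows "closed ((\<lambda>x. g \<cdot>\<^sub>m x \<cdot>\<^sub>m minv k) ` A)"
proof -
  have "(\<lambda>x. g \<cdot>\<^sub>m x \<cdot>\<^sub>m minv k) ` A = (\<lambda>x. minv g \<cdot>\<^sub>m x \<cdot>\<^sub>m k) -` A"
    by (rule image_eq_vimage_inverse) (simp_all add: bimul_inverse assms)
  then show ?thesis using closed_vimage[OF assms(3) bimul_continuous] by simp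
qed

lemma openin_SL2_image:
  assumes W: "openin AdS_top W" and cont: "continuous_on SL2 f'"
    and inv: "\<And>x. x \<in> SL2 \<Longrightarrow> f (f' x) = x" "\<And>x. x \<in> SL2 \<Longrightarrow> f' (f x) = x"
    and SL: "\<And>x. x \<in> SL2 \<Longrightarrow> f x \<in> SL2" "\<And>x. x \<in> SL2 \<Longrightarrow> f' x \<in> SL2"
  shows "openin AdS_top (f ` W)"
proof -
  have "W \<subseteq> SL2" using openin_subset[OF W] by (simp add: AdS_top_def)
  have "f ` W = SL2 \<inter> f' -` W"
  proof (intro equalityI subsetI)
    fix y assume "y \<in> f ` W"
    then obtain x where "x \<in> W" "y = f x" by blast
    then show "y \<in> SL2 \<inter> f' -` W" using \<open>W \<subseteq> SL2\<close> inv(2)[of x] SL(1)[of x] by auto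
  next
    fix y assume "y \<in> SL2 \<inter> f' -` W"
    then show "y \<in> f ` W" using inv(1)[of y] by (intro image_eqI[of _ _ "f' y"]) auto
  qed
  moreover have "openin AdS_top (SL2 \<inter> f' -` W)"
    using W SL(2) unfolding AdS_top_def by (intro continuous_openin_preimage[OF cont]) auto
  ultimately show ?thesis by simp
qed

lemma openin_rmul:
  assumes "openin AdS_top W" "m \<in> SL2"
  shows "openin AdS_top ((\<lambda>x. x \<cdot>\<^sub>m m) ` W)"
proof (rule openin_SL2_image[OF assms(1), where f' = "\<lambda>x. x \<cdot>\<^sub>m minv m"])
  show "continuous_on SL2 (\<lambda>x. x \<cdot>\<^sub>m minv m)" using bimul_continuous[of SL2 "(1,0,0,1)" "minv m"] by simp
qed (use assms in \<open>simp_all add: mmul_assoc mmul_minv SL2_mmul SL2_minv\<close>)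

lemma infinite_SL2: "infinite SL2"
proof
  assume "finite SL2"
  moreover have "(\<lambda>n::nat. (1, real n, 0, 1)) ` UNIV \<subseteq> SL2" by (auto simp: SL2_iff)
  ultimately have "finite ((\<lambda>n::nat. (1, real n, 0, 1)::mat2) ` UNIV)" by (rule rev_finite_subset)
  moreover have "inj (\<lambda>n::nat. (1, real n, 0, 1)::mat2)" by (auto intro!: injI)
  ultimately show False by (simp add: finite_image_iff)
qed

section \<open>Excluding a fundamental domain\<close>

lemma translate_act:
  assumes "saturated R" "g \<in> sanov"
  shows "translate act (to_nat g) R = (\<lambda>x. x \<cdot>\<^sub>m minv (rmat g)) ` R"
proof (intro equalityI subsetI)
  fix y assume "y \<in> translate act (to_nat g) R"
  then obtain x where x: "x \<in> R" "y = x \<cdot>\<^sub>m minv (rmat g) \<or> y = mneg (x \<cdot>\<^sub>m minv (rmat g))"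
    by (auto simp: translate_def msim_def)
  have "mneg x \<in> R" using x(1) assms(1) by (simp add: saturated_def)
  then show "y \<in> (\<lambda>x. x \<cdot>\<^sub>m minv (rmat g)) ` R"
    using x by (metis imageI mneg_mmul(1))
next
  fix y assume "y \<in> (\<lambda>x. x \<cdot>\<^sub>m minv (rmat g)) ` R"
  then show "y \<in> translate act (to_nat g) R" by (auto simp: translate_def msim_def)
qed

lemma no_crooked_fundamental_domain: "\<not> crooked_fundamental_domain sanov_group act R"
proof
  assume R: "crooked_fundamental_domain sanov_group act R"
  then have sat: "saturated R" and clR: "closedin AdS_top R"
    and cover: "(\<Union>\<gamma>\<in>carrier sanov_group. translate act \<gamma> R) = SL2"
    and disj: "\<And>\<gamma> \<delta>. \<gamma> \<in> carrier sanov_group \<Longrightarrow> \<delta> \<in> carrier sanov_group \<Longrightarrow> \<gamma> \<noteq> \<delta> \<Longrightarrow>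
        disjnt (AdS_top interior_of translate act \<gamma> R) (AdS_top interior_of translate act \<delta> R)"
    by (auto simp: crooked_fundamental_domain_def)
  from R obtain \<C> where \<C>: "finite \<C>" "\<And>P. P \<in> \<C> \<Longrightarrow> crooked_plane P" "pairwise disjnt \<C>"
    and fr: "AdS_top frontier_of R = \<Union>\<C>"
    by (auto simp: crooked_fundamental_domain_def)
  define U where "U = AdS_top interior_of R"
  have R_SL: "R \<subseteq> SL2" using sat by (simp add: saturated_def)
  have U_open: "openin AdS_top U" by (simp add: U_def)
  have UR: "U \<subseteq> R" unfolding U_def by (rule interior_of_subset)
  have U_SL: "U \<subseteq> SL2" using UR R_SL by blast
  have U_max: "W \<subseteq> U" if "openin AdS_top W" "W \<subseteq> R" for W
    unfolding U_def using that by (rule interior_of_maximal[rotated])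
  have clR': "AdS_top closure_of R = R" using clR by (simp add: closure_of_eq)
  have fr': "\<Union>\<C> = R - U" using fr by (simp add: frontier_of_def clR' U_def)
  have frU: "AdS_top frontier_of U \<subseteq> \<Union>\<C>"
  proof -
    have "AdS_top closure_of U \<subseteq> R" using closure_of_mono[OF UR, of AdS_top] clR' by simp
    moreover have "AdS_top interior_of U = U" using U_open by (simp add: interior_of_eq)
    ultimately show ?thesis unfolding frontier_of_def fr' by blast
  qed
  have U_neg: "mneg x \<in> U" if "x \<in> U" for x
  proof -
    have "openin AdS_top (mneg ` U)"
      by (rule openin_SL2_image[OF U_open, where f' = mneg]) (simp_all add: continuous_mneg SL2_mneg)
    moreover have "mneg ` U \<subseteq> R" using UR sat unfolding saturated_def by blast
    ultimately show ?thesis using U_max that by blast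
  qed
  \<comment> \<open>\<open>act\<close> multiplies by the inverse, so right multiplication by
    \<open>rmat g\<close> is the translate by \<open>iinv g\<close>.\<close>
  have U_move: "x \<cdot>\<^sub>m rmat g \<notin> U" if g: "g \<in> sanov" "g \<noteq> (1,0,0,1)" and x: "x \<in> U" for x g
  proof
    assume xg: "x \<cdot>\<^sub>m rmat g \<in> U"
    have gi: "iinv g \<in> sanov" "iinv g \<noteq> (1,0,0,1)"
      using sanov_inv[OF g(1)] g(2) by (simp, cases g, auto)
    have gg: "minv (rmat (iinv g)) = rmat g" using rmat_inv[OF g(1)] minv_minv[OF rmat_SL2[OF g(1)]] by simp
    have T1: "translate act (to_nat ((1,0,0,1)::imat)) R = R"
      unfolding translate_act[OF sat sanov_one] by simp
    have Tg: "translate act (to_nat (iinv g)) R = (\<lambda>x. x \<cdot>\<^sub>m rmat g) ` R"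
      unfolding translate_act[OF sat gi(1)] gg ..
    have "(\<lambda>x. x \<cdot>\<^sub>m rmat g) ` U \<subseteq> AdS_top interior_of translate act (to_nat (iinv g)) R"
      unfolding Tg by (intro interior_of_maximal openin_rmul U_open rmat_SL2 g(1) image_mono UR)
    moreover have "disjnt (AdS_top interior_of translate act (to_nat (iinv g)) R)
        (AdS_top interior_of translate act (to_nat ((1,0,0,1)::imat)) R)"
      by (rule disj) (use gi sanov_one in auto)
    ultimately show False using x xg unfolding T1 U_def[symmetric] disjnt_def by blast
  qed
  \<comment> \<open>The countably many translates are closed and cover \<open>SL2\<close>; if R had
    empty interior so would each of them, against Baire's theorem.\<close>
  have U_ne: "U \<noteq> {}"
  proof
    assume U0: "U = {}"
    have "AdS_top interior_of \<Union>((\<lambda>\<gamma>. translate act \<gamma> R) ` carrier sanov_group) = {}"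
    proof (rule Baire_category_alt)
      have "completely_metrizable_space AdS_top"
        unfolding AdS_top_def using closed_SL2 closed_closedin
        by (intro completely_metrizable_space_closedin completely_metrizable_space_euclidean) auto
      then show "completely_metrizable_space AdS_top \<or> locally_compact_space AdS_top \<and> regular_space AdS_top" ..
      show "countable ((\<lambda>\<gamma>. translate act \<gamma> R) ` carrier sanov_group)" by (intro countable_image countableI_type)
      fix T assume "T \<in> (\<lambda>\<gamma>. translate act \<gamma> R) ` carrier sanov_group"
      then obtain g where g: "g \<in> sanov" "T = (\<lambda>x. x \<cdot>\<^sub>m minv (rmat g)) ` R"
        using translate_act[OF sat] by auto
      note gS = rmat_SL2[OF g(1)]
      have cR: "closed R" using clR closed_SL2 unfolding AdS_top_def by (metis closedin_closed_eq)
      have "closed T" using closed_bimul_image[OF _ gS cR, of "(1,0,0,1)"] by (simp add: g(2) SL2_iff)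
      moreover have "T \<subseteq> SL2" using g(2) R_SL gS SL2_mmul SL2_minv by blast
      ultimately have "closedin AdS_top T" unfolding AdS_top_def by (simp add: closed_subset)
      moreover have "AdS_top interior_of T = {}"
      proof -
        define W where "W = AdS_top interior_of T"
        have "openin AdS_top ((\<lambda>x. x \<cdot>\<^sub>m rmat g) ` W)" by (rule openin_rmul[OF _ gS]) (simp add: W_def)
        moreover have "(\<lambda>x. x \<cdot>\<^sub>m rmat g) ` W \<subseteq> R"
        proof -
          have "W \<subseteq> (\<lambda>x. x \<cdot>\<^sub>m minv (rmat g)) ` R" unfolding W_def g(2) by (rule interior_of_subset)
          moreover have "x \<cdot>\<^sub>m minv (rmat g) \<cdot>\<^sub>m rmat g = x" for x
            by (simp add: mmul_assoc mmul_minv gS)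
          ultimately show ?thesis by auto
        qed
        ultimately have "(\<lambda>x. x \<cdot>\<^sub>m rmat g) ` W \<subseteq> {}" using U_max U0 by metis
        then show ?thesis by (simp add: W_def)
      qed
      ultimately show "closedin AdS_top T \<and> AdS_top interior_of T = {}" ..
    qed
    then have "AdS_top interior_of SL2 = {}" by (simp only: cover)
    moreover have "AdS_top interior_of SL2 = SL2"
      by (simp add: AdS_top_def interior_of_eq)
    ultimately show False using infinite_SL2 by auto
  qed
  have "\<forall>P\<in>\<C>. \<exists>g k. g \<in> SL2 \<and> k \<in> SL2 \<and> (\<exists>e. (e = 1 \<or> e = -1) \<and> P = (\<lambda>h. g \<cdot>\<^sub>m h \<cdot>\<^sub>m minv k) ` cplane e)"
    using crooked_plane_normal_form[OF \<C>(2)] by metis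
  then obtain G K where GK: "\<And>P. P \<in> \<C> \<Longrightarrow> G P \<in> SL2 \<and> K P \<in> SL2 \<and>
      (\<exists>e. (e = 1 \<or> e = -1) \<and> P = (\<lambda>h. G P \<cdot>\<^sub>m h \<cdot>\<^sub>m minv (K P)) ` cplane e)" by metis
  \<comment> \<open>The vertices of all boundary planes: the images of I and -I.\<close>
  define V where "V = (\<lambda>P. G P \<cdot>\<^sub>m minv (K P)) ` \<C> \<union> (\<lambda>P. mneg (G P \<cdot>\<^sub>m minv (K P))) ` \<C>"
  have V: "finite V" using \<C>(1) by (simp add: V_def)
  have one_cplane: "(1,0,0,1) \<in> cplane e" "(-1,0,0,-1) \<in> cplane e" for e by (simp_all add: cplane_iff)
  have neg_one: "g \<cdot>\<^sub>m (-1,0,0,-1) \<cdot>\<^sub>m k = mneg (g \<cdot>\<^sub>m k)" for g k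
    using mneg_mmul[of g k] mneg_mmul(2)[of g "(1,0,0,1)"] by simp
  have "V \<subseteq> \<Union>\<C>"
  proof
    fix x assume "x \<in> V"
    then obtain P where P: "P \<in> \<C>" "x = G P \<cdot>\<^sub>m minv (K P) \<or> x = mneg (G P \<cdot>\<^sub>m minv (K P))" by (auto simp: V_def)
    obtain e where e: "P = (\<lambda>h. G P \<cdot>\<^sub>m h \<cdot>\<^sub>m minv (K P)) ` cplane e" using GK[OF P(1)] by blast
    have "G P \<cdot>\<^sub>m (1,0,0,1) \<cdot>\<^sub>m minv (K P) \<in> P" "G P \<cdot>\<^sub>m (-1,0,0,-1) \<cdot>\<^sub>m minv (K P) \<in> P"
      using one_cplane[of e] by (subst e, blast)+
    then have "x \<in> P" using P(2) by (auto simp: neg_one)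
    then show "x \<in> \<Union>\<C>" using P(1) by blast
  qed
  then have UV: "U \<inter> V = {}" using fr' by blast
  \<comment> \<open>\<open>SL2\<close> - V is connected and meets both U and its complement, so U
    has a frontier point that is not a vertex.\<close>
  have "(SL2 - V) \<inter> AdS_top frontier_of U \<noteq> {}"
  proof (rule connectedin_Int_frontier_of)
    show "connectedin AdS_top (SL2 - V)"
      using SL2_minus_finite_connected[OF V] by (simp add: AdS_top_def connectedin_subtopology)
    show "(SL2 - V) \<inter> U \<noteq> {}" using U_ne UV U_SL by blast
    show "SL2 - V - U \<noteq> {}"
    proof
      \<comment> \<open>The complement of U contains a translate of U. Were it inside the finite set
        V, then U and with it \<open>SL2\<close> would be finite.\<close>
      assume "SL2 - V - U = {}"
      then have sub: "SL2 - U \<subseteq> V" by blast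
      have gA: "rmat sanov_A \<in> SL2" "sanov_A \<noteq> (1,0,0,1)" by (rule rmat_SL2[OF sanov_AB(1)]) (simp add: sanov_A_def)
      have "(\<lambda>x. x \<cdot>\<^sub>m rmat sanov_A) ` U \<subseteq> V"
        using sub U_move[OF sanov_AB(1) gA(2)] U_SL SL2_mmul gA(1) by blast
      then have "finite ((\<lambda>x. x \<cdot>\<^sub>m rmat sanov_A) ` U)" using V finite_subset by blast
      moreover have "inj_on (\<lambda>x. x \<cdot>\<^sub>m rmat sanov_A) U"
        by (rule inj_on_inverseI[where g = "\<lambda>x. x \<cdot>\<^sub>m minv (rmat sanov_A)"]) (simp add: mmul_assoc mmul_minv gA)
      ultimately have "finite U" by (simp add: finite_image_iff)
      then have "finite (V \<union> U)" using V by simp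
      then show False using infinite_SL2 sub finite_subset[of SL2 "V \<union> U"] by blast
    qed
  qed
  then obtain z where z: "z \<in> AdS_top frontier_of U" "z \<notin> V" by blast
  obtain P where P: "P \<in> \<C>" "z \<in> P" using z frU by blast
  obtain g k e where gk: "g \<in> SL2" "k \<in> SL2" and e: "e = 1 \<or> e = -1"
    and Pe: "P = (\<lambda>h. g \<cdot>\<^sub>m h \<cdot>\<^sub>m minv k) ` cplane e" and gkP: "g = G P" "k = K P"
    using GK[OF P(1)] by metis
  have zU: "z \<in> closure U"
  proof -
    have "z \<in> AdS_top closure_of U" using z by (simp add: frontier_of_def)
    then show ?thesis unfolding AdS_top_def closure_of_subtopology
      using closure_mono[of "SL2 \<inter> U" U] by auto
  qed
  \<comment> \<open>Coordinates in which P is \<open>cplane e\<close>. The left factor cancels in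
    translations: right multiplication by h becomes right multiplication by k^-1 h k.\<close>
  define f where "f x = minv g \<cdot>\<^sub>m x \<cdot>\<^sub>m k" for x
  define f' where "f' x = g \<cdot>\<^sub>m x \<cdot>\<^sub>m minv k" for x
  have ff': "f (f' x) = x" "f' (f x) = x" for x using gk by (simp_all add: f_def f'_def bimul_inverse)
  have fSL: "f x \<in> SL2" "f' x \<in> SL2" if "x \<in> SL2" for x
    using gk that by (auto simp: f_def f'_def intro!: SL2_mmul SL2_minv)
  have cont: "continuous_on UNIV f" "continuous_on UNIV f'"
    unfolding f_def f'_def by (rule bimul_continuous)+
  have im: "f ` A = f' -` A" for A by (rule image_eq_vimage_inverse) (rule ff')+
  have fP: "f ` P = cplane e" unfolding Pe f'_def[symmetric] by (simp add: image_image ff')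
  define D where "D = f ` \<Union>(\<C> - {P})"
  have sat_U: "connsat (\<Union>\<C>) U"
    unfolding connsat_def
  proof (intro allI impI)
    fix T assume T: "connected T \<and> T \<subseteq> SL2 \<and> T \<inter> \<Union>\<C> = {} \<and> T \<inter> U \<noteq> {}"
    show "T \<subseteq> U"
    proof (rule ccontr)
      assume "\<not> T \<subseteq> U"
      then have "T - U \<noteq> {}" by blast
      moreover have "connectedin AdS_top T" using T by (simp add: AdS_top_def connectedin_subtopology)
      ultimately have "T \<inter> AdS_top frontier_of U \<noteq> {}" using T by (intro connectedin_Int_frontier_of) auto
      then show False using T frU by blast
    qed
  qed
  have tile: "tile e D (f ` U)"
    unfolding tile_def
  proof (intro conjI)
    have "closed Q" if Q: "Q \<in> \<C>" for Q
    proof -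
      obtain e' where "Q = (\<lambda>h. G Q \<cdot>\<^sub>m h \<cdot>\<^sub>m minv (K Q)) ` cplane e'" using GK[OF Q] by blast
      then show ?thesis using closed_bimul_image[OF _ _ closed_cplane, of "G Q" "K Q" e'] GK[OF Q] by metis
    qed
    then have "closed (\<Union>(\<C> - {P}))" using \<C>(1) by (intro closed_Union) auto
    then show "closed D" unfolding D_def im by (rule closed_vimage[OF _ cont(2)])
    have injf: "inj f" by (rule inj_on_inverseI[of _ f']) (rule ff')
    \<comment> \<open>Here disjointness of the planes enters: near P no other plane
      interferes.\<close>
    have "\<Union>(\<C> - {P}) \<inter> P = {}" using \<C>(3) P(1) unfolding pairwise_def disjnt_def by blast
    then show "D \<inter> cplane e = {}" unfolding D_def fP[symmetric] image_Int[OF injf, symmetric] by simp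
    show "f ` U \<subseteq> SL2" using U_SL fSL by blast
    have "U \<inter> P = {}" using fr' P(1) by blast
    then show "f ` U \<inter> cplane e = {}" unfolding fP[symmetric] image_Int[OF injf, symmetric] by simp
    have "connsat (f ` \<Union>\<C>) (f ` U)"
      by (rule connsat_image[OF sat_U cont(2)]) (use ff' fSL in auto)
    moreover have "f ` \<Union>\<C> = cplane e \<union> D"
    proof -
      have "\<Union>\<C> = P \<union> \<Union>(\<C> - {P})" using P(1) by blast
      then show ?thesis unfolding D_def fP[symmetric] by (metis image_Un)
    qed
    ultimately show "connsat (cplane e \<union> D) (f ` U)" by simp
    show "\<forall>x\<in>f ` U. mneg x \<in> f ` U"
    proof
      fix x assume "x \<in> f ` U"
      then obtain u where u: "u \<in> U" "x = f u" by blast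
      have "mneg x = f (mneg u)" by (simp add: u f_def mneg_mmul)
      then show "mneg x \<in> f ` U" using U_neg[OF u(1)] by blast
    qed
  qed
  have J: "J \<in> closure (f ` U)"
  proof (rule tile_J[OF e tile])
    show "f z \<in> cplane e" using P(2) fP by blast
    have nV: "z \<noteq> g \<cdot>\<^sub>m minv k" "z \<noteq> mneg (g \<cdot>\<^sub>m minv k)" using z(2) P(1) by (auto simp: V_def gkP)
    have "f' (1,0,0,1) = g \<cdot>\<^sub>m minv k" "f' (-1,0,0,-1) = mneg (g \<cdot>\<^sub>m minv k)"
      unfolding f'_def neg_one by simp_all
    then show "f z \<noteq> (1,0,0,1)" "f z \<noteq> (-1,0,0,-1)" using nV ff'(2)[of z] by metis+
    show "f z \<in> closure (f ` U)" by (rule closure_image_mem[OF cont(1) zU])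
  qed
  obtain p q r s where k: "k = (p,q,r,s)" by (cases k)
  have det: "p * s - q * r = 1" using gk(2) by (simp add: k SL2_iff)
  show False
  proof (rule tile_no_crossing_False[OF e tile J det])
    fix m n :: int and \<sigma> :: real and x
    assume mn: "(m,n) \<noteq> (0,0)" and \<sigma>: "\<sigma> = 1 \<or> \<sigma> = -1" and "x \<in> f ` U"
    then obtain u where u: "u \<in> U" "x = f u" by blast
    define h where "h = unipotent \<sigma> (real_of_int m) (real_of_int n)"
    obtain \<gamma> where \<gamma>: "\<gamma> \<in> sanov" "\<gamma> \<noteq> (1,0,0,1)" "rmat \<gamma> = h \<or> rmat \<gamma> = mneg h"
      using unipotent_sanov[OF mn \<sigma>] unfolding h_def by metis
    \<comment> \<open>Only one of +-h is in the group; the symmetry of U covers both signs.\<close>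
    have "u \<cdot>\<^sub>m h \<notin> U"
    proof
      assume uh: "u \<cdot>\<^sub>m h \<in> U"
      then have "mneg (u \<cdot>\<^sub>m h) \<in> U" by (rule U_neg)
      then have "u \<cdot>\<^sub>m rmat \<gamma> \<in> U" using uh \<gamma>(3) by (auto simp: mneg_mmul)
      then show False using U_move[OF \<gamma>(1,2) u(1)] by simp
    qed
    moreover have "x \<cdot>\<^sub>m unipotent \<sigma> (s * real_of_int m - q * real_of_int n) (p * real_of_int n - r * real_of_int m)
        = f (u \<cdot>\<^sub>m h)"
      unfolding unipotent_conj[OF det, symmetric] k[symmetric] h_def[symmetric] u(2) f_def
      using gk(2) by (simp add: mmul_assoc mmul_minv_cancel)
    ultimately show "x \<cdot>\<^sub>m unipotent \<sigma> (s * real_of_int m - q * real_of_int n) (p * real_of_int n - r * real_of_int m)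
        \<notin> f ` U"
      using ff'(2) by (metis imageE)
  qed
qed

theorem theorem1p1:
  shows "\<exists>(\<Gamma> :: nat monoid) (\<alpha> :: nat \<Rightarrow> mat2 \<Rightarrow> mat2).
           fin_gen_free_group \<Gamma> \<and> isometric_action \<Gamma> \<alpha> \<and> properly_discontinuous \<Gamma> \<alpha> \<and>
           \<not> (\<exists>R. crooked_fundamental_domain \<Gamma> \<alpha> R)"
proof (intro exI conjI)
  show "fin_gen_free_group sanov_group" by (rule fin_gen_free_sanov_group)
  show "isometric_action sanov_group act" by (rule isometric_act)
  show "properly_discontinuous sanov_group act" by (rule properly_discontinuous_act)
  show "\<not> (\<exists>R. crooked_fundamental_domain sanov_group act R)"
    by (intro notI, elim exE) (rule notE[OF no_crooked_fundamental_domain])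
qed

end
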